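(* For any open chain linkage $\mathcal L$, the space $\mathrm{NCConf}_0(\mathcal L)$ of noncrossing configurations is connected. For any closed chain linkage $\mathcal L$, $\mathrm{NCConf}_0(\mathcal L)$ has at most two connected components.
   Context: A linkage is a pair $\mathcal L=(G,\ell)$ with $G=(V,E)$ a finite graph and $\ell:E\to\mathbb R_{\ge0}$ (edges are bars; zero lengths allowed). It is an open chain if $G$ is a path and a closed chain if $G$ is a cycle. A configuration is a map $C:V\to\mathbb R^2$ with $|C(v)-C(w)|=\ell(v,w)$ for every bar; $\mathrm{Conf}_0(\mathcal L)$ is the set of configurations. Two linkages $(G_1,\ell_1),(G_2,\ell_2)$ are $\epsilon$-related if $G_1=G_2$ and $|\ell_1(e)-\ell_2(e)|\le\epsilon$ for all $e$. A configuration $C$ of a linkage $\mathcal L'=(G,\ell')$ is nontouching if no two bars intersect except at endpoints, and two vertices have the same position iff they are joined in $G$ by a path of bars of $\ell'$-length zero (such vertices are regarded as merged). $\mathrm{NConf}_\epsilon(\mathcal L)$ is the set of nontouching configurations of linkages $\epsilon$-related to $\mathcal L$. Order function: for oriented segments $e_1,e_2$, in coordinates where $e_1$ runs from $(0,0)$ to $(l,0)$, $d_\pm(e_1,e_2)=\mathrm{len}\{x\in[0,l]:\exists y,\ \pm y\ge0,\ (x,y)\in e_2\}$ and $\mathrm{Ord}(e_1,e_2)=d_+-d_-$. Edges carry fixed canonical orientations; $\mathrm{Annot}_{\mathcal L}(C)=(C,A)$ with $A_{i,j}=\mathrm{Ord}(C(e_i),C(e_j))$. Noncrossing configurations: $\mathrm{NCConf}_0(\mathcal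 L)=\big(\mathrm{Conf}_0(\mathcal L)\times\mathbb R^{E\times E}\big)\cap\overline{\mathrm{Annot}_{\mathcal L}(\mathrm{NConf}_1(\mathcal L))}$, the closure taken in $(\mathbb R^2)^V\times\mathbb R^{E\times E}$ with its usual topology. *)

theory Defs
  imports "HOL-Analysis.Analysis"
begin

text \<open>A linkage is given by a finite vertex set V, an edge index set E,
  canonical orientations (edge e runs from vertex src e to vertex tgt e) and
  lengths l :: nat => real.  Points of the plane are complex numbers.
  Configurations are functions nat => complex that vanish outside V, annotation
  matrices are functions nat * nat => real that vanish outside E x E; so the
  ambient space (R^2)^V x R^(E x E) is the subspace of
  (nat => complex) x (nat * nat => real) (product topology) of such functions,
  whose subspace topology is the usual Euclidean one.\<close>

definition Conf0 :: "nat set \<Rightarrow> nat set \<Rightarrow> (nat \<Rightarrow> nat) \<Rightarrow> (nat \<Rightarrow> nat)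
    \<Rightarrow> (nat \<Rightarrow> real) \<Rightarrow> (nat \<Rightarrow> complex) set" where
  "Conf0 V E src tgt l =
     {C. (\<forall>v. v \<notin> V \<longrightarrow> C v = 0) \<and> (\<forall>e\<in>E. cmod (C (tgt e) - C (src e)) = l e)}"

definition Matrices :: "nat set \<Rightarrow> (nat \<times> nat \<Rightarrow> real) set" where
  "Matrices E = {A. \<forall>p. p \<notin> E \<times> E \<longrightarrow> A p = 0}"

text \<open>Order function of oriented segments p->q (e1) and a->b (e2): rotate/translate
  so that e1 runs from 0 to (L,0), L = |q-p|.\<close>
definition Ord :: "complex \<Rightarrow> complex \<Rightarrow> complex \<Rightarrow> complex \<Rightarrow> real" where
  "Ord p q a b =
     (let L = cmod (q - p);
          seg = (\<lambda>z. (z - p) * cnj (sgn (q - p))) ` closed_segment a b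
      in measure lebesgue {x \<in> {0..L}. \<exists>y. y \<ge> 0 \<and> Complex x y \<in> seg}
       - measure lebesgue {x \<in> {0..L}. \<exists>y. - y \<ge> 0 \<and> Complex x y \<in> seg})"

definition Annot :: "nat set \<Rightarrow> (nat \<Rightarrow> nat) \<Rightarrow> (nat \<Rightarrow> nat) \<Rightarrow> (nat \<Rightarrow> complex)
    \<Rightarrow> (nat \<Rightarrow> complex) \<times> (nat \<times> nat \<Rightarrow> real)" where
  "Annot E src tgt C =
     (C, \<lambda>(i, j). if i \<in> E \<and> j \<in> E
                  then Ord (C (src i)) (C (tgt i)) (C (src j)) (C (tgt j)) else 0)"

definition zero_joined :: "nat set \<Rightarrow> (nat \<Rightarrow> nat) \<Rightarrow> (nat \<Rightarrow> nat) \<Rightarrow> (nat \<Rightarrow> real)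
    \<Rightarrow> nat \<Rightarrow> nat \<Rightarrow> bool" where
  "zero_joined E src tgt l' =
     (\<lambda>a b. \<exists>e\<in>E. l' e = 0 \<and> ((src e = a \<and> tgt e = b) \<or> (src e = b \<and> tgt e = a)))\<^sup>*\<^sup>*"

definition nontouching :: "nat set \<Rightarrow> nat set \<Rightarrow> (nat \<Rightarrow> nat) \<Rightarrow> (nat \<Rightarrow> nat)
    \<Rightarrow> (nat \<Rightarrow> real) \<Rightarrow> (nat \<Rightarrow> complex) \<Rightarrow> bool" where
  "nontouching V E src tgt l' C \<longleftrightarrow>
     C \<in> Conf0 V E src tgt l' \<and>
     (\<forall>e\<in>E. \<forall>f\<in>E. e \<noteq> f \<longrightarrow>
        closed_segment (C (src e)) (C (tgt e)) \<inter> closed_segment (C (src f)) (C (tgt f))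
          \<subseteq> {C (src e), C (tgt e)} \<inter> {C (src f), C (tgt f)}) \<and>
     (\<forall>v\<in>V. \<forall>w\<in>V. C v = C w \<longleftrightarrow> zero_joined E src tgt l' v w)"

definition NConf :: "real \<Rightarrow> nat set \<Rightarrow> nat set \<Rightarrow> (nat \<Rightarrow> nat) \<Rightarrow> (nat \<Rightarrow> nat)
    \<Rightarrow> (nat \<Rightarrow> real) \<Rightarrow> (nat \<Rightarrow> complex) set" where
  "NConf \<epsilon> V E src tgt l =
     {C. \<exists>l'. (\<forall>e\<in>E. 0 \<le> l' e \<and> \<bar>l' e - l e\<bar> \<le> \<epsilon>) \<and> nontouching V E src tgt l' C}"

definition NCConf0 :: "nat set \<Rightarrow> nat set \<Rightarrow> (nat \<Rightarrow> nat) \<Rightarrow> (nat \<Rightarrow> nat)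
    \<Rightarrow> (nat \<Rightarrow> real) \<Rightarrow> ((nat \<Rightarrow> complex) \<times> (nat \<times> nat \<Rightarrow> real)) set" where
  "NCConf0 V E src tgt l =
     (Conf0 V E src tgt l \<times> Matrices E) \<inter> closure (Annot E src tgt ` NConf 1 V E src tgt l)"

definition open_chain_NCConf :: "nat \<Rightarrow> (nat \<Rightarrow> real) \<Rightarrow> _" where
  "open_chain_NCConf n l = NCConf0 {..n} {..<n} (\<lambda>i. i) Suc l"

definition closed_chain_NCConf :: "nat \<Rightarrow> (nat \<Rightarrow> real) \<Rightarrow> _" where
  "closed_chain_NCConf n l = NCConf0 {..<n} {..<n} (\<lambda>i. i) (\<lambda>i. Suc i mod n) l"

end

theory Submission
  imports Defs
begin

text \<open>
  Let the bar lengths of a chain vary in open intervals. On every component of the resulting space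
  of nontouching configurations, the sum of the reciprocals of certain gaps, which grow with the distances
  between vertices that are not joined by a bar, attains its minimum. The minimiser carries an
  equilibrium stress that is positive on all pairs of vertices except possibly the bars. Since at
  most two bars meet in a point, the maximum principle shows that the Maxwell--Cremona lift of this
  stress is nonpositive, and this leaves only straight open chains and convex polygons. So
  the space is connected for open chains, and for closed chains every component meets the set of
  convex polygons of one of the two orientations. Each of these sets is connected: move the
  directions of the bars freely and restore the closing condition by the unique suitable
  Moebius transformation of the unit disc.

  Up to translation, the noncrossing configurations are the intersection over \<open>\<epsilon>\<close> of the closures
  of the annotated nontouching configurations with positive lengths within \<open>\<epsilon>\<close> of the given ones; bars
  of length zero can be opened by a small motion, and \<open>Ord\<close> is continuous on segments that meet
  only in common end points. A decreasing intersection of compact connected sets is connected.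
\<close>

section \<open>The lift of an equilibrium stress\<close>

text \<open>No flow that expands the chain is constructed. Apart from bar terms, every gap has
  nonnegative coefficients on the distances between vertices, so a minimiser of the energy cannot be
  expanded any further; the dual certificate of this is the stress. Letting the bar lengths range
  over open intervals makes the pinned configuration space open, so criticality can be tested by
  moving one vertex at a time, and a bar needs no multiplier: its stress merely has no prescribed
  sign. Hence the lift is convex across struts and may be concave only across bars, and the maximum
  principle has to cope with at most two concave creases at a point. The stressed framework is the
  complete graph, whose struts cross one another and the bars; the lift is therefore a sum over the
  segments below a point, which makes sense in the presence of crossings. Flat configurations escape
  the convexity argument; they are exactly what remains for open chains and are impossible for
  closed ones. For convex polygons the centre of the Moebius transformation is the conformal
  barycentre of the weighted directions; its uniqueness, together with a bound away from the unit
  circle, makes it depend continuously on the data.\<close>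

definition cr :: "complex \<Rightarrow> complex \<Rightarrow> real" where
  "cr a b = Re a * Im b - Im a * Re b"

lemma cr_simps [simp]: "cr 0 b = 0" "cr a 0 = 0" "cr a a = 0"
  by (auto simp: cr_def)

lemma cr_add_left: "cr (a + b) c = cr a c + cr b c"
  and cr_add_right: "cr c (a + b) = cr c a + cr c b"
  and cr_diff_left: "cr (a - b) c = cr a c - cr b c"
  and cr_diff_right: "cr c (a - b) = cr c a - cr c b"
  and cr_scale_left: "cr (t *\<^sub>R a) c = t * cr a c"
  and cr_scale_right: "cr c (t *\<^sub>R a) = t * cr c a"
  and cr_minus_left: "cr (- a) c = - cr a c"
  and cr_minus_right: "cr c (- a) = - cr c a"
  by (simp_all add: cr_def algebra_simps)

lemma cr_commute: "cr a b = - cr b a"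
  by (simp add: cr_def algebra_simps)

lemma cr_sum_left: "cr (sum f A) c = (\<Sum>i\<in>A. cr (f i) c)"
  by (induction A rule: infinite_finite_induct) (auto simp: cr_add_left)

lemma cr_sum_right: "cr c (sum f A) = (\<Sum>i\<in>A. cr c (f i))"
  by (induction A rule: infinite_finite_induct) (auto simp: cr_add_right)

lemma continuous_on_cr [continuous_intros]:
  "continuous_on S f \<Longrightarrow> continuous_on S g \<Longrightarrow> continuous_on S (\<lambda>x. cr (f x) (g x))"
  unfolding cr_def by (intro continuous_intros)

text \<open>Serves to confront the two contributions \<open>H v j\<close> and \<open>H j v\<close>
  of one segment, which tend to cancel for a symmetric stress; the injective \<open>x\<close>
  orients each segment from left to right.\<close>

lemma sum_offdiag_pairs:
  fixes x :: "'a \<Rightarrow> real" and H :: "'a \<Rightarrow> 'a \<Rightarrow> real"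
  assumes "finite V" "inj_on x V" "\<And>v. v \<in> V \<Longrightarrow> H v v = 0"
  shows "(\<Sum>v\<in>V. \<Sum>j\<in>V. H v j) = (\<Sum>(v,j)\<in>{(v,j)\<in>V\<times>V. x v < x j}. H v j + H j v)"
proof -
  let ?A = "{(v,j)\<in>V\<times>V. x v < x j}" and ?B = "{(v,j)\<in>V\<times>V. x j < x v}" and ?C = "{(v,j)\<in>V\<times>V. v = j}"
  have fin: "finite ?A" "finite ?B" "finite ?C"
    using assms(1) by (auto intro: finite_subset[of _ "V\<times>V"])
  have un: "V \<times> V = (?A \<union> ?B) \<union> ?C"
  proof -
    have "x v < x j \<or> x j < x v \<or> v = j" if "v \<in> V" "j \<in> V" for v j
      using assms(2) that by (metis inj_onD linorder_less_linear)
    then show ?thesis by auto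
  qed
  have "(\<Sum>v\<in>V. \<Sum>j\<in>V. H v j) = (\<Sum>(v,j)\<in>V\<times>V. H v j)"
    by (simp add: sum.cartesian_product)
  also have "\<dots> = (\<Sum>(v,j)\<in>?A \<union> ?B. H v j) + (\<Sum>(v,j)\<in>?C. H v j)"
    by (subst un, subst sum.union_disjoint) (use fin in auto)
  also have "(\<Sum>(v,j)\<in>?C. H v j) = 0"
    by (rule sum.neutral) (use assms(3) in auto)
  also have "(\<Sum>(v,j)\<in>?A \<union> ?B. H v j) = (\<Sum>(v,j)\<in>?A. H v j) + (\<Sum>(v,j)\<in>?B. H v j)"
    by (subst sum.union_disjoint) (use fin in auto)
  also have "(\<Sum>(v,j)\<in>?B. H v j) = (\<Sum>(v,j)\<in>?A. H j v)"
    by (rule sum.reindex_bij_witness[of _ "\<lambda>(a,b). (b,a)" "\<lambda>(a,b). (b,a)"]) auto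
  finally show ?thesis by (simp add: sum.distrib case_prod_unfold)
qed

text \<open>What is kept of a minimiser of the energy. All pairs of vertices carry stress: bars
  (\<open>adj\<close>) of either sign, all other pairs (struts) of positive sign. Only bars are
  required not to cross; struts may cross anything.\<close>

locale stressed =
  fixes V :: "nat set" and adj :: "nat \<Rightarrow> nat \<Rightarrow> bool"
    and w :: "nat \<Rightarrow> nat \<Rightarrow> real" and p :: "nat \<Rightarrow> complex"
  assumes finV: "finite V"
    and inj_p: "inj_on p V"
    and adj_sym: "adj i j \<Longrightarrow> adj j i"
    and deg: "v \<in> V \<Longrightarrow> card {j\<in>V. adj v j} \<le> 2"
    and w_sym: "i \<in> V \<Longrightarrow> j \<in> V \<Longrightarrow> w i j = w j i"
    and equil: "i \<in> V \<Longrightarrow> (\<Sum>j\<in>V. w i j *\<^sub>R (p j - p i)) = 0"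
    and strut: "i \<in> V \<Longrightarrow> j \<in> V \<Longrightarrow> i \<noteq> j \<Longrightarrow> \<not> adj i j \<Longrightarrow> 0 < w i j"
    and bar_vertex: "i \<in> V \<Longrightarrow> j \<in> V \<Longrightarrow> adj i j \<Longrightarrow> v \<in> V \<Longrightarrow>
          p v \<in> closed_segment (p i) (p j) \<Longrightarrow> v = i \<or> v = j"
    and bar_bar: "i \<in> V \<Longrightarrow> j \<in> V \<Longrightarrow> adj i j \<Longrightarrow> k \<in> V \<Longrightarrow> l \<in> V \<Longrightarrow> adj k l \<Longrightarrow> {i,j} \<noteq> {k,l} \<Longrightarrow>
          z \<in> closed_segment (p i) (p j) \<Longrightarrow> z \<in> closed_segment (p k) (p l) \<Longrightarrow> z \<in> p ` V"
begin

lemma equil_cr: "i \<in> V \<Longrightarrow> (\<Sum>j\<in>V. w i j * cr (p j - p i) c) = 0"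
  using arg_cong[OF equil[of i], of "\<lambda>z. cr z c"] by (simp add: cr_sum_left cr_scale_left)

end

text \<open>A vertical line contains at most one vertex, so comparing the two sides of such a line
  only involves equilibrium at a single vertex. A rotation achieves this, see
  \<open>generic_rotation\<close>.\<close>

locale generic_stressed = stressed +
  assumes inj_Re: "inj_on (\<lambda>i. Re (p i)) V"
begin

definition X where "X i = Re (p i)"
text \<open>For \<open>X i < X j\<close> this is \<open>X j - X i\<close> times the height of
  \<open>z\<close> above the line through \<open>p i\<close> and \<open>p j\<close>.\<close>

definition D where "D i j z = cr (p j - p i) (z - p i)"
text \<open>Segments that continue to the right of the vertical line at \<open>x\<close>;
  \<open>PL\<close> has those that arrive from the left. On a line through a vertex the two differ,
  and each belongs to one of the one-sided derivatives of \<open>phi\<close>.\<close>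

definition PR where "PR x = {(i,j)\<in>V\<times>V. X i \<le> x \<and> x < X j}"
definition PL where "PL x = {(i,j)\<in>V\<times>V. X i < x \<and> x \<le> X j}"

text \<open>The Maxwell--Cremona lift: the second derivative of \<open>\<phi>\<close> along a vertical line is
  the stress of the segments that the line crosses.\<close>
definition phi :: "complex \<Rightarrow> real" where
  "phi z = (\<Sum>(i,j)\<in>PR (Re z). w i j * max 0 (D i j z))"

lemma fin_P: "finite (PR x)" "finite (PL x)"
  unfolding PR_def PL_def using finV by (auto intro: finite_subset[of _ "V\<times>V"])

lemma inj_X: "inj_on X V"
  using inj_Re by (simp add: inj_on_def X_def)

lemma D_swap: "cr (p i - p j) (z - p j) = - D i j z"
  by (simp add: D_def cr_def algebra_simps)

text \<open>A segment with both ends left of the line is counted from each end and cancels, one with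
  both ends to the right is not counted; only the segments that cross the line survive, each counted
  from its left end.\<close>

lemma sum_cut:
  fixes H :: "nat \<Rightarrow> nat \<Rightarrow> real"
  assumes "\<And>v j. v \<in> V \<Longrightarrow> j \<in> V \<Longrightarrow> X v < X j \<Longrightarrow> X j \<le> x \<Longrightarrow> H v j + H j v = 0"
    and "\<And>v. v \<in> V \<Longrightarrow> H v v = 0"
  shows "(\<Sum>v\<in>V. if X v \<le> x then \<Sum>j\<in>V. H v j else 0) = (\<Sum>(v,j)\<in>PR x. H v j)"
proof -
  have "(\<Sum>v\<in>V. if X v \<le> x then \<Sum>j\<in>V. H v j else 0) = (\<Sum>v\<in>V. \<Sum>j\<in>V. if X v \<le> x then H v j else 0)"
    by (intro sum.cong) auto
  also have "\<dots> = (\<Sum>(v,j)\<in>{(v,j)\<in>V\<times>V. X v < X j}. (if X v \<le> x then H v j else 0) + (if X j \<le> x then H j v else 0))"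
    by (rule sum_offdiag_pairs[OF finV inj_X, where H = "\<lambda>v j. if X v \<le> x then H v j else 0"])
      (use assms(2) in auto)
  also have "\<dots> = (\<Sum>(v,j)\<in>PR x. H v j)"
  proof (rule sum.mono_neutral_cong_right)
    show "finite {(v,j)\<in>V\<times>V. X v < X j}"
      using finV by (auto intro: finite_subset[of _ "V\<times>V"])
    show "PR x \<subseteq> {(v,j)\<in>V\<times>V. X v < X j}" by (auto simp: PR_def)
    show "\<forall>q\<in>{(v,j)\<in>V\<times>V. X v < X j} - PR x.
        (case q of (v,j) \<Rightarrow> (if X v \<le> x then H v j else 0) + (if X j \<le> x then H j v else 0)) = 0"
      using assms(1) by (auto simp: PR_def split: if_splits)
  qed (auto simp: PR_def)
  finally show ?thesis .
qed

text \<open>Made so that a segment seen from its right end contributes the negative of what it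
  contributes from its left end, which is the cancellation that \<open>sum_cut\<close> asks
  for.\<close>

definition kap where "kap d u = (if Re d > 0 then max 0 (cr d u) else min 0 (cr d u))"

text \<open>Gives continuity, which is not visible in \<open>phi\<close> because its index set jumps
  at every vertex. Here the index set is fixed and every term is continuous: left of
  \<open>v\<close> the horizontal offset is clamped to 0, and equilibrium at \<open>v\<close> makes
  the terms of \<open>v\<close> add up to zero.\<close>

lemma phi_vertex_form:
  "phi z = (\<Sum>v\<in>V. \<Sum>j\<in>V. w v j * kap (p j - p v) (Complex (max 0 (Re z - X v)) (Im z - Im (p v))))"
proof -
  have "(\<Sum>j\<in>V. w v j * kap (p j - p v) (Complex (max 0 (Re z - X v)) (Im z - Im (p v))))
     = (if X v \<le> Re z then \<Sum>j\<in>V. w v j * kap (p j - p v) (z - p v) else 0)" if v: "v \<in> V" for v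
  proof (cases "X v \<le> Re z")
    case True
    then have "Complex (max 0 (Re z - X v)) (Im z - Im (p v)) = z - p v"
      by (auto simp: complex_eq_iff X_def)
    then show ?thesis using True by simp
  next
    case False
    \<comment> \<open>For a vertical offset pointing up, \<open>kap d u\<close> is
      \<open>cr d u\<close> for every \<open>d\<close>, so the sum is a moment of the balanced
      forces at \<open>v\<close>; for one pointing down every term is 0.\<close>
    define u where "u = Complex 0 (Im z - Im (p v))"
    have u: "Complex (max 0 (Re z - X v)) (Im z - Im (p v)) = u"
      using False by (simp add: u_def)
    have "(\<Sum>j\<in>V. w v j * kap (p j - p v) u) = 0"
    proof (cases "Im z \<ge> Im (p v)")
      case True
      then have "kap d u = cr d u" for d
        by (auto simp: kap_def cr_def u_def zero_le_mult_iff mult_le_0_iff max_def min_def)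
      then show ?thesis using equil_cr[OF v] by simp
    next
      case False
      then have "kap d u = 0" for d
        by (auto simp: kap_def cr_def u_def zero_le_mult_iff mult_le_0_iff max_def min_def)
      then show ?thesis by simp
    qed
    then show ?thesis using False u by simp
  qed
  then have "(\<Sum>v\<in>V. \<Sum>j\<in>V. w v j * kap (p j - p v) (Complex (max 0 (Re z - X v)) (Im z - Im (p v))))
    = (\<Sum>v\<in>V. if X v \<le> Re z then \<Sum>j\<in>V. w v j * kap (p j - p v) (z - p v) else 0)"
    by (intro sum.cong) auto
  also have "\<dots> = (\<Sum>(v,j)\<in>PR (Re z). w v j * kap (p j - p v) (z - p v))"
  proof (rule sum_cut)
    fix v j assume vj: "v \<in> V" "j \<in> V" "X v < X j"
    have k1: "kap (p j - p v) (z - p v) = max 0 (D v j z)"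
      using vj(3) by (simp add: kap_def X_def D_def)
    have k2: "kap (p v - p j) (z - p j) = - max 0 (D v j z)"
      unfolding kap_def D_swap[of v j z] using vj(3) by (simp add: X_def max_def min_def)
    show "w v j * kap (p j - p v) (z - p v) + w j v * kap (p v - p j) (z - p j) = 0"
      unfolding k1 k2 w_sym[OF vj(1,2)] by simp
  qed (simp add: kap_def)
  also have "\<dots> = phi z"
    unfolding phi_def by (rule sum.cong) (auto simp: PR_def kap_def X_def D_def)
  finally show ?thesis by simp
qed

lemma continuous_on_kap:
  assumes "continuous_on T f"
  shows "continuous_on T (\<lambda>z. kap d (f z))"
proof (cases "Re d > 0")
  case True
  have "continuous_on T (\<lambda>z. max 0 (cr d (f z)))"
    by (intro continuous_on_max continuous_on_const continuous_on_cr assms)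
  then show ?thesis unfolding kap_def if_P[OF True] .
next
  case False
  have "continuous_on T (\<lambda>z. min 0 (cr d (f z)))"
    by (intro continuous_on_min continuous_on_const continuous_on_cr assms)
  then show ?thesis unfolding kap_def if_not_P[OF False] .
qed

lemma continuous_on_phi: "continuous_on S phi"
proof -
  have c: "continuous_on S (\<lambda>z. Complex (max 0 (Re z - a)) (Im z - b))" for a b
    unfolding Complex_eq by (intro continuous_intros)
  have "continuous_on S (\<lambda>z. \<Sum>v\<in>V. \<Sum>j\<in>V. w v j * kap (p j - p v) (Complex (max 0 (Re z - X v)) (Im z - Im (p v))))"
    by (intro continuous_on_sum continuous_on_mult continuous_on_const continuous_on_kap c)
  then show ?thesis by (simp only: phi_vertex_form[symmetric])
qed

lemma D_decomp:
  "D i j z = (X j - Re z) * (Im z - Im (p i)) + (Re z - X i) * (Im z - Im (p j))"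
  by (simp add: D_def X_def cr_def algebra_simps)

text \<open>Above all vertices no positive part is cut off, and \<open>phi z\<close> is the total
  moment about \<open>z\<close> of the forces at the vertices left of \<open>z\<close>, each of
  which is balanced.\<close>

lemma phi_high:
  assumes "\<And>v. v \<in> V \<Longrightarrow> Im (p v) \<le> Im z"
  shows "phi z = 0"
proof -
  have "phi z = (\<Sum>(i,j)\<in>PR (Re z). w i j * cr (p j - p i) (z - p i))"
    unfolding phi_def
  proof (rule sum.cong, simp, clarify)
    fix i j assume ij: "(i,j) \<in> PR (Re z)"
    have "0 \<le> D i j z"
      unfolding D_decomp using ij assms[of i] assms[of j]
      by (intro add_nonneg_nonneg mult_nonneg_nonneg) (auto simp: PR_def)
    then show "w i j * max 0 (D i j z) = w i j * cr (p j - p i) (z - p i)"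
      by (simp add: D_def)
  qed
  also have "\<dots> = (\<Sum>v\<in>V. if X v \<le> Re z then \<Sum>j\<in>V. w v j * cr (p j - p v) (z - p v) else 0)"
  proof (rule sum_cut[symmetric])
    fix v j assume "v \<in> V" "j \<in> V"
    then show "w v j * cr (p j - p v) (z - p v) + w j v * cr (p v - p j) (z - p j) = 0"
      using w_sym[of v j] D_swap[of v j z] by (simp add: D_def)
  qed simp
  also have "\<dots> = 0" by (rule sum.neutral) (simp add: equil_cr)
  finally show ?thesis .
qed

lemma phi_low:
  assumes "\<And>v. v \<in> V \<Longrightarrow> Im z \<le> Im (p v)"
  shows "phi z = 0"
  unfolding phi_def
proof (rule sum.neutral, clarify)
  fix i j assume ij: "(i,j) \<in> PR (Re z)"
  have "(X j - Re z) * (Im z - Im (p i)) \<le> 0" "(Re z - X i) * (Im z - Im (p j)) \<le> 0"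
    using ij assms[of i] assms[of j] by (auto simp: PR_def mult_le_0_iff)
  then show "w i j * max 0 (D i j z) = 0" by (simp add: D_decomp)
qed

lemma phi_side:
  assumes "(\<forall>v\<in>V. X v \<le> Re z) \<or> (\<forall>v\<in>V. Re z < X v)"
  shows "phi z = 0"
proof -
  have "PR (Re z) = {}" using assms by (force simp: PR_def)
  then show ?thesis by (simp add: phi_def)
qed


text \<open>The two index sets differ only in the segments at the one vertex on the line. If
  \<open>f\<close> is there a common multiple of the moments of the forces at that vertex, with
  opposite signs on the two sides, equilibrium makes both parts equal.\<close>

lemma sum_PR_eq_PL:
  assumes "\<And>v j. v \<in> V \<Longrightarrow> j \<in> V \<Longrightarrow> X v = x \<Longrightarrow> x < X j \<Longrightarrow> f (v,j) = k v * (w v j * cr (p j - p v) (c v))"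
    and "\<And>v i. v \<in> V \<Longrightarrow> i \<in> V \<Longrightarrow> X v = x \<Longrightarrow> X i < x \<Longrightarrow> f (i,v) = - (k v * (w v i * cr (p i - p v) (c v)))"
  shows "sum f (PR x) = sum f (PL x)"
proof -
  let ?C = "{(i,j)\<in>V\<times>V. X i < x \<and> x < X j}"
  let ?R = "{(v,j)\<in>V\<times>V. X v = x \<and> x < X j}"
  let ?L = "{(i,v)\<in>V\<times>V. X i < x \<and> X v = x}"
  have fin: "finite ?C" "finite ?R" "finite ?L"
    using finV by (auto intro: finite_subset[of _ "V\<times>V"])
  have "sum f (PR x) = sum f (?C \<union> ?R)" by (rule sum.cong) (auto simp: PR_def)
  also have "\<dots> = sum f ?C + sum f ?R" by (rule sum.union_disjoint) (use fin in auto)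
  finally have 1: "sum f (PR x) = sum f ?C + sum f ?R" .
  have "sum f (PL x) = sum f (?C \<union> ?L)" by (rule sum.cong) (auto simp: PL_def)
  also have "\<dots> = sum f ?C + sum f ?L" by (rule sum.union_disjoint) (use fin in auto)
  finally have 2: "sum f (PL x) = sum f ?C + sum f ?L" .
  have "sum f ?R = sum f ?L"
  proof (cases "\<exists>v\<in>V. X v = x")
    case False
    then have e: "?R = {}" "?L = {}" by auto
    show ?thesis by (simp only: e)
  next
    case True
    then obtain v where v: "v \<in> V" "X v = x" by auto
    have uniq: "u = v" if "u \<in> V" "X u = x" for u
      using inj_X v that by (auto dest: inj_onD)
    have R: "?R = Pair v ` {j\<in>V. x < X j}" and L: "?L = (\<lambda>i. (i,v)) ` {i\<in>V. X i < x}"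
      using v by (auto dest: uniq)
    have sR: "sum f ?R = (\<Sum>j\<in>{j\<in>V. x < X j}. k v * (w v j * cr (p j - p v) (c v)))"
      unfolding R by (subst sum.reindex) (auto simp: inj_on_def assms(1) v intro!: sum.cong)
    have sL: "sum f ?L = (\<Sum>j\<in>{j\<in>V. X j < x}. - (k v * (w v j * cr (p j - p v) (c v))))"
      unfolding L by (subst sum.reindex) (auto simp: inj_on_def assms(2) v intro!: sum.cong)
    have "0 = k v * (\<Sum>j\<in>V. w v j * cr (p j - p v) (c v))"
      using equil_cr[OF v(1)] by simp
    also have "\<dots> = (\<Sum>j\<in>V. k v * (w v j * cr (p j - p v) (c v)))" by (simp add: sum_distrib_left)
    also have "\<dots> = (\<Sum>j\<in>{j\<in>V. x < X j} \<union> {j\<in>V. X j < x}. k v * (w v j * cr (p j - p v) (c v)))"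
    proof (rule sum.mono_neutral_right)
      show "\<forall>i\<in>V - ({j \<in> V. x < X j} \<union> {j \<in> V. X j < x}). k v * (w v i * cr (p i - p v) (c v)) = 0"
      proof
        fix i assume "i \<in> V - ({j \<in> V. x < X j} \<union> {j \<in> V. X j < x})"
        then have "i = v" by (intro uniq) auto
        then show "k v * (w v i * cr (p i - p v) (c v)) = 0" by simp
      qed
    qed (use finV in auto)
    also have "\<dots> = sum f ?R - sum f ?L"
      unfolding sR sL sum_negf by (subst sum.union_disjoint) (use finV in auto)
    finally show ?thesis by simp
  qed
  then show ?thesis using 1 2 by simp
qed

lemma D_right: "X v = Re z \<Longrightarrow> D v j z = (X j - Re z) * (Im z - Im (p v))"
  and D_left: "X v = Re z \<Longrightarrow> D i v z = (Re z - X i) * (Im z - Im (p v))"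
  by (simp_all add: D_decomp)

lemma cr_diff_swap: "cr (a - b) c = - cr (b - a) c"
  by (simp add: cr_def algebra_simps)

text \<open>For every segment at a vertex \<open>v\<close> straight above or below \<open>z\<close>,
  or at \<open>z\<close>, the value \<open>D\<close> is a positive multiple of the height of
  \<open>z\<close> over \<open>p v\<close>. A test \<open>Pr\<close> that ignores positive factors
  thus accepts all of these segments or none.\<close>

lemma match:
  assumes "\<And>s y. 0 < s \<Longrightarrow> Pr (s * y) = Pr y"
  shows "(\<Sum>(i,j)\<in>PR (Re z). if Pr (D i j z) then w i j * cr (p j - p i) c else 0)
   = (\<Sum>(i,j)\<in>PL (Re z). if Pr (D i j z) then w i j * cr (p j - p i) c else 0)"
proof (rule sum_PR_eq_PL[where k = "\<lambda>v. if Pr (Im z - Im (p v)) then 1 else 0" and c = "\<lambda>v. c"], goal_cases)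
  case (1 v j)
  then show ?case by (simp add: D_right assms)
next
  case (2 v i)
  then show ?case by (simp add: D_left assms w_sym[of i v] cr_diff_swap[of "p v" "p i"])
qed

lemma phi_PL: "phi z = (\<Sum>(i,j)\<in>PL (Re z). w i j * max 0 (D i j z))"
  unfolding phi_def
proof (rule sum_PR_eq_PL[where k = "\<lambda>v. if 0 < Im z - Im (p v) then 1 else 0" and c = "\<lambda>v. z - p v"], goal_cases)
  case (1 v j)
  have eq: "cr (p j - p v) (z - p v) = D v j z" by (simp add: D_def)
  have "0 < D v j z \<longleftrightarrow> 0 < Im z - Im (p v)" using 1 by (simp add: D_right zero_less_mult_iff)
  then show ?case unfolding eq by (auto simp: max_def)
next
  case (2 v i)
  have eq: "cr (p i - p v) (z - p v) = - D i v z" by (rule D_swap)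
  have "0 < D i v z \<longleftrightarrow> 0 < Im z - Im (p v)" using 2 by (simp add: D_left zero_less_mult_iff)
  then show ?case unfolding eq using w_sym[of i v] 2 by (auto simp: max_def)
qed

section \<open>One-sided derivatives of the lift\<close>

definition dd where "dd i j s = cr (p j - p i) (Complex 1 s)"

text \<open>\<open>rr\<close> and \<open>ll\<close> are the derivatives of \<open>phi\<close> at
  \<open>z\<close> in the directions \<open>Complex 1 s\<close> and \<open>- Complex 1 s\<close>:
  segments strictly below \<open>z\<close> contribute linearly (\<open>Lam\<close>), segments
  through \<open>z\<close> with the positive part only; \<open>Gam\<close> is what the latter would
  contribute linearly.\<close>

definition Lam where "Lam z s = (\<Sum>(i,j)\<in>PR (Re z). if D i j z > 0 then w i j * dd i j s else 0)"
definition Gam where "Gam z s = (\<Sum>(i,j)\<in>PR (Re z). if D i j z = 0 then w i j * dd i j s else 0)"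
definition rr where "rr z s = Lam z s + (\<Sum>(i,j)\<in>PR (Re z). if D i j z = 0 then w i j * max 0 (dd i j s) else 0)"
definition ll where "ll z s = - Lam z s + (\<Sum>(i,j)\<in>PL (Re z). if D i j z = 0 then w i j * max 0 (- dd i j s) else 0)"

lemma Lam_PL: "Lam z s = (\<Sum>(i,j)\<in>PL (Re z). if D i j z > 0 then w i j * dd i j s else 0)"
  unfolding Lam_def dd_def by (rule match) (simp add: zero_less_mult_iff)

lemma Gam_PL: "Gam z s = (\<Sum>(i,j)\<in>PL (Re z). if D i j z = 0 then w i j * dd i j s else 0)"
  unfolding Gam_def dd_def by (rule match) simp

lemma max_diff_neg: "max 0 (d::real) = d + max 0 (- d)" "max 0 (- d) = - d + max 0 d" by auto

text \<open>Exchanges the positive parts for negative ones at the price of a linear term. This makes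
  it possible to choose on which side of the direction the segments through \<open>z\<close> are
  charged, and so to avoid a bar of unknown sign.\<close>

lemma rr_upper: "rr z s = Lam z s + Gam z s + (\<Sum>(i,j)\<in>PR (Re z). if D i j z = 0 then w i j * max 0 (- dd i j s) else 0)"
  unfolding rr_def Gam_def add.assoc sum.distrib[symmetric]
proof (intro arg_cong2[where f = "(+)"] sum.cong refl, clarify)
  fix i j
  have "w i j * max 0 (dd i j s) = w i j * dd i j s + w i j * max 0 (- dd i j s)"
    by (subst max_diff_neg(1)) (rule distrib_left)
  then show "(if D i j z = 0 then w i j * max 0 (dd i j s) else 0) =
    (if D i j z = 0 then w i j * dd i j s else 0) + (if D i j z = 0 then w i j * max 0 (- dd i j s) else 0)"
    by simp
qed

lemma ll_upper: "ll z s = - Lam z s - Gam z s + (\<Sum>(i,j)\<in>PL (Re z). if D i j z = 0 then w i j * max 0 (dd i j s) else 0)"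
proof -
  have "(\<Sum>(i,j)\<in>PL (Re z). if D i j z = 0 then w i j * max 0 (- dd i j s) else 0)
     = - (\<Sum>(i,j)\<in>PL (Re z). if D i j z = 0 then w i j * dd i j s else 0)
       + (\<Sum>(i,j)\<in>PL (Re z). if D i j z = 0 then w i j * max 0 (dd i j s) else 0)"
    unfolding sum_negf[symmetric] sum.distrib[symmetric]
  proof (intro sum.cong refl, clarify)
    fix i j
    have "w i j * max 0 (- dd i j s) = - (w i j * dd i j s) + w i j * max 0 (dd i j s)"
      by (subst max_diff_neg(2)) (simp add: algebra_simps)
    then show "(if D i j z = 0 then w i j * max 0 (- dd i j s) else 0) =
      - (if D i j z = 0 then w i j * dd i j s else 0) + (if D i j z = 0 then w i j * max 0 (dd i j s) else 0)"
      by simp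
  qed
  then show ?thesis unfolding ll_def Gam_PL by linarith
qed

lemma max_local:
  "\<forall>\<^sub>F t in at_right (0::real). max 0 (a + t * d) = max 0 a + t * (if a > 0 then d else if a = 0 then max 0 d else 0)"
proof (cases "a = 0")
  case True
  have "\<forall>\<^sub>F t in at_right (0::real). 0 < t" by (simp add: eventually_at_right_less)
  then show ?thesis
  proof eventually_elim
    case (elim t)
    have "max 0 (t * d) = t * max 0 d"
      using elim by (simp add: max_mult_distrib_left)
    then show ?case using True by simp
  qed
next
  case False
  have lim: "((\<lambda>t. a + t * d) \<longlongrightarrow> a + 0 * d) (at_right 0)" by (intro tendsto_intros)
  show ?thesis
  proof (cases "a > 0")
    case True
    then have "\<forall>\<^sub>F t in at_right 0. 0 < a + t * d"
      using order_tendstoD(1)[OF lim, of 0] by simp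
    then show ?thesis by eventually_elim (use True in auto)
  next
    case F: False
    then have "\<forall>\<^sub>F t in at_right 0. a + t * d < 0"
      using order_tendstoD(2)[OF lim, of 0] False by simp
    then show ?thesis by eventually_elim (use F False in auto)
  qed
qed

lemma D_add: "D i j (z + t *\<^sub>R u) = D i j z + t * cr (p j - p i) u"
  by (simp add: D_def cr_def algebra_simps)

lemma PR_near: "\<forall>\<^sub>F t in at_right (0::real). PR (x + t) = PR x"
  and PL_near: "\<forall>\<^sub>F t in at_right (0::real). PR (x - t) = PL x"
proof -
  have ev: "\<forall>\<^sub>F t in at_right (0::real). 0 < t \<and> t < b" if "b > 0" for b
    unfolding eventually_at_right_field using that by blast
  have R: "\<forall>\<^sub>F t in at_right (0::real). \<forall>v\<in>V. x < X v \<longrightarrow> x + t < X v"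
    unfolding eventually_ball_finite_distrib[OF finV]
  proof
    fix v assume "v \<in> V"
    show "\<forall>\<^sub>F t in at_right 0. x < X v \<longrightarrow> x + t < X v"
    proof (cases "x < X v")
      case True then show ?thesis using ev[of "X v - x"] by (auto elim!: eventually_mono)
    qed simp
  qed
  have L: "\<forall>\<^sub>F t in at_right (0::real). \<forall>v\<in>V. X v < x \<longrightarrow> X v < x - t"
    unfolding eventually_ball_finite_distrib[OF finV]
  proof
    fix v assume "v \<in> V"
    show "\<forall>\<^sub>F t in at_right 0. X v < x \<longrightarrow> X v < x - t"
    proof (cases "X v < x")
      case True then show ?thesis using ev[of "x - X v"] by (auto elim!: eventually_mono)
    qed simp
  qed
  show "\<forall>\<^sub>F t in at_right (0::real). PR (x + t) = PR x"
    using R ev[OF zero_less_one]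
  proof eventually_elim
    case (elim t)
    have "X v \<le> x + t \<longleftrightarrow> X v \<le> x" "x + t < X v \<longleftrightarrow> x < X v" if "v \<in> V" for v
      using elim(1)[rule_format, OF that] elim(2) by linarith+
    then show ?case unfolding PR_def by auto
  qed
  show "\<forall>\<^sub>F t in at_right (0::real). PR (x - t) = PL x"
    using L ev[OF zero_less_one]
  proof eventually_elim
    case (elim t)
    have "X v \<le> x - t \<longleftrightarrow> X v < x" "x - t < X v \<longleftrightarrow> x \<le> X v" if "v \<in> V" for v
      using elim(1)[rule_format, OF that] elim(2) by linarith+
    then show ?case unfolding PR_def PL_def by auto
  qed
qed

lemma phi_right: "\<forall>\<^sub>F t in at_right (0::real). phi (z + t *\<^sub>R Complex 1 s) = phi z + t * rr z s"
proof -
  let ?k = "\<lambda>q t. t * (if D (fst q) (snd q) z > 0 then dd (fst q) (snd q) s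
      else if D (fst q) (snd q) z = 0 then max 0 (dd (fst q) (snd q) s) else 0)"
  have "\<forall>\<^sub>F t in at_right (0::real). \<forall>q\<in>PR (Re z).
     max 0 (D (fst q) (snd q) z + t * dd (fst q) (snd q) s) = max 0 (D (fst q) (snd q) z) + ?k q t"
    unfolding eventually_ball_finite_distrib[OF fin_P(1)] by (intro ballI max_local)
  with PR_near[of "Re z"] show ?thesis
  proof eventually_elim
    case (elim t)
    have "phi (z + t *\<^sub>R Complex 1 s) = (\<Sum>q\<in>PR (Re z). w (fst q) (snd q) * max 0 (D (fst q) (snd q) z + t * dd (fst q) (snd q) s))"
      unfolding phi_def case_prod_unfold using elim(1) by (simp add: D_add dd_def)
    also have "\<dots> = (\<Sum>q\<in>PR (Re z). w (fst q) (snd q) * (max 0 (D (fst q) (snd q) z) + ?k q t))"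
      by (intro sum.cong refl) (simp only: elim(2)[rule_format])
    also have "\<dots> = phi z + t * rr z s"
      unfolding phi_def rr_def Lam_def case_prod_unfold sum.distrib[symmetric] sum_distrib_left
      by (intro sum.cong refl) (simp add: distrib_left)
    finally show ?case .
  qed
qed

lemma phi_left: "\<forall>\<^sub>F t in at_right (0::real). phi (z - t *\<^sub>R Complex 1 s) = phi z + t * ll z s"
proof -
  let ?k = "\<lambda>q t. t * (if D (fst q) (snd q) z > 0 then - dd (fst q) (snd q) s
      else if D (fst q) (snd q) z = 0 then max 0 (- dd (fst q) (snd q) s) else 0)"
  have "\<forall>\<^sub>F t in at_right (0::real). \<forall>q\<in>PL (Re z).
     max 0 (D (fst q) (snd q) z + t * (- dd (fst q) (snd q) s)) = max 0 (D (fst q) (snd q) z) + ?k q t"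
    unfolding eventually_ball_finite_distrib[OF fin_P(2)] by (intro ballI max_local)
  with PL_near[of "Re z"] show ?thesis
  proof eventually_elim
    case (elim t)
    have D: "D i j (z - t *\<^sub>R Complex 1 s) = D i j z + t * (- dd i j s)" for i j
      by (simp add: D_def dd_def cr_def algebra_simps)
    have "phi (z - t *\<^sub>R Complex 1 s) = (\<Sum>q\<in>PL (Re z). w (fst q) (snd q) * max 0 (D (fst q) (snd q) z + t * (- dd (fst q) (snd q) s)))"
      unfolding phi_def case_prod_unfold D using elim(1) by simp
    also have "\<dots> = (\<Sum>q\<in>PL (Re z). w (fst q) (snd q) * (max 0 (D (fst q) (snd q) z) + ?k q t))"
      by (intro sum.cong refl) (simp only: elim(2)[rule_format])
    also have "\<dots> = phi z + t * ll z s"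
      unfolding phi_PL ll_def Lam_PL case_prod_unfold sum_negf[symmetric] sum.distrib[symmetric] sum_distrib_left
      by (intro sum.cong refl) (simp add: distrib_left)
    finally show ?case .
  qed
qed


section \<open>The maximum principle\<close>

definition BR where "BR z = {(i,j)\<in>PR (Re z). adj i j \<and> D i j z = 0}"
definition BL where "BL z = {(i,j)\<in>PL (Re z). adj i j \<and> D i j z = 0}"

lemma on_segment:
  assumes "X i \<le> Re z" "Re z \<le> X j" "X i < X j" "D i j z = 0"
  shows "z \<in> closed_segment (p i) (p j)"
proof -
  define t where "t = (Re z - X i) / (X j - X i)"
  have t: "0 \<le> t" "t \<le> 1" using assms by (auto simp: t_def)
  have tx: "t * (X j - X i) = Re z - X i" using assms by (simp add: t_def)
  have "(X j - X i) * (t * (Im (p j) - Im (p i))) = (t * (X j - X i)) * (Im (p j) - Im (p i))" by simp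
  also have "\<dots> = (X j - X i) * (Im z - Im (p i))"
    unfolding tx using assms(4) by (simp add: D_def cr_def X_def algebra_simps)
  finally have ty: "t * (Im (p j) - Im (p i)) = Im z - Im (p i)" using assms(3) by simp
  have "z = (1 - t) *\<^sub>R p i + t *\<^sub>R p j"
    using tx ty by (auto simp: complex_eq_iff X_def algebra_simps)
  then show ?thesis using t by (auto simp: closed_segment_def)
qed

lemma fin_B: "finite (BR z)" "finite (BL z)"
  unfolding BR_def BL_def using fin_P by (auto intro: finite_subset)

lemma BR_segment: "(i,j) \<in> BR z \<Longrightarrow> i \<in> V \<and> j \<in> V \<and> adj i j \<and> X i < X j \<and> X i \<le> Re z \<and> Re z < X j \<and> z \<in> closed_segment (p i) (p j)"
  by (auto simp: BR_def PR_def intro: on_segment)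

lemma BL_segment: "(i,j) \<in> BL z \<Longrightarrow> i \<in> V \<and> j \<in> V \<and> adj i j \<and> X i < X j \<and> X i < Re z \<and> Re z \<le> X j \<and> z \<in> closed_segment (p i) (p j)"
  by (auto simp: BL_def PL_def intro: on_segment)

text \<open>At a vertex this is the degree bound. Elsewhere \<open>z\<close> is on at most one bar,
  in its interior, and that bar is counted once on the right and once on the left.\<close>

lemma card_bars: "card (BR z) + card (BL z) \<le> 2"
proof (cases "z \<in> p ` V")
  case True
  then obtain v where v: "v \<in> V" "z = p v" by auto
  let ?J = "{j\<in>V. adj v j \<and> X v < X j}" and ?I = "{j\<in>V. adj v j \<and> X j < X v}"
  have fin: "finite ?I" "finite ?J" using finV by auto
  have "BR z \<subseteq> Pair v ` ?J"
  proof (clarify)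
    fix i j assume ij: "(i,j) \<in> BR z"
    note s = BR_segment[OF ij]
    have "v = i" using bar_vertex[of i j v] s v by (auto simp: X_def)
    then show "(i,j) \<in> Pair v ` ?J" using s by auto
  qed
  then have 1: "card (BR z) \<le> card ?J"
    by (rule surj_card_le[OF fin(2)])
  have "BL z \<subseteq> (\<lambda>i. (i,v)) ` ?I"
  proof (clarify)
    fix i j assume ij: "(i,j) \<in> BL z"
    note s = BL_segment[OF ij]
    have "v = j" using bar_vertex[of i j v] s v by (auto simp: X_def)
    then show "(i,j) \<in> (\<lambda>i. (i,v)) ` ?I" using s adj_sym by auto
  qed
  then have 2: "card (BL z) \<le> card ?I"
    by (rule surj_card_le[OF fin(1)])
  have "card ?J + card ?I = card (?J \<union> ?I)"
    by (rule card_Un_disjoint[symmetric]) (use fin in auto)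
  also have "\<dots> \<le> card {j\<in>V. adj v j}" by (rule card_mono) (use finV in auto)
  also have "\<dots> \<le> 2" by (rule deg) (rule v)
  finally show ?thesis using 1 2 by linarith
next
  case False
  have "a = b" if ab: "a \<in> BR z" "b \<in> BR z" for a b
  proof -
    obtain i j k l where e: "a = (i,j)" "b = (k,l)" by fastforce
    note s = BR_segment[of i j z] BR_segment[of k l z]
    have "{i,j} = {k,l}"
      by (rule ccontr) (use bar_bar[of i j k l z] s that e False in blast)
    then show ?thesis using s that e by (auto simp: doubleton_eq_iff)
  qed
  then have 1: "card (BR z) \<le> 1" using card_le_Suc0_iff_eq[OF fin_B(1)] by auto
  have "a = b" if ab: "a \<in> BL z" "b \<in> BL z" for a b
  proof -
    obtain i j k l where e: "a = (i,j)" "b = (k,l)" by fastforce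
    note s = BL_segment[of i j z] BL_segment[of k l z]
    have "{i,j} = {k,l}"
      by (rule ccontr) (use bar_bar[of i j k l z] s that e False in blast)
    then show ?thesis using s that e by (auto simp: doubleton_eq_iff)
  qed
  then have 2: "card (BL z) \<le> 1" using card_le_Suc0_iff_eq[OF fin_B(2)] by auto
  from 1 2 show ?thesis by linarith
qed

text \<open>Only bars may carry negative stress, so a weight \<open>f\<close> that vanishes on the
  bars through \<open>z\<close> leaves nothing but struts.\<close>

lemma sum_PR_nonneg:
  assumes "\<And>i j. (i,j) \<in> BR z \<Longrightarrow> f i j = 0" "\<And>i j. 0 \<le> f i j"
  shows "0 \<le> (\<Sum>(i,j)\<in>PR (Re z). if D i j z = 0 then w i j * f i j else (0::real))"
proof (rule sum_nonneg, clarify)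
  fix i j assume ij: "(i,j) \<in> PR (Re z)"
  then have V: "i \<in> V" "j \<in> V" "i \<noteq> j" by (auto simp: PR_def)
  show "0 \<le> (if D i j z = 0 then w i j * f i j else 0)"
    using assms(1)[of i j] assms(2)[of i j] strut[OF V] ij
    by (cases "adj i j") (auto simp: BR_def)
qed

lemma sum_PL_nonneg:
  assumes "\<And>i j. (i,j) \<in> BL z \<Longrightarrow> f i j = 0" "\<And>i j. 0 \<le> f i j"
  shows "0 \<le> (\<Sum>(i,j)\<in>PL (Re z). if D i j z = 0 then w i j * f i j else (0::real))"
proof (rule sum_nonneg, clarify)
  fix i j assume ij: "(i,j) \<in> PL (Re z)"
  then have V: "i \<in> V" "j \<in> V" "i \<noteq> j" by (auto simp: PL_def)
  show "0 \<le> (if D i j z = 0 then w i j * f i j else 0)"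
    using assms(1)[of i j] assms(2)[of i j] strut[OF V] ij
    by (cases "adj i j") (auto simp: BL_def)
qed

lemma dd_eq: "dd i j s = (X j - X i) * s - (Im (p j) - Im (p i))"
  by (simp add: dd_def cr_def X_def)

lemma Lam_affine: "\<exists>a b. \<forall>s. Lam z s = a + b * s"
proof -
  have "Lam z s = (\<Sum>(i,j)\<in>PR (Re z). if D i j z > 0 then - w i j * (Im (p j) - Im (p i)) else 0)
     + (\<Sum>(i,j)\<in>PR (Re z). if D i j z > 0 then w i j * (X j - X i) else 0) * s" for s
    unfolding Lam_def sum_distrib_right sum.distrib[symmetric] case_prod_unfold
    by (intro sum.cong refl) (simp add: dd_eq algebra_simps)
  then show ?thesis by blast
qed

lemma affine_nonneg_const:
  fixes a b :: real
  assumes "\<And>s. 0 \<le> a + b * s"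
  shows "b = 0"
proof (rule ccontr)
  assume "b \<noteq> 0"
  then have "a + b * (- (a + 1) / b) = - 1" by simp
  with assms[of "- (a + 1) / b"] show False by simp
qed

lemma dd_neg: "finite Q \<Longrightarrow> \<forall>(i,j)\<in>Q. X i < X j \<Longrightarrow> \<exists>s. \<forall>(i,j)\<in>Q. dd i j s \<le> 0"
proof -
  assume Q: "finite Q" "\<forall>(i,j)\<in>Q. X i < X j"
  have "\<forall>\<^sub>F s in at_bot. \<forall>q\<in>Q. dd (fst q) (snd q) s \<le> 0"
    unfolding eventually_ball_finite_distrib[OF Q(1)]
  proof
    fix q assume "q \<in> Q"
    then have x: "X (fst q) < X (snd q)" using Q(2) by auto
    have "\<forall>\<^sub>F s in at_bot. s \<le> (Im (p (snd q)) - Im (p (fst q))) / (X (snd q) - X (fst q))"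
      by (rule eventually_le_at_bot)
    then show "\<forall>\<^sub>F s in at_bot. dd (fst q) (snd q) s \<le> 0"
      by eventually_elim (use x in \<open>simp add: dd_eq field_simps\<close>)
  qed
  then obtain s where "\<forall>q\<in>Q. dd (fst q) (snd q) s \<le> 0"
    using eventually_happens'[OF trivial_limit_at_bot_linorder] by blast
  then show ?thesis by (intro exI[of _ s]) auto
qed

lemma dd_pos: "finite Q \<Longrightarrow> \<forall>(i,j)\<in>Q. X i < X j \<Longrightarrow> \<exists>s. \<forall>(i,j)\<in>Q. 0 \<le> dd i j s"
proof -
  assume Q: "finite Q" "\<forall>(i,j)\<in>Q. X i < X j"
  have "\<forall>\<^sub>F s in at_top. \<forall>q\<in>Q. 0 \<le> dd (fst q) (snd q) s"
    unfolding eventually_ball_finite_distrib[OF Q(1)]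
  proof
    fix q assume "q \<in> Q"
    then have x: "X (fst q) < X (snd q)" using Q(2) by auto
    have "\<forall>\<^sub>F s in at_top. (Im (p (snd q)) - Im (p (fst q))) / (X (snd q) - X (fst q)) \<le> s"
      by (rule eventually_ge_at_top)
    then show "\<forall>\<^sub>F s in at_top. 0 \<le> dd (fst q) (snd q) s"
      by eventually_elim (use x in \<open>simp add: dd_eq field_simps\<close>)
  qed
  then obtain s where "\<forall>q\<in>Q. 0 \<le> dd (fst q) (snd q) s"
    using eventually_happens'[OF trivial_limit_at_top_linorder] by blast
  then show ?thesis by (intro exI[of _ s]) auto
qed

text \<open>A sufficiently steep descent leaves all segments through \<open>z\<close> above it, so
  that only those strictly below \<open>z\<close> count. In \<open>ll_high\<close> the slope is
  large instead, because the direction is reversed.\<close>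

lemma rr_low: "\<exists>s. rr z s = Lam z s"
proof -
  obtain s where s: "\<forall>(i,j)\<in>PR (Re z). dd i j s \<le> 0"
    using dd_neg[OF fin_P(1), of "Re z"] by (force simp: PR_def)
  have "rr z s = Lam z s"
    unfolding rr_def by (simp, rule sum.neutral) (use s in auto)
  then show ?thesis ..
qed

lemma ll_high: "\<exists>s. ll z s = - Lam z s"
proof -
  obtain s where s: "\<forall>(i,j)\<in>PL (Re z). 0 \<le> dd i j s"
    using dd_pos[OF fin_P(2), of "Re z"] by (force simp: PL_def)
  have "ll z s = - Lam z s"
    unfolding ll_def by (simp, rule sum.neutral) (use s in auto)
  then show ?thesis ..
qed

text \<open>At a local maximum there is a direction to the right along which \<open>\<phi>\<close> is constant: along
  a bar when there is one bar on each side, because the half-plane on one side of the line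
  spanned by it then contains no bar in its interior and \<open>\<phi>\<close> is convex there.\<close>
lemma flat_direction:
  assumes r: "\<And>s. rr z s \<le> 0" and l: "\<And>s. ll z s \<le> 0"
  shows "\<exists>s. rr z s = 0"
proof -
  obtain a b where ab: "\<And>s. Lam z s = a + b * s" using Lam_affine by blast
  consider "BL z = {}" | "BR z = {}" | "card (BR z) = 1" "card (BL z) = 1"
  proof -
    have "card (BL z) = 0 \<or> card (BR z) = 0 \<or> card (BR z) = 1 \<and> card (BL z) = 1"
      using card_bars[of z] by linarith
    then show thesis using fin_B[of z] that by (metis card_0_eq)
  qed
  then show ?thesis
  proof cases
    \<comment> \<open>Without bars on the left, \<open>ll z s\<close> exceeds
      \<open>- Lam z s\<close> only by strut terms, so \<open>Lam\<close> is nonnegative; a steep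
      descent to the right has derivative \<open>Lam\<close>.\<close>
    case 1
    have "0 \<le> Lam z s" for s
    proof -
      have "0 \<le> ll z s + Lam z s"
        unfolding ll_def using sum_PL_nonneg[of z "\<lambda>i j. max 0 (- dd i j s)"] 1 by simp
      then show ?thesis using l[of s] by linarith
    qed
    then show ?thesis using rr_low r by (metis antisym)
  next
    \<comment> \<open>Here \<open>Lam\<close> is nonpositive for all slopes; being affine in the
      slope it is constant, and a steep descent to the left shows that the constant is not
      negative.\<close>
    case 2
    have le: "Lam z s \<le> 0" for s
    proof -
      have "Lam z s \<le> rr z s"
        unfolding rr_def using sum_PR_nonneg[of z "\<lambda>i j. max 0 (dd i j s)"] 2 by simp
      then show ?thesis using r[of s] by linarith
    qed
    have "0 \<le> - a + - b * s" for s using le[of s] ab[of s] by simp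
    then have "b = 0" using affine_nonneg_const[of "- a" "- b"] by simp
    then have c: "Lam z s = a" for s using ab by simp
    have "0 \<le> a" using ll_high[of z] l c by (metis neg_le_0_iff_le)
    then have "Lam z s = 0" for s using c le by (metis antisym)
    then show ?thesis using rr_low by metis
  next
    case 3
    obtain q where "BR z = {q}" using 3(1) card_1_singletonE by blast
    then obtain i j where R: "BR z = {(i,j)}" by (cases q) auto
    obtain q' where "BL z = {q'}" using 3(2) card_1_singletonE by blast
    then obtain k m where L: "BL z = {(k,m)}" by (cases q') auto
    have x: "X i < X j" using BR_segment[of i j z] R by auto
    define s where "s = (Im (p j) - Im (p i)) / (X j - X i)"
    have s: "dd i j s = 0" using x by (simp add: dd_eq s_def)
    \<comment> \<open>The linear terms cancel in the sum. The right bar lies along the direction and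
      counts nowhere; the left bar lies on one side of the extended direction, and the positive
      parts are charged on the other side.\<close>
    have "0 \<le> rr z s + ll z s"
    proof (cases "0 \<le> dd k m s")
      case True
      have "0 \<le> (\<Sum>(i,j)\<in>PR (Re z). if D i j z = 0 then w i j * max 0 (dd i j s) else 0)"
        by (rule sum_PR_nonneg) (use R s in auto)
      moreover have "0 \<le> (\<Sum>(i,j)\<in>PL (Re z). if D i j z = 0 then w i j * max 0 (- dd i j s) else 0)"
        by (rule sum_PL_nonneg) (use L True in auto)
      ultimately show ?thesis unfolding rr_def ll_def by linarith
    next
      case False
      have "0 \<le> (\<Sum>(i,j)\<in>PR (Re z). if D i j z = 0 then w i j * max 0 (- dd i j s) else 0)"
        by (rule sum_PR_nonneg) (use R s in auto)
      moreover have "0 \<le> (\<Sum>(i,j)\<in>PL (Re z). if D i j z = 0 then w i j * max 0 (dd i j s) else 0)"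
        by (rule sum_PL_nonneg) (use L False in auto)
      ultimately show ?thesis unfolding rr_upper ll_upper by linarith
    qed
    then have "rr z s = 0" using r[of s] l[of s] by linarith
    then show ?thesis ..
  qed
qed

lemma bounded_support: "\<exists>K. compact K \<and> (\<forall>z. z \<notin> K \<longrightarrow> phi z = 0)"
proof (cases "V = {}")
  case True
  then have "PR x = {}" for x unfolding PR_def using True by auto
  then have "phi z = 0" for z by (simp add: phi_def)
  then show ?thesis by (intro exI[of _ "{}"]) auto
next
  case False
  let ?K = "cbox (Complex (Min (X ` V)) (Min ((\<lambda>v. Im (p v)) ` V))) (Complex (Max (X ` V)) (Max ((\<lambda>v. Im (p v)) ` V)))"
  have "phi z = 0" if z: "z \<notin> ?K" for z
  proof -
    have "Re z < Min (X ` V) \<or> Max (X ` V) < Re z \<or> Im z < Min ((\<lambda>v. Im (p v)) ` V) \<or> Max ((\<lambda>v. Im (p v)) ` V) < Im z"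
      using z by (auto simp: in_cbox_complex_iff)
    then consider "\<forall>v\<in>V. Re z < X v" | "\<forall>v\<in>V. X v \<le> Re z" | "\<forall>v\<in>V. Im z \<le> Im (p v)" | "\<forall>v\<in>V. Im (p v) \<le> Im z"
      using False finV by (force simp: less_imp_le)
    then show ?thesis
      by cases (use phi_side[of z] phi_high[of z] phi_low[of z] in blast)+
  qed
  then show ?thesis by (intro exI[of _ ?K]) auto
qed

theorem phi_nonpos: "phi z \<le> 0"
proof (rule ccontr)
  assume "\<not> phi z \<le> 0"
  then have z: "phi z > 0" by simp
  obtain K where K: "compact K" "\<And>z. z \<notin> K \<Longrightarrow> phi z = 0" using bounded_support by blast
  have "z \<in> K" using K(2) z by force
  obtain m where m: "m \<in> K" "\<And>y. y \<in> K \<Longrightarrow> phi y \<le> phi m"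
    using continuous_attains_sup[OF K(1) _ continuous_on_phi] \<open>z \<in> K\<close> by blast
  have pos: "phi m > 0" using m(2)[OF \<open>z \<in> K\<close>] z by linarith
  have max: "phi y \<le> phi m" for y using m(2)[of y] K(2)[of y] pos by (cases "y \<in> K") auto
  define M where "M = K \<inter> {y. phi y = phi m}"
  have "closed {y. phi y = phi m}"
    by (rule closed_Collect_eq[OF continuous_on_phi continuous_on_const])
  then have "compact M" unfolding M_def by (rule compact_Int_closed[OF K(1)])
  moreover have "m \<in> M" using m by (auto simp: M_def)
  \<comment> \<open>A rightmost maximiser: the flat direction to the right will lead to a maximiser
    that is further right.\<close>
  ultimately obtain y where y: "y \<in> M" "\<And>x. x \<in> M \<Longrightarrow> Re x \<le> Re y"
    using continuous_attains_sup[of M Re] continuous_on_Re[OF continuous_on_id] by blast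
  have py: "phi y = phi m" using y(1) by (auto simp: M_def)
  have r: "rr y s \<le> 0" for s
  proof -
    have "\<forall>\<^sub>F t in at_right (0::real). t > 0 \<and> phi (y + t *\<^sub>R Complex 1 s) = phi y + t * rr y s"
      using phi_right eventually_at_right_less by (auto simp: eventually_conj_iff)
    then obtain t where t: "t > 0" "phi (y + t *\<^sub>R Complex 1 s) = phi y + t * rr y s"
      using eventually_happens'[OF trivial_limit_at_right_real] by blast
    then have "t * rr y s \<le> 0" using max[of "y + t *\<^sub>R Complex 1 s"] py by linarith
    then show ?thesis using t(1) by (simp add: mult_le_0_iff)
  qed
  have l: "ll y s \<le> 0" for s
  proof -
    have "\<forall>\<^sub>F t in at_right (0::real). t > 0 \<and> phi (y - t *\<^sub>R Complex 1 s) = phi y + t * ll y s"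
      using phi_left eventually_at_right_less by (auto simp: eventually_conj_iff)
    then obtain t where t: "t > 0" "phi (y - t *\<^sub>R Complex 1 s) = phi y + t * ll y s"
      using eventually_happens'[OF trivial_limit_at_right_real] by blast
    then have "t * ll y s \<le> 0" using max[of "y - t *\<^sub>R Complex 1 s"] py by linarith
    then show ?thesis using t(1) by (simp add: mult_le_0_iff)
  qed
  obtain s where s: "rr y s = 0" using flat_direction[OF r l] by blast
  have "\<forall>\<^sub>F t in at_right (0::real). t > 0 \<and> phi (y + t *\<^sub>R Complex 1 s) = phi y + t * rr y s"
    using phi_right eventually_at_right_less by (auto simp: eventually_conj_iff)
  then obtain t where t: "t > 0" "phi (y + t *\<^sub>R Complex 1 s) = phi m"
    using eventually_happens'[OF trivial_limit_at_right_real] s py by force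
  then have "y + t *\<^sub>R Complex 1 s \<in> M" using pos K(2)[of "y + t *\<^sub>R Complex 1 s"] by (auto simp: M_def)
  then have "Re (y + t *\<^sub>R Complex 1 s) \<le> Re y" by (rule y(2))
  then show False using t(1) by simp
qed


section \<open>Edges of the convex hull are bars\<close>

lemma D_vertex: "D i j (p v) = - cr (p j - p v) (p i - p v)"
  by (simp add: D_def cr_def algebra_simps)

text \<open>No segment passes below a hull vertex \<open>p v\<close>, so \<open>phi\<close> vanishes
  there, and by \<open>phi_nonpos\<close> it cannot increase in any direction. Going right from
  \<open>v\<close> along the lowest bar, a strut that starts lower would make it increase. So
  nothing starts lower than that bar, and it is the hull edge.\<close>

lemma next_bar_generic:
  assumes v: "v \<in> V" and q: "Re q > 0" "\<And>k. k \<in> V \<Longrightarrow> 0 \<le> cr q (p k - p v)"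
    and k0: "k0 \<in> V" "X v < X k0"
  shows "\<exists>j\<in>V. adj v j \<and> (\<forall>k\<in>V. 0 \<le> cr (p j - p v) (p k - p v))"
proof -
  define z where "z = p v"
  have Rez: "Re z = X v" by (simp add: z_def X_def)
  \<comment> \<open>Since \<open>q\<close> points to the right and supports the configuration at
    \<open>v\<close>, a segment over the vertical line of \<open>v\<close> passes through
    \<open>p v\<close> or above it.\<close>
  have D: "D i j z \<le> 0" if "(i,j) \<in> PR (Re z)" for i j
  proof -
    have V: "i \<in> V" "j \<in> V" "X i \<le> X v" "X v < X j" using that by (auto simp: PR_def Rez)
    have "Re q * cr (p i - p v) (p j - p v)
        = Re (p i - p v) * cr q (p j - p v) - Re (p j - p v) * cr q (p i - p v)"
      by (simp add: cr_def algebra_simps)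
    moreover have "Re (p i - p v) * cr q (p j - p v) \<le> 0" "0 \<le> Re (p j - p v) * cr q (p i - p v)"
      using V q(2)[of i] q(2)[of j] by (auto simp: X_def mult_nonpos_nonneg)
    ultimately have "Re q * cr (p i - p v) (p j - p v) \<le> 0" by linarith
    then have "cr (p i - p v) (p j - p v) \<le> 0" using q(1) by (simp add: mult_le_0_iff)
    then show ?thesis unfolding z_def D_vertex by (subst cr_commute) simp
  qed
  have phi0: "phi z = 0"
    unfolding phi_def by (rule sum.neutral) (use D in \<open>auto simp: max_absorb1\<close>)
  have Lam0: "Lam z s = 0" for s
    unfolding Lam_def by (rule sum.neutral) (use D in \<open>force simp: not_less\<close>)
  have rr: "(\<Sum>(i,j)\<in>PR (Re z). if D i j z = 0 then w i j * max 0 (dd i j s) else 0) \<le> 0" for s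
  proof -
    have "\<forall>\<^sub>F t in at_right (0::real). t > 0 \<and> phi (z + t *\<^sub>R Complex 1 s) = phi z + t * rr z s"
      using phi_right eventually_at_right_less by (auto simp: eventually_conj_iff)
    then obtain t where t: "t > 0" "phi (z + t *\<^sub>R Complex 1 s) = phi z + t * rr z s"
      using eventually_happens'[OF trivial_limit_at_right_real] by blast
    then have "t * rr z s \<le> 0" using phi_nonpos[of "z + t *\<^sub>R Complex 1 s"] phi0 by linarith
    then show ?thesis using t(1) by (simp add: mult_le_0_iff rr_def Lam0)
  qed
  \<comment> \<open>If no bar through \<open>p v\<close> starts below the direction
    \<open>Complex 1 s\<close>, then no strut does: its positive stress would give
    \<open>phi\<close> a positive derivative.\<close>
  have low: "dd i j s \<le> 0"
    if s: "\<And>i j. (i,j) \<in> BR z \<Longrightarrow> dd i j s \<le> 0" and ij: "(i,j) \<in> PR (Re z)" "D i j z = 0" for i j s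
  proof (cases "adj i j")
    case True
    then show ?thesis using s ij by (auto simp: BR_def)
  next
    case False
    have V: "a \<in> V" "b \<in> V" "a \<noteq> b" if "(a,b) \<in> PR (Re z)" for a b using that by (auto simp: PR_def)
    have nn: "0 \<le> (case x of (i,j) \<Rightarrow> if D i j z = 0 then w i j * max 0 (dd i j s) else 0)"
      if "x \<in> PR (Re z)" for x
    proof -
      obtain a b where x: "x = (a,b)" by (cases x)
      show ?thesis
        using s[of a b] strut[OF V[of a b]] that unfolding x
        by (cases "adj a b") (auto simp: BR_def max_absorb1)
    qed
    have "w i j * max 0 (dd i j s) \<le> (\<Sum>(i,j)\<in>PR (Re z). if D i j z = 0 then w i j * max 0 (dd i j s) else 0)"
      using member_le_sum[OF ij(1) _ fin_P(1), of "\<lambda>(i,j). if D i j z = 0 then w i j * max 0 (dd i j s) else 0"]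
        nn ij(2) by auto
    then have "w i j * max 0 (dd i j s) \<le> 0" using rr[of s] by linarith
    then show ?thesis using strut[OF V[OF ij(1)] False] by (simp add: mult_le_0_iff)
  qed
  have vk: "(v,k) \<in> PR (Re z)" "D v k z = 0" if "k \<in> V" "X v < X k" for k
    using that v unfolding Rez PR_def by (auto simp: D_vertex z_def)
  have "BR z \<noteq> {}"
  proof
    assume B: "BR z = {}"
    have x: "X k0 - X v > 0" using k0 by simp
    \<comment> \<open>With no bar at hand \<open>low\<close> would hold for every slope; for this
      slope \<open>dd v k0\<close> equals 1.\<close>
    have "dd v k0 ((Im (p k0) - Im (p v) + 1) / (X k0 - X v)) \<le> 0"
      by (rule low[OF _ vk[OF k0]]) (use B in auto)
    then show False using x by (simp add: dd_eq)
  qed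
  define sl where "sl = (\<lambda>(i,j). (Im (p j) - Im (p i)) / (X j - X i))"
  obtain e where e: "e \<in> BR z" "\<And>f. f \<in> BR z \<Longrightarrow> sl e \<le> sl f"
    using arg_min_if_finite[OF fin_B(1) \<open>BR z \<noteq> {}\<close>, of sl] by (metis not_le)
  obtain i j where ij: "e = (i,j)" by (cases e)
  have B: "i \<in> V" "j \<in> V" "adj i j" "X i < X j" "X v < X j" "z \<in> closed_segment (p i) (p j)"
    using BR_segment[of i j z] e(1) ij by (auto simp: Rez)
  have iv: "i = v" using bar_vertex[OF B(1-3) v] B by (auto simp: z_def)
  have dd: "dd a b (sl e) \<le> 0" if "(a,b) \<in> PR (Re z)" "D a b z = 0" for a b
  proof (rule low[OF _ that])
    fix a b assume ab: "(a,b) \<in> BR z"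
    have "X a < X b" using BR_segment[OF ab] by auto
    moreover have "sl e \<le> (Im (p b) - Im (p a)) / (X b - X a)" using e(2)[OF ab] by (simp add: sl_def)
    ultimately show "dd a b (sl e) \<le> 0" by (simp add: dd_eq field_simps)
  qed
  have sl: "sl e * (X j - X v) = Im (p j) - Im (p v)" using B(4) by (simp add: sl_def ij iv)
  have "0 \<le> cr (p j - p v) (p k - p v)" if k: "k \<in> V" for k
  proof (cases "X v < X k")
    case True
    have "cr (p j - p v) (p k - p v) = - (X j - X v) * dd v k (sl e)"
      unfolding cr_def minus_complex.sel sl[symmetric] by (simp add: dd_eq X_def algebra_simps)
    then show ?thesis using dd[OF vk[OF k True]] B(5) by (simp add: mult_nonpos_nonpos)
  next
    case False
    then have "(k,j) \<in> PR (Re z)" using k B by (auto simp: PR_def Rez)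
    from D[OF this] show ?thesis unfolding z_def D_vertex by simp
  qed
  then show ?thesis using B iv by auto
qed

end

lemma cr_rotate: "cr (a * u) (b * u) = (cmod u)\<^sup>2 * cr a b"
proof -
  have "(cmod u)\<^sup>2 = Re u * Re u + Im u * Im u" unfolding cmod_power2 by (simp add: power2_eq_square)
  then show ?thesis by (simp add: cr_def algebra_simps)
qed

context stressed begin

text \<open>Equilibrium is linear in the positions and segments go to segments, so the same stress
  serves for every injective linear image.\<close>

lemma linear_image:
  assumes f: "linear f" "inj f"
  shows "stressed V adj w (f \<circ> p)"
proof -
  have seg: "f z \<in> closed_segment (f a) (f b) \<longleftrightarrow> z \<in> closed_segment a b" for z a b
    using closed_segment_linear_image[OF f(1)] inj_image_mem_iff[OF f(2)] by auto
  have surj: "closed_segment (f a) (f b) \<subseteq> range f" for a b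
    using closed_segment_linear_image[OF f(1)] by auto
  show ?thesis
  proof
    show "(\<Sum>j\<in>V. w i j *\<^sub>R ((f \<circ> p) j - (f \<circ> p) i)) = 0" if "i \<in> V" for i
    proof -
      have "(\<Sum>j\<in>V. w i j *\<^sub>R ((f \<circ> p) j - (f \<circ> p) i)) = f (\<Sum>j\<in>V. w i j *\<^sub>R (p j - p i))"
        by (simp add: linear_sum[OF f(1)] linear_scale[OF f(1)] linear_diff[OF f(1)])
      then show ?thesis using equil[OF that] linear_0[OF f(1)] by simp
    qed
    show "inj_on (f \<circ> p) V" using inj_p f(2) by (meson comp_inj_on inj_on_subset subset_UNIV)
    show "v = i \<or> v = j"
      if "i \<in> V" "j \<in> V" "adj i j" "v \<in> V" "(f \<circ> p) v \<in> closed_segment ((f \<circ> p) i) ((f \<circ> p) j)" for i j v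
      using bar_vertex[OF that(1-4)] that(5) by (auto simp: seg)
    show "z \<in> (f \<circ> p) ` V"
      if h: "i \<in> V" "j \<in> V" "adj i j" "k \<in> V" "l \<in> V" "adj k l" "{i,j} \<noteq> {k,l}"
      "z \<in> closed_segment ((f \<circ> p) i) ((f \<circ> p) j)" "z \<in> closed_segment ((f \<circ> p) k) ((f \<circ> p) l)" for i j k l z
    proof -
      obtain y where y: "z = f y" using surj h(8) by (metis comp_apply rangeE subsetD)
      have "y \<in> p ` V" using bar_bar[OF h(1-7)] h(8,9) by (simp add: y seg)
      then show ?thesis by (auto simp: y)
    qed
  qed (use finV adj_sym deg w_sym strut in auto)
qed

lemma rotate: "u \<noteq> 0 \<Longrightarrow> stressed V adj w (\<lambda>i. p i * u)"
  using linear_image[of "\<lambda>z. z * u"] bounded_linear.linear[OF bounded_linear_mult_left, of u]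
  by (auto simp: o_def inj_on_def)

lemma reflect: "stressed V adj w (\<lambda>i. cnj (p i))"
  using linear_image[of cnj] bounded_linear.linear[OF bounded_linear_cnj]
  by (auto simp: o_def inj_on_def)

text \<open>The candidates are the vectors \<open>u\<close> on a ray from \<open>a\<close> in
  direction \<open>b\<close>. Two given vertices become vertically aligned for at most one parameter
  \<open>s\<close>, because the condition is affine in \<open>s\<close> and cannot hold identically
  for independent \<open>a\<close> and \<open>b\<close>.\<close>

lemma generic_rotation:
  assumes a: "cmod a = 1" and b: "cmod b = 1" and ab: "cr a b \<noteq> 0"
  shows "\<exists>u. u \<noteq> 0 \<and> Re (a * cnj u) > 0 \<and> Re (b * cnj u) > 0 \<and> inj_on (\<lambda>i. Re (p i * cnj u)) V"
proof -
  define g where "g = Re (a * cnj b)"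
  have na: "Re a * Re a + Im a * Im a = 1" and nb: "Re b * Re b + Im b * Im b = 1"
    using a b by (simp_all add: cmod_def power2_eq_square)
  have "(Re a * Re a + Im a * Im a) * (Re b * Re b + Im b * Im b) = g\<^sup>2 + (cr a b)\<^sup>2"
    by (simp add: g_def cr_def power2_eq_square algebra_simps)
  then have "g\<^sup>2 + (cr a b)\<^sup>2 = 1" by (simp add: na nb)
  moreover have "(cr a b)\<^sup>2 > 0" using ab by simp
  ultimately have "g\<^sup>2 < 1" by linarith
  then have "g\<^sup>2 < 1\<^sup>2" by simp
  then have g: "- 1 < g" "g < 1" using power2_less_imp_less[of g 1] power2_less_imp_less[of "- g" 1] by auto
  define Bad where "Bad = (\<lambda>(i,j). {s. Re ((p i - p j) * cnj (a + s *\<^sub>R b)) = 0})"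
  have fin: "finite (Bad (i,j))" if "i \<in> V" "j \<in> V" "i \<noteq> j" for i j
  proof -
    define e where "e = p i - p j"
    have e: "e \<noteq> 0" using inj_p that by (auto simp: e_def dest: inj_onD)
    have eq: "Re (e * cnj (a + s *\<^sub>R b)) = Re (e * cnj a) + s * Re (e * cnj b)" for s
      by (simp add: algebra_simps)
    have Bad: "Bad (i,j) = {s. Re (e * cnj a) + s * Re (e * cnj b) = 0}"
      by (simp only: Bad_def prod.case e_def[symmetric] eq)
    show ?thesis
    proof (cases "Re (e * cnj b) = 0")
      case True
      have "Re (e * cnj a) \<noteq> 0"
      proof
        assume "Re (e * cnj a) = 0"
        then have "Re e * cr a b = 0" "Im e * cr a b = 0" using True
          by (auto simp: cr_def algebra_simps) (algebra+)
        then show False using ab e by (simp add: complex_eq_iff)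
      qed
      then have "Bad (i,j) = {}" unfolding Bad True by simp
      then show ?thesis by simp
    next
      case False
      have "Bad (i,j) \<subseteq> {- Re (e * cnj a) / Re (e * cnj b)}"
        unfolding Bad using False by (auto simp: field_simps simp del: times_complex.sel)
      then show ?thesis by (rule finite_subset) simp
    qed
  qed
  have "finite (\<Union>q\<in>{(i,j)\<in>V\<times>V. i \<noteq> j}. Bad q)"
    using finV fin by (intro finite_UN_I) (auto intro: finite_subset[of _ "V \<times> V"])
  \<comment> \<open>The inner products of \<open>u\<close> with \<open>a\<close> and
    \<open>b\<close> are \<open>1 + s * g\<close> and \<open>g + s\<close>; both are positive for
    \<open>s\<close> in this interval, since \<open>\<bar>g\<bar> < 1\<close>.\<close>
  moreover have "infinite {max 0 (- g)<..<1}" using g by (simp add: infinite_Ioo)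
  ultimately have "\<not> {max 0 (- g)<..<1} \<subseteq> (\<Union>q\<in>{(i,j)\<in>V\<times>V. i \<noteq> j}. Bad q)"
    using finite_subset by blast
  then obtain s where s: "max 0 (- g) < s" "s < 1" "\<And>i j. i \<in> V \<Longrightarrow> j \<in> V \<Longrightarrow> i \<noteq> j \<Longrightarrow> s \<notin> Bad (i,j)"
    by fastforce
  define u where "u = a + s *\<^sub>R b"
  have ra: "Re (a * cnj u) = 1 + s * g"
    using na by (simp add: u_def g_def algebra_simps)
  have rb: "Re (b * cnj u) = g + s"
    using nb arg_cong[OF nb, of "\<lambda>x. s * x"] by (simp add: u_def g_def algebra_simps)
  have "s * g > - 1"
  proof -
    have "0 \<le> s * g \<or> 1 * g \<le> s * g"
      using s(1,2) by (cases "g \<ge> 0") (auto intro!: mult_right_mono_neg)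
    then show ?thesis using g by linarith
  qed
  then have "Re (a * cnj u) > 0" "Re (b * cnj u) > 0" using ra rb s by auto
  moreover from this have "u \<noteq> 0" by auto
  moreover have "inj_on (\<lambda>i. Re (p i * cnj u)) V"
  proof (rule inj_onI, rule ccontr)
    fix i j assume ij: "i \<in> V" "j \<in> V" "Re (p i * cnj u) = Re (p j * cnj u)" "i \<noteq> j"
    then have "Re ((p i - p j) * cnj u) = 0" by (simp add: algebra_simps)
    then have "s \<in> Bad (i,j)" by (simp add: Bad_def u_def)
    then show False using s(3) ij by blast
  qed
  ultimately show ?thesis by blast
qed

text \<open>The supporting direction \<open>q\<close> and the direction towards \<open>k0\<close>
  are independent, so one rotation turns both to the right and makes the positions generic; rotation
  and scaling multiply \<open>cr\<close> by a positive factor.\<close>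

lemma next_bar:
  assumes v: "v \<in> V" and q: "\<And>k. k \<in> V \<Longrightarrow> 0 \<le> cr q (p k - p v)"
    and k0: "k0 \<in> V" "cr q (p k0 - p v) \<noteq> 0"
  shows "\<exists>j\<in>V. adj v j \<and> (\<forall>k\<in>V. 0 \<le> cr (p j - p v) (p k - p v))"
proof -
  define d where "d = p k0 - p v"
  have nz: "q \<noteq> 0" "d \<noteq> 0" using k0 by (auto simp: d_def cr_def)
  have sg: "x = cmod x *\<^sub>R sgn x" for x by (cases "x = 0") (simp_all add: sgn_div_norm)
  have "cr q d = cmod q * (cmod d * cr (sgn q) (sgn d))"
    by (subst sg[of q], subst sg[of d]) (simp add: cr_scale_left cr_scale_right del: sgn_div_norm)
  then have "cr (sgn q) (sgn d) \<noteq> 0" using k0 by (auto simp: d_def)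
  then obtain u where u: "u \<noteq> 0" "Re (sgn q * cnj u) > 0" "Re (sgn d * cnj u) > 0" "inj_on (\<lambda>i. Re (p i * cnj u)) V"
    using generic_rotation[of "sgn q" "sgn d"] nz by (auto simp: norm_sgn)
  have "Re (q * cnj u) = cmod q * Re (sgn q * cnj u)" "Re (d * cnj u) = cmod d * Re (sgn d * cnj u)"
    by (simp_all add: sgn_div_norm field_simps nz)
  then have qd: "Re (q * cnj u) > 0" "Re (d * cnj u) > 0" using u nz by auto
  interpret R: stressed V adj w "\<lambda>i. p i * cnj u" using rotate u(1) by simp
  interpret R: generic_stressed V adj w "\<lambda>i. p i * cnj u" by unfold_locales (rule u(4))
  have cu: "(cmod (cnj u))\<^sup>2 > 0" using u(1) by simp
  have rot: "cr (a * cnj u) (b * cnj u - c * cnj u) = (cmod (cnj u))\<^sup>2 * cr a (b - c)" for a b c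
    using cr_rotate[of a "cnj u" "b - c"] by (simp add: algebra_simps)
  have "\<exists>j\<in>V. adj v j \<and> (\<forall>k\<in>V. 0 \<le> cr (p j * cnj u - p v * cnj u) (p k * cnj u - p v * cnj u))"
  proof (rule R.next_bar_generic[OF v qd(1) _ k0(1)])
    show "0 \<le> cr (q * cnj u) (p k * cnj u - p v * cnj u)" if "k \<in> V" for k
      unfolding rot using q[OF that] by simp
    show "R.X v < R.X k0" unfolding R.X_def using qd(2) by (simp add: d_def algebra_simps)
  qed
  then obtain j where j: "j \<in> V" "adj v j" "\<And>k. k \<in> V \<Longrightarrow> 0 \<le> cr ((p j - p v) * cnj u) (p k * cnj u - p v * cnj u)"
    by (auto simp: left_diff_distrib)
  then show ?thesis using cu unfolding rot by (intro bexI[of _ j]) (auto simp: zero_le_mult_iff)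
qed

end

text \<open>Complex conjugation changes the sign of \<open>cr\<close>, so this is
  \<open>next_bar\<close> for the mirror image with supporting direction
  \<open>- cnj q\<close>.\<close>

lemma (in stressed) prev_bar:
  assumes v: "v \<in> V" and q: "\<And>k. k \<in> V \<Longrightarrow> 0 \<le> cr q (p k - p v)"
    and k0: "k0 \<in> V" "cr q (p k0 - p v) \<noteq> 0"
  shows "\<exists>j\<in>V. adj v j \<and> (\<forall>k\<in>V. cr (p j - p v) (p k - p v) \<le> 0)"
proof -
  interpret C: stressed V adj w "\<lambda>i. cnj (p i)" by (rule reflect)
  have c: "cr (cnj a) (cnj b) = - cr a b" for a b by (simp add: cr_def)
  have d: "cnj (p i) - cnj (p v) = cnj (p i - p v)" for i by simp
  have "\<exists>j\<in>V. adj v j \<and> (\<forall>k\<in>V. 0 \<le> cr (cnj (p j) - cnj (p v)) (cnj (p k) - cnj (p v)))"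
    by (rule C.next_bar[OF v, of "- cnj q", OF _ k0(1)])
      (use q k0 in \<open>simp_all only: d cr_minus_left c\<close>, auto)
  then show ?thesis unfolding d c by auto
qed

section \<open>Energies and their critical stresses\<close>

text \<open>The proviso admits the diagonal terms of a sum over all pairs of vertices, where
  position difference and velocity difference are both 0.\<close>

lemma norm_line_DERIV:
  fixes x y :: "'a::real_inner"
  assumes "x = 0 \<Longrightarrow> y = 0"
  shows "((\<lambda>t. norm (x + t *\<^sub>R y)) has_real_derivative inner (sgn x) y) (at 0)"
proof (cases "x = 0")
  case True
  then show ?thesis using assms by simp
next
  case False
  have "((\<lambda>t. x + t *\<^sub>R y) has_derivative (\<lambda>t. t *\<^sub>R y)) (at (0::real))"
    by (auto intro!: derivative_eq_intros)
  moreover have "(norm has_derivative (\<lambda>h. inner h (sgn x))) (at (x + 0 *\<^sub>R y))"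
    using has_derivative_norm[OF False] by simp
  ultimately have "((\<lambda>t. norm (x + t *\<^sub>R y)) has_derivative (\<lambda>t. inner (t *\<^sub>R y) (sgn x))) (at 0)"
    by (rule has_derivative_compose)
  then show ?thesis
    unfolding has_field_derivative_def by (rule has_derivative_eq_rhs) (simp add: fun_eq_iff inner_commute)
qed

definition gap :: "nat set \<Rightarrow> ('t \<Rightarrow> nat \<Rightarrow> nat \<Rightarrow> real) \<Rightarrow> ('t \<Rightarrow> real) \<Rightarrow> 't \<Rightarrow> (nat \<Rightarrow> complex) \<Rightarrow> real" where
  "gap V c k \<tau> C = (\<Sum>i\<in>V. \<Sum>j\<in>V. c \<tau> i j * cmod (C i - C j)) + k \<tau>"

definition energy where
  "energy V c k T C = (\<Sum>\<tau>\<in>T. 1 / gap V c k \<tau> C)"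

text \<open>The coefficient of \<open>C j - C i\<close> in half the negative gradient of the energy at vertex \<open>i\<close>.\<close>
definition stress where
  "stress V c k T C i j = (\<Sum>\<tau>\<in>T. c \<tau> i j / (gap V c k \<tau> C)\<^sup>2) / cmod (C i - C j)"

text \<open>Moving vertex \<open>i\<close> affects the pairs in which it is the first and those in
  which it is the second index equally, whence the factor 2.\<close>

lemma gap_DERIV:
  assumes V: "finite V" "i \<in> V" and inj: "inj_on C V" and sym: "\<And>a b. c \<tau> a b = c \<tau> b a"
  shows "((\<lambda>t. gap V c k \<tau> (C(i := C i + t *\<^sub>R d))) has_real_derivative
     2 * (\<Sum>j\<in>V. c \<tau> i j * inner (sgn (C i - C j)) d)) (at 0)"
proof -
  let ?y = "\<lambda>a b. (if a = i then d else 0) - (if b = i then d else 0)"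
  have eq: "gap V c k \<tau> (C(i := C i + t *\<^sub>R d)) = (\<Sum>a\<in>V. \<Sum>b\<in>V. c \<tau> a b * cmod ((C a - C b) + t *\<^sub>R ?y a b)) + k \<tau>" for t
    unfolding gap_def by (intro arg_cong2[where f = "(+)"] sum.cong refl arg_cong2[where f = "(*)"] arg_cong[where f = cmod])
      (auto simp: algebra_simps)
  have "((\<lambda>t. gap V c k \<tau> (C(i := C i + t *\<^sub>R d))) has_real_derivative
     (\<Sum>a\<in>V. \<Sum>b\<in>V. c \<tau> a b * inner (sgn (C a - C b)) (?y a b)) + 0) (at 0)"
    unfolding eq
  proof (intro DERIV_add DERIV_sum DERIV_const DERIV_cmult norm_line_DERIV)
    fix a b assume "a \<in> V" "b \<in> V" "C a - C b = 0"
    then have "a = b" using inj by (auto dest: inj_onD)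
    then show "?y a b = 0" by simp
  qed
  moreover have "(\<Sum>a\<in>V. \<Sum>b\<in>V. c \<tau> a b * inner (sgn (C a - C b)) (?y a b)) = 2 * (\<Sum>j\<in>V. c \<tau> i j * inner (sgn (C i - C j)) d)"
  proof -
    have "(\<Sum>a\<in>V. \<Sum>b\<in>V. c \<tau> a b * inner (sgn (C a - C b)) (?y a b))
      = (\<Sum>a\<in>V. \<Sum>b\<in>V. if a = i then c \<tau> a b * inner (sgn (C a - C b)) d else 0)
      - (\<Sum>a\<in>V. \<Sum>b\<in>V. if b = i then c \<tau> a b * inner (sgn (C a - C b)) d else 0)"
      unfolding sum_subtractf[symmetric]
      by (intro sum.cong refl) (simp add: inner_diff_right right_diff_distrib)
    also have "(\<Sum>a\<in>V. \<Sum>b\<in>V. if a = i then c \<tau> a b * inner (sgn (C a - C b)) d else 0)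
      = (\<Sum>a\<in>V. if a = i then (\<Sum>b\<in>V. c \<tau> a b * inner (sgn (C a - C b)) d) else 0)"
      by (intro sum.cong refl) auto
    also have "\<dots> = (\<Sum>j\<in>V. c \<tau> i j * inner (sgn (C i - C j)) d)"
      using V by (simp add: sum.delta)
    also have "(\<Sum>a\<in>V. \<Sum>b\<in>V. if b = i then c \<tau> a b * inner (sgn (C a - C b)) d else 0)
      = (\<Sum>a\<in>V. c \<tau> a i * inner (sgn (C a - C i)) d)"
      using V by (simp add: sum.delta)
    also have "\<dots> = - (\<Sum>j\<in>V. c \<tau> i j * inner (sgn (C i - C j)) d)"
    proof -
      have "sgn (C a - C i) = - sgn (C i - C a)" for a by (metis minus_diff_eq sgn_minus)
      then show ?thesis unfolding sum_negf[symmetric] by (intro sum.cong refl) (simp add: sym[of _ i])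
    qed
    finally show ?thesis by simp
  qed
  ultimately show ?thesis by simp
qed

text \<open>The derivative of the energy when \<open>i\<close> moves in direction \<open>d\<close>
  is \<open>2 * inner S d\<close>, with \<open>S\<close> the resultant of the stress at
  \<open>i\<close>. Motions of this one vertex suffice, which is why the configuration space is kept
  open under them.\<close>

lemma critical_equilibrium:
  assumes V: "finite V" "i \<in> V" and T: "finite T" and inj: "inj_on C V"
    and sym: "\<And>\<tau> a b. \<tau> \<in> T \<Longrightarrow> c \<tau> a b = c \<tau> b a"
    and pos: "\<And>\<tau>. \<tau> \<in> T \<Longrightarrow> 0 < gap V c k \<tau> C"
    and crit: "\<And>d. \<exists>\<delta>>0. \<forall>t. \<bar>t\<bar> < \<delta> \<longrightarrow> energy V c k T C \<le> energy V c k T (C(i := C i + t *\<^sub>R d))"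
  shows "(\<Sum>j\<in>V. stress V c k T C i j *\<^sub>R (C j - C i)) = 0"
proof -
  define S where "S = (\<Sum>j\<in>V. stress V c k T C i j *\<^sub>R (C j - C i))"
  have "inner S d = 0" for d
  proof -
    have 1: "((\<lambda>t. 1 / gap V c k \<tau> (C(i := C i + t *\<^sub>R d))) has_real_derivative
       - (2 * (\<Sum>j\<in>V. c \<tau> i j * inner (sgn (C i - C j)) d)) / (gap V c k \<tau> C)\<^sup>2) (at 0)"
      if \<tau>: "\<tau> \<in> T" for \<tau>
    proof -
      have z: "C(i := C i + 0 *\<^sub>R d) = C" by simp
      have "gap V c k \<tau> (C(i := C i + 0 *\<^sub>R d)) \<noteq> 0" using pos[OF \<tau>] by simp
      from DERIV_divide[OF DERIV_const gap_DERIV[of V i C c \<tau>, OF V inj sym[OF \<tau>]] this, of 1]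
      show ?thesis by (simp add: power2_eq_square fun_upd_def)
    qed
    have "((\<lambda>t. energy V c k T (C(i := C i + t *\<^sub>R d))) has_real_derivative
      (\<Sum>\<tau>\<in>T. - (2 * (\<Sum>j\<in>V. c \<tau> i j * inner (sgn (C i - C j)) d)) / (gap V c k \<tau> C)\<^sup>2)) (at 0)"
      unfolding energy_def by (intro DERIV_sum 1)
    moreover have "(\<Sum>\<tau>\<in>T. - (2 * (\<Sum>j\<in>V. c \<tau> i j * inner (sgn (C i - C j)) d)) / (gap V c k \<tau> C)\<^sup>2) = 2 * inner S d"
    proof -
      have "(\<Sum>\<tau>\<in>T. - (2 * (\<Sum>j\<in>V. c \<tau> i j * inner (sgn (C i - C j)) d)) / (gap V c k \<tau> C)\<^sup>2)
        = (\<Sum>\<tau>\<in>T. \<Sum>j\<in>V. 2 * (c \<tau> i j / (gap V c k \<tau> C)\<^sup>2 * inner (sgn (C j - C i)) d))"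
      proof (intro sum.cong refl)
        fix \<tau>
        have s: "sgn (C j - C i) = - sgn (C i - C j)" for j by (metis minus_diff_eq sgn_minus)
        show "- (2 * (\<Sum>j\<in>V. c \<tau> i j * inner (sgn (C i - C j)) d)) / (gap V c k \<tau> C)\<^sup>2
          = (\<Sum>j\<in>V. 2 * (c \<tau> i j / (gap V c k \<tau> C)\<^sup>2 * inner (sgn (C j - C i)) d))"
          unfolding sum_distrib_left sum_divide_distrib sum_negf[symmetric]
          by (intro sum.cong refl) (simp add: s)
      qed
      also have "\<dots> = (\<Sum>j\<in>V. \<Sum>\<tau>\<in>T. 2 * (c \<tau> i j / (gap V c k \<tau> C)\<^sup>2 * inner (sgn (C j - C i)) d))"
        by (rule sum.swap)
      also have "\<dots> = (\<Sum>j\<in>V. 2 * (stress V c k T C i j * inner (C j - C i) d))"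
      proof (intro sum.cong refl)
        fix j
        have "stress V c k T C i j * inner (C j - C i) d
            = (\<Sum>\<tau>\<in>T. c \<tau> i j / (gap V c k \<tau> C)\<^sup>2) * inner (sgn (C j - C i)) d"
          by (simp add: stress_def sgn_div_norm norm_minus_commute divide_inverse)
        then show "(\<Sum>\<tau>\<in>T. 2 * (c \<tau> i j / (gap V c k \<tau> C)\<^sup>2 * inner (sgn (C j - C i)) d))
          = 2 * (stress V c k T C i j * inner (C j - C i) d)"
          by (simp add: sum_distrib_left sum_distrib_right)
      qed
      also have "\<dots> = 2 * inner S d"
        by (simp add: S_def inner_sum_left sum_distrib_left)
      finally show ?thesis .
    qed
    ultimately have D: "((\<lambda>t. energy V c k T (C(i := C i + t *\<^sub>R d))) has_real_derivative 2 * inner S d) (at 0)" by simp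
    obtain \<delta> where "\<delta> > 0" "\<And>t. \<bar>t\<bar> < \<delta> \<Longrightarrow> energy V c k T C \<le> energy V c k T (C(i := C i + t *\<^sub>R d))"
      using crit[of d] by blast
    then have "2 * inner S d = 0" by (intro DERIV_local_min[OF D, of \<delta>]) auto
    then show ?thesis by simp
  qed
  then have "S = 0" by (metis inner_eq_zero_iff)
  then show ?thesis by (simp add: S_def)
qed

lemma stress_sym:
  assumes "\<And>\<tau> a b. \<tau> \<in> T \<Longrightarrow> c \<tau> a b = c \<tau> b a"
  shows "stress V c k T C i j = stress V c k T C j i"
  unfolding stress_def using assms by (simp add: norm_minus_commute[of "C i"])

text \<open>Newton's third law: internal forces add up to zero, so a vertex held fixed is in
  equilibrium as soon as all others are.\<close>
lemma equilibrium_pinned: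
  fixes s :: "nat \<Rightarrow> nat \<Rightarrow> real" and C :: "nat \<Rightarrow> complex"
  assumes V: "finite V" "v \<in> V" and sym: "\<And>i j. i \<in> V \<Longrightarrow> j \<in> V \<Longrightarrow> s i j = s j i"
    and eq: "\<And>i. i \<in> V \<Longrightarrow> i \<noteq> v \<Longrightarrow> (\<Sum>j\<in>V. s i j *\<^sub>R (C j - C i)) = 0"
  shows "(\<Sum>j\<in>V. s v j *\<^sub>R (C j - C v)) = 0"
proof -
  let ?F = "\<Sum>i\<in>V. \<Sum>j\<in>V. s i j *\<^sub>R (C j - C i)"
  have "?F = (\<Sum>j\<in>V. \<Sum>i\<in>V. s i j *\<^sub>R (C j - C i))" by (rule sum.swap)
  also have "\<dots> = - ?F"
    unfolding sum_negf[symmetric]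
    by (intro sum.cong refl) (simp add: sym scaleR_right.minus[symmetric] del: scaleR_minus_right)
  finally have "?F = 0" by simp
  moreover have "?F = (\<Sum>j\<in>V. s v j *\<^sub>R (C j - C v)) + (\<Sum>i\<in>V - {v}. \<Sum>j\<in>V. s i j *\<^sub>R (C j - C i))"
    by (rule sum.remove[OF V])
  moreover have "(\<Sum>i\<in>V - {v}. \<Sum>j\<in>V. s i j *\<^sub>R (C j - C i)) = 0"
    by (rule sum.neutral) (use eq in auto)
  ultimately show ?thesis by simp
qed

section \<open>Crossing segments\<close>

lemma in_segment_iff:
  fixes a b :: "'a::real_vector"
  shows "x \<in> closed_segment a b \<longleftrightarrow> (\<exists>t. 0 \<le> t \<and> t \<le> 1 \<and> x = a + t *\<^sub>R (b - a))"
  by (auto simp: closed_segment_def algebra_simps)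

lemma cr_eq_0_imp:
  assumes "cr u z = 0" "cr v z = 0" "cr u v \<noteq> 0"
  shows "z = 0"
proof -
  have "cr u v *\<^sub>R z = cr z v *\<^sub>R u + cr u z *\<^sub>R v"
    by (simp add: complex_eq_iff cr_def algebra_simps)
  then show ?thesis using assms cr_commute[of z v] by simp
qed

text \<open>Proper crossing, expressed by strict signs of orientations: its negation is a closed
  condition on the end points, whereas disjointness of segments is an open one.\<close>

definition cross :: "complex \<Rightarrow> complex \<Rightarrow> complex \<Rightarrow> complex \<Rightarrow> bool" where
  "cross p q a b \<longleftrightarrow> cr (q - p) (a - p) * cr (q - p) (b - p) < 0 \<and> cr (b - a) (p - a) * cr (b - a) (q - a) < 0"

lemma opposite_signs_ratio:
  fixes x y :: real
  assumes "x * y < 0"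
  shows "0 < x / (x - y)" "x / (x - y) < 1" "x + x / (x - y) * (y - x) = 0"
proof -
  have "x < 0 \<and> 0 < y \<or> 0 < x \<and> y < 0" using assms by (auto simp: mult_less_0_iff)
  then show "0 < x / (x - y)" "x / (x - y) < 1" "x + x / (x - y) * (y - x) = 0"
    by (auto simp: field_simps)
qed

lemma cross_imp_meet:
  assumes "cross p q a b"
  shows "closed_segment p q \<inter> closed_segment a b \<noteq> {}"
proof -
  define \<alpha> where "\<alpha> = cr (q - p) (a - p)"
  define \<beta> where "\<beta> = cr (q - p) (b - p)"
  define \<gamma> where "\<gamma> = cr (b - a) (p - a)"
  define \<delta> where "\<delta> = cr (b - a) (q - a)"
  have ab: "\<alpha> * \<beta> < 0" and cd: "\<gamma> * \<delta> < 0"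
    using assms by (auto simp: cross_def \<alpha>_def \<beta>_def \<gamma>_def \<delta>_def)
  define s where "s = \<alpha> / (\<alpha> - \<beta>)"
  define t where "t = \<gamma> / (\<gamma> - \<delta>)"
  note s = opposite_signs_ratio[OF ab, folded s_def] and t = opposite_signs_ratio[OF cd, folded t_def]
  define x where "x = (1 - s) *\<^sub>R a + s *\<^sub>R b"
  define y where "y = (1 - t) *\<^sub>R p + t *\<^sub>R q"
  have "cr (q - p) (x - y) = \<alpha> + s * (\<beta> - \<alpha>)"
    by (simp add: x_def y_def \<alpha>_def \<beta>_def cr_def algebra_simps)
  moreover have "cr (b - a) (x - y) = - (\<gamma> + t * (\<delta> - \<gamma>))"
    by (simp add: x_def y_def \<gamma>_def \<delta>_def cr_def algebra_simps)
  moreover have "cr (q - p) (b - a) = \<beta> - \<alpha>"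
    by (simp add: \<alpha>_def \<beta>_def cr_def algebra_simps)
  ultimately have "x - y = 0"
    using s(3) t(3) ab by (intro cr_eq_0_imp[of "q - p" _ "b - a"]) auto
  moreover have "x \<in> closed_segment a b" "y \<in> closed_segment p q"
    using s t by (auto simp: x_def y_def closed_segment_def intro: less_imp_le)
  ultimately show ?thesis by auto
qed

lemma meet_imp_cross:
  assumes z: "z \<in> closed_segment p q" "z \<in> closed_segment a b"
    and ends: "p \<notin> closed_segment a b" "q \<notin> closed_segment a b" "a \<notin> closed_segment p q" "b \<notin> closed_segment p q"
  shows "cross p q a b"
proof -
  have one: "cr (q - p) (a - p) * cr (q - p) (b - p) < 0"
    if z: "z \<in> closed_segment p q" "z \<in> closed_segment a b"
      and ends: "p \<notin> closed_segment a b" "q \<notin> closed_segment a b" "a \<notin> closed_segment p q" "b \<notin> closed_segment p q"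
    for p q a b
  proof -
    obtain t where t: "0 \<le> t" "t \<le> 1" "z = (1 - t) *\<^sub>R p + t *\<^sub>R q" using z(1) by (auto simp: closed_segment_def)
    obtain s where s: "0 \<le> s" "s \<le> 1" "z = (1 - s) *\<^sub>R a + s *\<^sub>R b" using z(2) by (auto simp: closed_segment_def)
    have "s \<noteq> 0" "s \<noteq> 1" "t \<noteq> 0" "t \<noteq> 1" using z ends s(3) t(3) by auto
    then have st: "0 < s" "s < 1" "0 < t" "t < 1" using s t by auto
    define \<alpha> where "\<alpha> = cr (q - p) (a - p)"
    define \<beta> where "\<beta> = cr (q - p) (b - p)"
    have "cr (q - p) (z - p) = 0" by (simp add: t(3) cr_def algebra_simps)
    moreover have "cr (q - p) (z - p) = (1 - s) * \<alpha> + s * \<beta>"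
      by (simp add: s(3) \<alpha>_def \<beta>_def cr_def algebra_simps)
    ultimately have e: "(1 - s) * \<alpha> = - s * \<beta>" by simp
    \<comment> \<open>If \<open>a\<close> were on the line of \<open>p\<close> and \<open>q\<close>,
      so would be \<open>b\<close>; two overlapping segments of one line cannot both avoid the end
      points of the other.\<close>
    have "\<alpha> \<noteq> 0"
    proof
      assume a0: "\<alpha> = 0"
      then have b0: "\<beta> = 0" using e st by simp
      have pq: "q - p \<noteq> 0" using z ends by auto
      have on: "\<exists>r. x = p + r *\<^sub>R (q - p)" if "cr (q - p) (x - p) = 0" for x
      proof -
        define r where "r = Re ((x - p) / (q - p))"
        have "Im ((x - p) * cnj (q - p)) = 0" using that by (simp add: cr_def algebra_simps)
        then have "Im ((x - p) / (q - p)) = 0" by (simp add: Im_divide cr_def algebra_simps)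
        then have "(x - p) / (q - p) = of_real r" by (simp add: complex_eq_iff r_def)
        then have "x - p = r *\<^sub>R (q - p)" using pq by (simp add: field_simps scaleR_conv_of_real)
        then show ?thesis by (intro exI[of _ r]) (simp add: algebra_simps)
      qed
      obtain ra where ra: "a = p + ra *\<^sub>R (q - p)" using on[of a] a0 by (auto simp: \<alpha>_def)
      obtain rb where rb: "b = p + rb *\<^sub>R (q - p)" using on[of b] b0 by (auto simp: \<beta>_def)
      have "z = p + ((1 - s) * ra + s * rb) *\<^sub>R (q - p)" by (simp add: s(3) ra rb algebra_simps)
      moreover have "z = p + t *\<^sub>R (q - p)" by (simp add: t(3) algebra_simps)
      ultimately have tt: "t = (1 - s) * ra + s * rb" using pq by simp
      have out: "r < 0 \<or> 1 < r" if "p + r *\<^sub>R (q - p) \<notin> closed_segment p q" for r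
      proof (rule ccontr)
        assume "\<not> (r < 0 \<or> 1 < r)"
        then have "p + r *\<^sub>R (q - p) \<in> closed_segment p q"
          unfolding closed_segment_def by (intro CollectI exI[of _ r]) (simp add: algebra_simps)
        then show False using that by simp
      qed
      have oa: "ra < 0 \<or> 1 < ra" and ob: "rb < 0 \<or> 1 < rb" using out ends ra rb by auto
      have "p \<in> closed_segment a b"
      proof -
        have "\<not> (ra < 0 \<and> rb < 0)"
        proof
          assume "ra < 0 \<and> rb < 0"
          then have "(1 - s) * ra < 0" "s * rb < 0" using st by (auto simp: mult_less_0_iff)
          then show False using tt st by linarith
        qed
        moreover have "\<not> (1 < ra \<and> 1 < rb)"
        proof
          assume "1 < ra \<and> 1 < rb"
          then have "1 - s < (1 - s) * ra" "s < s * rb" using st by simp_all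
          then show False using tt st by linarith
        qed
        ultimately have opp: "ra * rb < 0" using oa ob by (auto simp: mult_less_0_iff)
        note r = opposite_signs_ratio[OF opp]
        have "p = a + (ra / (ra - rb)) *\<^sub>R (b - a)"
        proof -
          have "b - a = (rb - ra) *\<^sub>R (q - p)" unfolding ra rb scaleR_left_diff_distrib by simp
          then have "a + (ra / (ra - rb)) *\<^sub>R (b - a) = a + (ra / (ra - rb) * (rb - ra)) *\<^sub>R (q - p)" by simp
          also have "\<dots> = p + (ra + ra / (ra - rb) * (rb - ra)) *\<^sub>R (q - p)"
            by (subst ra) (simp only: scaleR_left_distrib add.assoc)
          finally have "a + (ra / (ra - rb)) *\<^sub>R (b - a) = p + (ra + ra / (ra - rb) * (rb - ra)) *\<^sub>R (q - p)" .
          then show ?thesis by (simp only: r(3)) simp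
        qed
        then show ?thesis unfolding in_segment_iff using r by (intro exI[of _ "ra / (ra - rb)"]) auto
      qed
      then show False using ends by simp
    qed
    have "(1 - s) * (\<alpha> * \<beta>) = - (s * (\<beta> * \<beta>))"
      using arg_cong[OF e, of "\<lambda>x. x * \<beta>"] by (simp add: mult.assoc)
    moreover have "\<beta> \<noteq> 0" using e \<open>\<alpha> \<noteq> 0\<close> st by auto
    then have "s * (\<beta> * \<beta>) > 0" using st by (auto simp: zero_less_mult_iff)
    ultimately have "(1 - s) * (\<alpha> * \<beta>) < 0" by linarith
    then show ?thesis using st by (simp add: mult_less_0_iff \<alpha>_def \<beta>_def)
  qed
  show ?thesis unfolding cross_def using one[OF z ends] one[of a b p q, OF z(2,1)] ends by auto
qed

lemma disjoint_segments_stable: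
  fixes p q a b :: complex
  assumes "closed_segment p q \<inter> closed_segment a b = {}"
  shows "\<exists>\<delta>>0. \<forall>p' q' a' b'. cmod (p' - p) < \<delta> \<longrightarrow> cmod (q' - q) < \<delta> \<longrightarrow> cmod (a' - a) < \<delta> \<longrightarrow> cmod (b' - b) < \<delta> \<longrightarrow>
     closed_segment p' q' \<inter> closed_segment a' b' = {}"
proof -
  obtain \<delta> where \<delta>: "\<delta> > 0" "\<And>x y. x \<in> closed_segment p q \<Longrightarrow> y \<in> closed_segment a b \<Longrightarrow> \<delta> \<le> dist x y"
    using separate_compact_closed[of "closed_segment p q" "closed_segment a b"] assms by auto
  have near: "\<exists>x\<in>closed_segment p q. cmod (z - x) < \<delta> / 2"
    if h: "cmod (p' - p) < \<delta> / 2" "cmod (q' - q) < \<delta> / 2" "z \<in> closed_segment p' q'" for p q p' q' z :: complex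
  proof -
    obtain t where t: "0 \<le> t" "t \<le> 1" "z = (1 - t) *\<^sub>R p' + t *\<^sub>R q'" using h(3) by (auto simp: closed_segment_def)
    have "z - ((1 - t) *\<^sub>R p + t *\<^sub>R q) = (1 - t) *\<^sub>R (p' - p) + t *\<^sub>R (q' - q)" by (simp add: t(3) algebra_simps)
    moreover have "(1 - t) *\<^sub>R (p' - p) + t *\<^sub>R (q' - q) \<in> ball 0 (\<delta> / 2)"
      by (rule convexD[OF convex_ball]) (use h t in auto)
    ultimately show ?thesis using t by (intro bexI[of _ "(1 - t) *\<^sub>R p + t *\<^sub>R q"]) (auto simp: closed_segment_def)
  qed
  show ?thesis
  proof (intro exI[of _ "\<delta> / 2"] conjI allI impI)
    fix p' q' a' b' assume h: "cmod (p' - p) < \<delta> / 2" "cmod (q' - q) < \<delta> / 2" "cmod (a' - a) < \<delta> / 2" "cmod (b' - b) < \<delta> / 2"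
    show "closed_segment p' q' \<inter> closed_segment a' b' = {}"
    proof (rule ccontr)
      assume "closed_segment p' q' \<inter> closed_segment a' b' \<noteq> {}"
      then obtain z where z: "z \<in> closed_segment p' q'" "z \<in> closed_segment a' b'" by auto
      obtain x where x: "x \<in> closed_segment p q" "cmod (z - x) < \<delta> / 2" using near[OF h(1,2) z(1)] by blast
      obtain y where y: "y \<in> closed_segment a b" "cmod (z - y) < \<delta> / 2" using near[OF h(3,4) z(2)] by blast
      have "dist x y \<le> cmod (z - x) + cmod (z - y)"
        by (metis dist_commute dist_norm dist_triangle2)
      then show False using \<delta>(2)[OF x(1) y(1)] x y by linarith
    qed
  qed (use \<delta> in auto)
qed

text \<open>If two segments from \<open>v\<close> share another point, they lie on one ray, and the
  shorter one ends on the longer one.\<close>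

lemma segments_common_end:
  fixes v x y :: "'a::real_vector"
  assumes "x \<notin> closed_segment v y" "y \<notin> closed_segment v x"
  shows "closed_segment v x \<inter> closed_segment v y \<subseteq> {v}"
proof
  fix z assume "z \<in> closed_segment v x \<inter> closed_segment v y"
  then obtain s t where s: "0 \<le> s" "s \<le> 1" "z = v + s *\<^sub>R (x - v)" and t: "0 \<le> t" "t \<le> 1" "z = v + t *\<^sub>R (y - v)"
    unfolding Int_iff in_segment_iff by blast
  have e: "s *\<^sub>R (x - v) = t *\<^sub>R (y - v)" using s t by simp
  have key: "False" if "0 \<le> s" "s \<le> t" "0 < t" "s *\<^sub>R (x - v) = t *\<^sub>R (y - v)" "y \<notin> closed_segment v x" for s t :: real and x y
  proof -
    have "y - v = (1 / t) *\<^sub>R (t *\<^sub>R (y - v))" using that(3) by simp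
    then have "y - v = (s / t) *\<^sub>R (x - v)" unfolding that(4)[symmetric] by simp
    then have "y = v + (s / t) *\<^sub>R (x - v)" by (metis add.commute diff_add_cancel)
    moreover have "0 \<le> s / t" "s / t \<le> 1" using that by auto
    ultimately show False using that(5) unfolding in_segment_iff by blast
  qed
  have "s = 0 \<or> t = 0"
  proof (rule ccontr)
    assume "\<not> (s = 0 \<or> t = 0)"
    then have "s > 0" "t > 0" using s t by auto
    then show False
      using key[of s t x y, OF s(1) _ _ e assms(2)] key[of t s y x, OF t(1) _ _ e[symmetric] assms(1)] by linarith
  qed
  then show "z \<in> {v}" using s t by auto
qed

section \<open>Open and closed chains\<close>

lemma continuous_on_coord [continuous_intros]: "continuous_on S (\<lambda>C. (C :: 'i \<Rightarrow> 'b::topological_space) v)"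
  by (rule continuous_on_subset[OF continuous_on_product_coordinates]) simp

lemma compact_box_fun:
  fixes K :: "'i \<Rightarrow> 'b::topological_space set"
  assumes "\<And>v. compact (K v)"
  shows "compact {C. \<forall>v. C v \<in> K v}"
proof -
  have "compactin (product_topology (\<lambda>_. euclidean) UNIV) (PiE UNIV K)"
    unfolding compactin_PiE using assms by simp
  moreover have "PiE UNIV K = {C. \<forall>v. C v \<in> K v}" by (auto simp: PiE_UNIV_domain)
  ultimately show ?thesis by (simp add: euclidean_product_topology)
qed

locale chain =
  fixes N m :: nat
  assumes size: "m = N - 1 \<and> 2 \<le> N \<or> m = N \<and> 3 \<le> N"
begin

text \<open>The wrap-around \<open>tg (N - 1) = 0\<close> is a bar only when \<open>m = N\<close>;
  for an open chain the index \<open>N - 1\<close> is not below \<open>m\<close>, so both kinds of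
  chain share one formula.\<close>

definition tg where "tg e = Suc e mod N"
definition adj where "adj i j \<longleftrightarrow> (\<exists>e<m. i = e \<and> j = tg e \<or> i = tg e \<and> j = e)"
definition nt where
  "nt C \<longleftrightarrow> (\<forall>e<m. \<forall>f<m. e \<noteq> f \<longrightarrow>
      closed_segment (C e) (C (tg e)) \<inter> closed_segment (C f) (C (tg f)) \<subseteq> {C e, C (tg e)} \<inter> {C f, C (tg f)})
    \<and> inj_on C {..<N}"
text \<open>Vertex 0 is pinned to divide out translations, and the length bounds are strict so that
  every other vertex can be moved a little.\<close>

definition confs where
  "confs a b = {C. (\<forall>v\<ge>N. C v = 0) \<and> C 0 = (0::complex) \<and>
      (\<forall>e<m. a e < cmod (C (tg e) - C e) \<and> cmod (C (tg e) - C e) < b e) \<and> nt C}"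

lemma N: "2 \<le> N" "m \<le> N" "0 < m" "N \<le> Suc m" using size by auto

lemma tg_less [simp]: "tg e < N" using N by (simp add: tg_def)

lemma tg_Suc: "Suc e < N \<Longrightarrow> tg e = Suc e" by (simp add: tg_def)

lemma tg_last: "tg (N - 1) = 0" using N by (simp add: tg_def)

lemma tg_cases: "e < N \<Longrightarrow> tg e = (if e = N - 1 then 0 else Suc e)"
  using tg_last by (auto simp: tg_Suc)

lemma tg_neq: "e < m \<Longrightarrow> tg e \<noteq> e" "e < m \<Longrightarrow> e \<noteq> tg e"
  using size by (auto simp: tg_cases split: if_splits)

lemma tg_inj: "e < N \<Longrightarrow> f < N \<Longrightarrow> tg e = tg f \<Longrightarrow> e = f"
  by (auto simp: tg_cases split: if_splits)

lemma edge_unique: "e < m \<Longrightarrow> f < m \<Longrightarrow> {e, tg e} = {f, tg f} \<Longrightarrow> e = f"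
  using size by (auto simp: doubleton_eq_iff tg_cases split: if_splits)

lemma adj_sym: "adj i j \<Longrightarrow> adj j i" by (auto simp: adj_def)

lemma adj_tg: "e < m \<Longrightarrow> adj e (tg e)" by (auto simp: adj_def)

lemma deg: "card {j\<in>{..<N}. adj v j} \<le> 2"
proof -
  have "{j\<in>{..<N}. adj v j} \<subseteq> {tg v} \<union> {j\<in>{..<N}. tg j = v}" by (auto simp: adj_def)
  then have "card {j\<in>{..<N}. adj v j} \<le> card ({tg v} \<union> {j\<in>{..<N}. tg j = v})" by (intro card_mono) auto
  also have "\<dots> \<le> 1 + card {j\<in>{..<N}. tg j = v}" by (rule order_trans[OF card_Un_le]) simp
  also have "card {j\<in>{..<N}. tg j = v} \<le> Suc 0"
    by (subst card_le_Suc0_iff_eq) (auto intro: tg_inj)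
  finally show ?thesis by simp
qed

lemma incident: "v < N \<Longrightarrow> \<exists>e<m. v = e \<or> v = tg e"
proof (cases "v < m")
  case False
  assume "v < N"
  then have "v = N - 1" "m = N - 1" using False size by auto
  then have "m - 1 < m" "v = tg (m - 1)" using N by (auto simp: tg_cases)
  then show ?thesis by blast
qed auto

text \<open>Index \<open>Inl (v, e)\<close> measures how far vertex \<open>v\<close> is from bar \<open>e\<close>, by the excess of
  the distances from \<open>v\<close> to the ends of \<open>e\<close> over the length of \<open>e\<close>: it is positive off the bar, and
  increases with the distances. The other indices keep the bar lengths between their bounds.\<close>
definition E2 where "E2 x y = (\<lambda>i j::nat. if i = x \<and> j = y \<or> i = y \<and> j = x then 1/2 else (0::real))"
definition gaps :: "(nat \<times> nat + nat + nat) set" where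
  "gaps = Inl ` {(v,e). v < N \<and> e < m \<and> v \<noteq> e \<and> v \<noteq> tg e} \<union> (Inr \<circ> Inl) ` {..<m} \<union> (Inr \<circ> Inr) ` {..<m}"
definition cf :: "(nat \<times> nat + nat + nat) \<Rightarrow> nat \<Rightarrow> nat \<Rightarrow> real" where
  "cf \<tau> i j = (case \<tau> of Inl (v,e) \<Rightarrow> E2 v e i j + E2 v (tg e) i j - E2 e (tg e) i j
     | Inr (Inl e) \<Rightarrow> E2 e (tg e) i j | Inr (Inr e) \<Rightarrow> - E2 e (tg e) i j)"
definition kf :: "(nat \<Rightarrow> real) \<Rightarrow> (nat \<Rightarrow> real) \<Rightarrow> (nat \<times> nat + nat + nat) \<Rightarrow> real" where
  "kf a b \<tau> = (case \<tau> of Inl _ \<Rightarrow> 0 | Inr (Inl e) \<Rightarrow> - a e | Inr (Inr e) \<Rightarrow> b e)"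

lemma finite_gaps: "finite gaps"
proof -
  have "finite {(v,e). v < N \<and> e < m \<and> v \<noteq> e \<and> v \<noteq> tg e}"
    by (rule finite_subset[of _ "{..<N} \<times> {..<m}"]) auto
  then show ?thesis by (simp add: gaps_def)
qed

lemma cf_sym: "cf \<tau> i j = cf \<tau> j i"
proof -
  have "E2 x y i j = E2 x y j i" for x y by (auto simp: E2_def)
  then show ?thesis unfolding cf_def by presburger
qed

lemma sum_E2:
  fixes C :: "nat \<Rightarrow> complex"
  assumes "x < N" "y < N" "x \<noteq> y"
  shows "(\<Sum>i<N. \<Sum>j<N. E2 x y i j * cmod (C i - C j)) = cmod (C x - C y)"
proof -
  have "(\<Sum>i<N. \<Sum>j<N. E2 x y i j * cmod (C i - C j))
     = (\<Sum>i<N. \<Sum>j<N. (if i = x then if j = y then cmod (C x - C y) / 2 else 0 else 0)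
         + (if i = y then if j = x then cmod (C x - C y) / 2 else 0 else 0))"
    using assms(3) by (intro sum.cong refl) (auto simp: E2_def norm_minus_commute)
  also have "\<dots> = (\<Sum>i<N. (if i = x then \<Sum>j<N. if j = y then cmod (C x - C y) / 2 else 0 else 0)
         + (if i = y then \<Sum>j<N. if j = x then cmod (C x - C y) / 2 else 0 else 0))"
    by (intro sum.cong refl) (auto simp: sum.distrib)
  also have "\<dots> = cmod (C x - C y)"
    using assms by (simp add: sum.distrib)
  finally show ?thesis .
qed

abbreviation gp where "gp a b \<equiv> gap {..<N} cf (kf a b)"

lemma gap_vertex:
  "v < N \<Longrightarrow> e < m \<Longrightarrow> v \<noteq> e \<Longrightarrow> v \<noteq> tg e \<Longrightarrow>
    gp a b (Inl (v,e)) C = cmod (C v - C e) + cmod (C v - C (tg e)) - cmod (C e - C (tg e))"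
  using N sum_E2[of v e C] sum_E2[of v "tg e" C] sum_E2[of e "tg e" C] tg_neq[of e]
  by (simp add: gap_def cf_def kf_def sum.distrib sum_subtractf left_diff_distrib distrib_right)

lemma gap_lower: "e < m \<Longrightarrow> gp a b (Inr (Inl e)) C = cmod (C (tg e) - C e) - a e"
  using N sum_E2[of e "tg e" C] tg_neq[of e]
  by (simp add: gap_def cf_def kf_def norm_minus_commute)

lemma gap_upper: "e < m \<Longrightarrow> gp a b (Inr (Inr e)) C = b e - cmod (C (tg e) - C e)"
  using N sum_E2[of e "tg e" C] tg_neq[of e]
  by (simp add: gap_def cf_def kf_def norm_minus_commute sum_negf)

lemma gap_vertex_pos:
  assumes "v < N" "e < m" "v \<noteq> e" "v \<noteq> tg e"
  shows "0 < gp a b (Inl (v,e)) C \<longleftrightarrow> C v \<notin> closed_segment (C e) (C (tg e))"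
proof -
  have "dist (C e) (C (tg e)) \<le> dist (C e) (C v) + dist (C v) (C (tg e))" by (rule dist_triangle)
  then show ?thesis
    unfolding gap_vertex[OF assms] between_mem_segment[symmetric] between
    by (auto simp: dist_norm norm_minus_commute)
qed

lemma all_gaps: "(\<forall>\<tau>\<in>gaps. 0 < gp a b \<tau> C) \<longleftrightarrow>
   (\<forall>v<N. \<forall>e<m. v \<noteq> e \<longrightarrow> v \<noteq> tg e \<longrightarrow> C v \<notin> closed_segment (C e) (C (tg e))) \<and>
   (\<forall>e<m. a e < cmod (C (tg e) - C e) \<and> cmod (C (tg e) - C e) < b e)"
  unfolding gaps_def ball_Un ball_simps by (auto simp: gap_vertex_pos gap_lower gap_upper)

section \<open>Nontouching as an open and as a closed condition\<close>

definition apart where "apart C \<longleftrightarrow> (\<forall>e<m. \<forall>f<m. {e, tg e} \<inter> {f, tg f} = {} \<longrightarrow>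
   closed_segment (C e) (C (tg e)) \<inter> closed_segment (C f) (C (tg f)) = {})"

definition uncrossed where "uncrossed C \<longleftrightarrow> (\<forall>e<m. \<forall>f<m. {e, tg e} \<inter> {f, tg f} = {} \<longrightarrow>
   \<not> cross (C e) (C (tg e)) (C f) (C (tg f)))"

lemma nt_vertex:
  assumes nt: "nt C" and v: "v < N" "e < m" "v \<noteq> e" "v \<noteq> tg e"
  shows "C v \<notin> closed_segment (C e) (C (tg e))"
proof
  assume on: "C v \<in> closed_segment (C e) (C (tg e))"
  obtain f where f: "f < m" "v = f \<or> v = tg f" using incident[OF v(1)] by auto
  have "f \<noteq> e" using f v by auto
  moreover have "C v \<in> closed_segment (C f) (C (tg f))" using f by auto
  ultimately have "C v \<in> {C e, C (tg e)}" using nt f v on unfolding nt_def by blast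
  moreover have "e < N" using v N by linarith
  ultimately show False using nt v unfolding nt_def by (auto dest: inj_onD)
qed

text \<open>Positive gaps keep every vertex off the bars that do not contain it. Bars with a common
  vertex then meet only there, by \<open>segments_common_end\<close>, so only pairs of bars without
  common vertex are left to check.\<close>

lemma nt_iff_apart:
  fixes a b :: "nat \<Rightarrow> real"
  assumes a: "\<And>e. e < m \<Longrightarrow> 0 \<le> a e" and g: "\<forall>\<tau>\<in>gaps. 0 < gp a b \<tau> C"
  shows "nt C \<longleftrightarrow> apart C"
proof
  assume nt: "nt C"
  show "apart C" unfolding apart_def
  proof (intro allI impI)
    fix e f assume h: "e < m" "f < m" "{e, tg e} \<inter> {f, tg f} = {}"
    then have "e \<noteq> f" by auto
    then have "closed_segment (C e) (C (tg e)) \<inter> closed_segment (C f) (C (tg f)) \<subseteq> C ` {e, tg e} \<inter> C ` {f, tg f}"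
      using nt h unfolding nt_def by (auto; blast)
    also have "\<dots> = C ` ({e, tg e} \<inter> {f, tg f})"
      by (rule inj_on_image_Int[symmetric, of C "{..<N}"]) (use nt h N in \<open>auto simp: nt_def\<close>)
    finally show "closed_segment (C e) (C (tg e)) \<inter> closed_segment (C f) (C (tg f)) = {}" using h by auto
  qed
next
  assume ap: "apart C"
  have off: "C v \<notin> closed_segment (C e) (C (tg e))" if "v < N" "e < m" "v \<noteq> e" "v \<noteq> tg e" for v e
    using g that unfolding all_gaps by blast
  have pos: "C (tg e) \<noteq> C e" if "e < m" for e
    using g a that unfolding all_gaps by force
  have "inj_on C {..<N}"
  proof (rule inj_onI, rule ccontr)
    fix v u assume vu: "v \<in> {..<N}" "u \<in> {..<N}" "C v = C u" "v \<noteq> u"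
    obtain f where f: "f < m" "u = f \<or> u = tg f" using incident[of u] vu by auto
    then have "C v \<in> closed_segment (C f) (C (tg f))" using vu(3) by auto
    then have "v = f \<or> v = tg f" using off[of v f] vu f by auto
    then show False using f vu pos[OF f(1)] by auto
  qed
  moreover have "closed_segment (C e) (C (tg e)) \<inter> closed_segment (C f) (C (tg f)) \<subseteq> {C e, C (tg e)} \<inter> {C f, C (tg f)}"
    if ef: "e < m" "f < m" "e \<noteq> f" for e f
  proof (cases "{e, tg e} \<inter> {f, tg f} = {}")
    case True
    then show ?thesis using ap ef unfolding apart_def by blast
  next
    case False
    then obtain v where v: "v \<in> {e, tg e}" "v \<in> {f, tg f}" by auto
    obtain x where x: "{e, tg e} = {v, x}" using v(1) by (metis insert_commute insertE singletonD)
    obtain y where y: "{f, tg f} = {v, y}" using v(2) by (metis insert_commute insertE singletonD)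
    have xN: "x < N" "y < N" using x y ef N by (auto simp: doubleton_eq_iff)
    have xy: "x \<noteq> y" using edge_unique[OF ef(1,2)] ef(3) x y by auto
    have xv: "x \<noteq> v" "y \<noteq> v" using x y tg_neq ef by (auto simp: doubleton_eq_iff)
    have se: "closed_segment (C e) (C (tg e)) = closed_segment (C v) (C x)"
      using x by (auto simp: doubleton_eq_iff closed_segment_commute)
    have sf: "closed_segment (C f) (C (tg f)) = closed_segment (C v) (C y)"
      using y by (auto simp: doubleton_eq_iff closed_segment_commute)
    have "C x \<notin> closed_segment (C v) (C y)" using off[of x f] sf xN ef xy xv y by (auto simp: doubleton_eq_iff)
    moreover have "C y \<notin> closed_segment (C v) (C x)" using off[of y e] se xN ef xy xv x by (auto simp: doubleton_eq_iff)
    ultimately have "closed_segment (C v) (C x) \<inter> closed_segment (C v) (C y) \<subseteq> {C v}"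
      by (rule segments_common_end)
    then show ?thesis unfolding se sf using v by auto
  qed
  ultimately show "nt C" unfolding nt_def by blast
qed

text \<open>Two bars that meet while no vertex touches a foreign bar must cross properly. So an open
  and a closed condition agree where all gaps are positive: the energy needs no terms for pairs of
  bars, since a motion cannot start a crossing without closing a vertex gap first.\<close>

lemma apart_iff_uncrossed:
  assumes "\<forall>\<tau>\<in>gaps. 0 < gp a b \<tau> C"
  shows "apart C \<longleftrightarrow> uncrossed C"
proof -
  have off: "C v \<notin> closed_segment (C e) (C (tg e))" if "v < N" "e < m" "v \<noteq> e" "v \<noteq> tg e" for v e
    using assms that unfolding all_gaps by blast
  have "closed_segment (C e) (C (tg e)) \<inter> closed_segment (C f) (C (tg f)) = {} \<longleftrightarrow> \<not> cross (C e) (C (tg e)) (C f) (C (tg f))"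
    if h: "e < m" "f < m" "{e, tg e} \<inter> {f, tg f} = {}" for e f
  proof
    assume "closed_segment (C e) (C (tg e)) \<inter> closed_segment (C f) (C (tg f)) = {}"
    then show "\<not> cross (C e) (C (tg e)) (C f) (C (tg f))" using cross_imp_meet by blast
  next
    assume nc: "\<not> cross (C e) (C (tg e)) (C f) (C (tg f))"
    have lt: "e < N" "f < N" using h N by auto
    show "closed_segment (C e) (C (tg e)) \<inter> closed_segment (C f) (C (tg f)) = {}"
    proof (rule ccontr)
      assume "closed_segment (C e) (C (tg e)) \<inter> closed_segment (C f) (C (tg f)) \<noteq> {}"
      then obtain z where "z \<in> closed_segment (C e) (C (tg e))" "z \<in> closed_segment (C f) (C (tg f))" by auto
      then have "cross (C e) (C (tg e)) (C f) (C (tg f))"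
        by (rule meet_imp_cross) (use off h lt in auto)
      then show False using nc by simp
    qed
  qed
  then show ?thesis unfolding apart_def uncrossed_def by (intro iff_allI imp_cong refl)
qed

lemma gaps_of_confs:
  assumes "C \<in> confs a b"
  shows "\<forall>\<tau>\<in>gaps. 0 < gp a b \<tau> C"
  unfolding all_gaps using assms nt_vertex by (auto simp: confs_def)

lemma confs_iff:
  fixes a b :: "nat \<Rightarrow> real"
  assumes "\<And>e. e < m \<Longrightarrow> 0 \<le> a e"
  shows "C \<in> confs a b \<longleftrightarrow> (\<forall>v\<ge>N. C v = 0) \<and> C 0 = 0 \<and> (\<forall>\<tau>\<in>gaps. 0 < gp a b \<tau> C) \<and> apart C"
proof
  assume C: "C \<in> confs a b"
  note g = gaps_of_confs[OF C]
  have "apart C" using nt_iff_apart[OF assms g] C by (simp add: confs_def)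
  then show "(\<forall>v\<ge>N. C v = 0) \<and> C 0 = 0 \<and> (\<forall>\<tau>\<in>gaps. 0 < gp a b \<tau> C) \<and> apart C"
    using C g by (simp add: confs_def)
next
  assume r: "(\<forall>v\<ge>N. C v = 0) \<and> C 0 = 0 \<and> (\<forall>\<tau>\<in>gaps. 0 < gp a b \<tau> C) \<and> apart C"
  then have g: "\<forall>\<tau>\<in>gaps. 0 < gp a b \<tau> C" by simp
  have "nt C" using nt_iff_apart[OF assms g] r by simp
  moreover have "\<forall>e<m. a e < cmod (C (tg e) - C e) \<and> cmod (C (tg e) - C e) < b e"
    using g unfolding all_gaps by simp
  ultimately show "C \<in> confs a b" using r by (simp add: confs_def)
qed

lemma confs_iff':
  fixes a b :: "nat \<Rightarrow> real"
  assumes "\<And>e. e < m \<Longrightarrow> 0 \<le> a e"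
  shows "C \<in> confs a b \<longleftrightarrow> (\<forall>v\<ge>N. C v = 0) \<and> C 0 = 0 \<and> (\<forall>\<tau>\<in>gaps. 0 < gp a b \<tau> C) \<and> uncrossed C"
  using confs_iff[of a C b, OF assms] apart_iff_uncrossed[of a b C] by meson

end

lemma continuous_on_gap: "continuous_on S (gap V c k \<tau>)"
proof -
  have "continuous_on S (\<lambda>C. gap V c k \<tau> C)"
    unfolding gap_def by (intro continuous_intros)
  then show ?thesis by simp
qed

lemma connected_subset_component:
  assumes "W \<in> components S" "connected T" "T \<subseteq> S" "x \<in> W" "x \<in> T"
  shows "T \<subseteq> W"
  using components_maximal[OF assms(1-3)] assms(4,5) by blast

lemma continuous_on_move: "continuous_on S (\<lambda>t. (C :: nat \<Rightarrow> complex)(i := C i + t *\<^sub>R d))"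
proof (rule continuous_on_coordinatewise_then_product)
  fix v
  show "continuous_on S (\<lambda>t. (C(i := C i + t *\<^sub>R d)) v)"
    by (cases "v = i") (simp_all, intro continuous_intros)
qed

context chain begin

lemma closed_uncrossed: "closed {C. uncrossed C}"
proof -
  have "closed {C. \<not> cross (C p) (C q) (C x) (C y)}" for p q x y :: nat
  proof -
    have "closed {C :: nat \<Rightarrow> complex. 0 \<le> cr (C q - C p) (C x - C p) * cr (C q - C p) (C y - C p) \<or>
       0 \<le> cr (C y - C x) (C p - C x) * cr (C y - C x) (C q - C x)}"
      by (intro closed_Collect_disj closed_Collect_le continuous_intros)
    then show ?thesis unfolding cross_def by (simp add: not_less)
  qed
  then show ?thesis unfolding uncrossed_def
    by (intro closed_Collect_all closed_Collect_imp open_Collect_const)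
qed

text \<open>Openness is read off from the description by \<open>apart\<close>; the pinned vertex 0
  has to be excluded.\<close>

lemma confs_move:
  fixes a b :: "nat \<Rightarrow> real"
  assumes a: "\<And>e. e < m \<Longrightarrow> 0 \<le> a e" and C: "C \<in> confs a b" and i: "i < N" "i \<noteq> 0"
  shows "\<exists>\<delta>>0. \<forall>t. \<bar>t\<bar> < \<delta> \<longrightarrow> C(i := C i + t *\<^sub>R d) \<in> confs a b"
proof -
  let ?g = "\<lambda>t. C(i := C i + t *\<^sub>R d)"
  have C': "\<forall>v\<ge>N. C v = 0" "C 0 = 0" "\<forall>\<tau>\<in>gaps. 0 < gp a b \<tau> C" "apart C"
    using confs_iff[of a, OF a] C by auto
  have 1: "\<forall>\<^sub>F t in nhds 0. \<forall>\<tau>\<in>gaps. 0 < gp a b \<tau> (?g t)"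
    unfolding eventually_ball_finite_distrib[OF finite_gaps]
  proof
    fix \<tau> assume \<tau>: "\<tau> \<in> gaps"
    have "continuous_on UNIV (\<lambda>t. gp a b \<tau> (?g t))"
      by (rule continuous_on_compose2[OF continuous_on_gap[of UNIV] continuous_on_move]) simp
    then have "open {t. 0 < gp a b \<tau> (?g t)}"
      by (intro open_Collect_less continuous_on_const)
    then show "\<forall>\<^sub>F t in nhds 0. 0 < gp a b \<tau> (?g t)"
      using C'(3) \<tau> eventually_nhds_in_open[of "{t. 0 < gp a b \<tau> (?g t)}" 0] by simp
  qed
  have 2: "\<forall>\<^sub>F t in nhds 0. \<forall>e\<in>{..<m}. \<forall>f\<in>{..<m}. {e, tg e} \<inter> {f, tg f} = {} \<longrightarrow>
      closed_segment (?g t e) (?g t (tg e)) \<inter> closed_segment (?g t f) (?g t (tg f)) = {}"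
    unfolding eventually_ball_finite_distrib[OF finite_lessThan]
  proof (intro ballI)
    fix e f assume ef: "e \<in> {..<m}" "f \<in> {..<m}"
    show "\<forall>\<^sub>F t in nhds 0. {e, tg e} \<inter> {f, tg f} = {} \<longrightarrow>
      closed_segment (?g t e) (?g t (tg e)) \<inter> closed_segment (?g t f) (?g t (tg f)) = {}"
    proof (cases "{e, tg e} \<inter> {f, tg f} = {}")
      case True
      then have "closed_segment (C e) (C (tg e)) \<inter> closed_segment (C f) (C (tg f)) = {}"
        using C'(4) ef unfolding apart_def by auto
      then obtain \<delta> where \<delta>: "\<delta> > 0" "\<And>p' q' a' b'. cmod (p' - C e) < \<delta> \<Longrightarrow> cmod (q' - C (tg e)) < \<delta> \<Longrightarrow>
         cmod (a' - C f) < \<delta> \<Longrightarrow> cmod (b' - C (tg f)) < \<delta> \<Longrightarrow> closed_segment p' q' \<inter> closed_segment a' b' = {}"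
        using disjoint_segments_stable[of "C e" "C (tg e)" "C f" "C (tg f)"] by metis
      have "open {t. cmod (t *\<^sub>R d) < \<delta>}" by (intro open_Collect_less continuous_intros)
      then have "\<forall>\<^sub>F t in nhds 0. cmod (t *\<^sub>R d) < \<delta>"
        using eventually_nhds_in_open[of "{t. cmod (t *\<^sub>R d) < \<delta>}" 0] \<delta>(1) by simp
      then show ?thesis
      proof eventually_elim
        case (elim t)
        have "cmod (?g t v - C v) < \<delta>" for v using elim \<delta>(1) by (cases "v = i") auto
        then show ?case using \<delta>(2) by blast
      qed
    next
      case False
      then show ?thesis by (intro always_eventually) blast
    qed
  qed
  have "\<forall>\<^sub>F t in nhds 0. ?g t \<in> confs a b"
    using 1 2
  proof eventually_elim
    case (elim t)
    have "apart (?g t)" using elim(2) unfolding apart_def by blast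
    moreover have "\<forall>v\<ge>N. ?g t v = 0" "?g t 0 = 0" using C' i by auto
    ultimately show ?case using confs_iff[of a, OF a] elim(1) by blast
  qed
  then show ?thesis unfolding eventually_nhds_metric by simp
qed

lemma confs_bounded:
  assumes "C \<in> confs a b" "v < N"
  shows "cmod (C v) \<le> (\<Sum>e<N. \<bar>b e\<bar>)"
proof -
  have "cmod (C v) \<le> (\<Sum>e<v. \<bar>b e\<bar>)"
    using assms(2)
  proof (induction v)
    case 0
    then show ?case using assms(1) by (simp add: confs_def)
  next
    case (Suc v)
    have v: "v < m" using Suc.prems N by linarith
    have "cmod (C (Suc v)) \<le> cmod (C v) + cmod (C (Suc v) - C v)"
      using norm_triangle_ineq[of "C v" "C (Suc v) - C v"] by simp
    also have "cmod (C (Suc v) - C v) < b v"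
      using assms(1) v tg_Suc[OF Suc.prems] unfolding confs_def by force
    finally show ?case using Suc by simp
  qed
  also have "\<dots> \<le> (\<Sum>e<N. \<bar>b e\<bar>)" using assms(2) by (intro sum_mono2) auto
  finally show ?thesis .
qed

text \<open>Negative coefficients occur on bars only, so no gap contributes negatively to a strut;
  the gap between \<open>j\<close> and a bar at \<open>i\<close> contributes strictly, as it
  contains the distance from \<open>i\<close> to \<open>j\<close>.\<close>

lemma stress_strut:
  assumes g: "\<forall>\<tau>\<in>gaps. 0 < gp a b \<tau> C" and ij: "i < N" "j < N" "i \<noteq> j" "\<not> adj i j" and ne: "C i \<noteq> C j"
  shows "0 < stress {..<N} cf (kf a b) gaps C i j"
proof -
  have E: "E2 e (tg e) i j = 0" if "e < m" for e using ij that by (auto simp: E2_def adj_def)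
  have nn: "0 \<le> cf \<tau> i j" if "\<tau> \<in> gaps" for \<tau>
    using that E unfolding gaps_def by (auto simp: cf_def) (auto simp: E2_def)
  obtain e where e: "e < m" "i = e \<or> i = tg e" using incident ij by blast
  have j: "j \<noteq> e" "j \<noteq> tg e" using e ij adj_tg[of e] adj_sym by auto
  have \<tau>: "Inl (j,e) \<in> gaps" using e j ij by (auto simp: gaps_def)
  have E2_nn: "0 \<le> E2 x y i j" for x y by (simp add: E2_def)
  have "E2 j e i j = 1/2 \<or> E2 j (tg e) i j = 1/2" using e(2) by (auto simp: E2_def)
  moreover have "cf (Inl (j,e)) i j = E2 j e i j + E2 j (tg e) i j" using E[OF e(1)] by (simp add: cf_def)
  ultimately have pos: "0 < cf (Inl (j,e)) i j" using E2_nn[of j e] E2_nn[of j "tg e"] by linarith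
  have "0 < (\<Sum>\<tau>\<in>gaps. cf \<tau> i j / (gp a b \<tau> C)\<^sup>2)"
  proof (rule sum_pos2[OF finite_gaps \<tau>])
    show "0 < cf (Inl (j,e)) i j / (gp a b (Inl (j,e)) C)\<^sup>2"
      using pos g \<tau> by (intro divide_pos_pos) (auto simp: zero_less_power)
    show "0 \<le> cf \<tau> i j / (gp a b \<tau> C)\<^sup>2" if "\<tau> \<in> gaps" for \<tau> using nn[OF that] by simp
  qed
  then show ?thesis unfolding stress_def using ne by simp
qed

text \<open>The energy blows up at the boundary of a component, so it has a minimiser there; criticality
  of the minimiser is equilibrium of the stress.\<close>
lemma component_stressed:
  fixes a b :: "nat \<Rightarrow> real"
  assumes a: "\<And>e. e < m \<Longrightarrow> 0 \<le> a e" and W: "W \<in> components (confs a b)"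
  shows "\<exists>C\<in>W. stressed {..<N} adj (stress {..<N} cf (kf a b) gaps C) C"
proof -
  let ?F = "energy {..<N} cf (kf a b) gaps"
  have Wsub: "W \<subseteq> confs a b" and Wne: "W \<noteq> {}"
    using in_components_subset[OF W] in_components_nonempty[OF W] by auto
  obtain T where T: "closed T" "W = confs a b \<inter> T"
    using closedin_component[OF W] by (auto simp: closedin_closed)
  obtain C0 where C0: "C0 \<in> W" using Wne by auto
  have g0: "\<forall>\<tau>\<in>gaps. 0 < gp a b \<tau> C" if "C \<in> W" for C using gaps_of_confs Wsub that by blast
  have Fge: "1 / gp a b \<tau> C \<le> ?F C" if "C \<in> W" "\<tau> \<in> gaps" for C \<tau>
    unfolding energy_def
    by (rule member_le_sum[OF that(2) _ finite_gaps]) (use g0[OF that(1)] in \<open>auto intro: less_imp_le\<close>)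
  have "Inr (Inl 0) \<in> gaps" using N by (auto simp: gaps_def)
  then have F0: "0 < ?F C0" using Fge[OF C0] g0[OF C0] by (meson less_le_trans zero_less_divide_1_iff)
  \<comment> \<open>A compact set between the sublevel set of the energy of \<open>C0\<close> in
    \<open>W\<close> and \<open>W\<close> itself. An energy of at most \<open>?F C0\<close> keeps
    each gap above \<open>1 / ?F C0\<close>, and \<open>uncrossed\<close> is the closed form of
    nontouching.\<close>
  define K where "K = T \<inter> {C. (\<forall>v. C v \<in> (if v < N then cball 0 (\<Sum>e<N. \<bar>b e\<bar>) else {0}))}
      \<inter> {C. C 0 = 0 \<and> (\<forall>\<tau>. \<tau> \<in> gaps \<longrightarrow> 1 / ?F C0 \<le> gp a b \<tau> C)} \<inter> {C. uncrossed C}"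
  have KW: "K \<subseteq> W"
  proof
    fix C assume C: "C \<in> K"
    have "0 < gp a b \<tau> C" if "\<tau> \<in> gaps" for \<tau>
      using C that F0 unfolding K_def by (auto intro: less_le_trans[of 0 "1 / ?F C0"])
    moreover have "C v = 0" if "N \<le> v" for v
    proof -
      have "C v \<in> (if v < N then cball 0 (\<Sum>e<N. \<bar>b e\<bar>) else {0})" using C unfolding K_def by blast
      then show ?thesis using that by simp
    qed
    ultimately have "C \<in> confs a b" using C confs_iff'[of a, OF a] unfolding K_def by blast
    then show "C \<in> W" using C T unfolding K_def by blast
  qed
  have inK: "C \<in> K" if C: "C \<in> W" "?F C \<le> ?F C0" for C
  proof -
    have Cc: "C \<in> confs a b" using C Wsub by auto
    have "1 / ?F C0 \<le> gp a b \<tau> C" if "\<tau> \<in> gaps" for \<tau>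
    proof -
      have "1 / gp a b \<tau> C \<le> ?F C0" "0 < gp a b \<tau> C"
        using Fge[OF C(1) that] C(2) g0[OF C(1)] that by auto
      then show ?thesis using F0 by (simp add: field_simps)
    qed
    moreover have "uncrossed C" "\<forall>v\<ge>N. C v = 0" "C 0 = 0" using confs_iff'[of a, OF a] Cc by auto
    moreover have "\<forall>v<N. C v \<in> cball 0 (\<Sum>e<N. \<bar>b e\<bar>)" using confs_bounded[OF Cc] by simp
    ultimately show ?thesis using C T unfolding K_def by auto
  qed
  have "compact {C. \<forall>v. C v \<in> (if v < N then cball (0::complex) (\<Sum>e<N. \<bar>b e\<bar>) else {0})}"
    by (rule compact_box_fun) auto
  moreover have "closed (T \<inter> {C. C 0 = 0 \<and> (\<forall>\<tau>. \<tau> \<in> gaps \<longrightarrow> 1 / ?F C0 \<le> gp a b \<tau> C)} \<inter> {C. uncrossed C})"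
    by (intro closed_Int T closed_uncrossed closed_Collect_conj closed_Collect_all closed_Collect_imp open_Collect_const
        closed_Collect_eq closed_Collect_le continuous_on_const continuous_on_gap continuous_on_coord)
  ultimately have "compact ({C. \<forall>v. C v \<in> (if v < N then cball (0::complex) (\<Sum>e<N. \<bar>b e\<bar>) else {0})} \<inter>
      (T \<inter> {C. C 0 = 0 \<and> (\<forall>\<tau>. \<tau> \<in> gaps \<longrightarrow> 1 / ?F C0 \<le> gp a b \<tau> C)} \<inter> {C. uncrossed C}))"
    by (rule compact_Int_closed)
  then have cK: "compact K" unfolding K_def by (simp add: Int_ac)
  have contF: "continuous_on K ?F"
    unfolding energy_def[abs_def]
  proof (intro continuous_on_sum continuous_on_divide continuous_on_const continuous_on_gap ballI)
    fix \<tau> C assume "\<tau> \<in> gaps" "C \<in> K"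
    then show "gp a b \<tau> C \<noteq> 0" using g0 KW by force
  qed
  have "K \<noteq> {}" using inK[OF C0] by auto
  from continuous_attains_inf[OF cK this contF]
  obtain C where C: "C \<in> K" "\<And>C'. C' \<in> K \<Longrightarrow> ?F C \<le> ?F C'" by blast
  have CW: "C \<in> W" using C KW by auto
  have min: "?F C \<le> ?F C'" if "C' \<in> W" for C'
    \<comment> \<open>Outside the sublevel set of \<open>C0\<close> the energy already exceeds that
      of \<open>C0\<close>, so minimality on \<open>K\<close> extends to all of
      \<open>W\<close>.\<close>
    using C(2)[OF inK[OF that]] C(2)[OF inK[OF C0]] by fastforce
  have Cc: "C \<in> confs a b" using CW Wsub by auto
  then have nt: "nt C" by (simp add: confs_def)
  then have inj: "inj_on C {..<N}" by (simp add: nt_def)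
  note g = g0[OF CW]
  let ?s = "stress {..<N} cf (kf a b) gaps C"
  have sym: "?s i j = ?s j i" for i j by (rule stress_sym) (rule cf_sym)
  have eq1: "(\<Sum>j<N. ?s i j *\<^sub>R (C j - C i)) = 0" if i: "i < N" "i \<noteq> 0" for i
  proof (rule critical_equilibrium)
    show "\<exists>\<delta>>0. \<forall>t. \<bar>t\<bar> < \<delta> \<longrightarrow> ?F C \<le> ?F (C(i := C i + t *\<^sub>R d))" for d
    proof -
      obtain \<delta> where \<delta>: "\<delta> > 0" "\<And>t. \<bar>t\<bar> < \<delta> \<Longrightarrow> C(i := C i + t *\<^sub>R d) \<in> confs a b"
        using confs_move[of a, OF a Cc i, of d] by blast
      let ?A = "(\<lambda>t. C(i := C i + t *\<^sub>R d)) ` {-\<delta><..<\<delta>}"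
      have "connected ?A" by (intro connected_continuous_image continuous_on_move) simp
      moreover have "?A \<subseteq> confs a b" using \<delta> by auto
      moreover have "C \<in> ?A" using \<delta>(1) by (intro image_eqI[of _ _ 0]) auto
      ultimately have "?A \<subseteq> W" using connected_subset_component[OF W] CW by blast
      then have "?F C \<le> ?F (C(i := C i + t *\<^sub>R d))" if "\<bar>t\<bar> < \<delta>" for t
        using that by (intro min) (auto simp: abs_less_iff)
      then show ?thesis using \<delta>(1) by blast
    qed
  qed (use i finite_gaps inj cf_sym g in auto)
  have eq: "(\<Sum>j<N. ?s i j *\<^sub>R (C j - C i)) = 0" if "i < N" for i
  proof (cases "i = 0")
    case True
    have "(\<Sum>j\<in>{..<N}. ?s 0 j *\<^sub>R (C j - C 0)) = 0"
      by (rule equilibrium_pinned) (use N eq1 sym in auto)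
    then show ?thesis using True by simp
  qed (use eq1 that in blast)
  have "stressed {..<N} adj ?s C"
  proof
    show "adj i j \<Longrightarrow> adj j i" for i j by (rule adj_sym)
    show "card {j \<in> {..<N}. adj v j} \<le> 2" for v by (rule deg)
    show "?s i j = ?s j i" for i j by (rule sym)
    show "(\<Sum>j<N. ?s i j *\<^sub>R (C j - C i)) = 0" if "i \<in> {..<N}" for i using eq that by simp
    show "0 < ?s i j" if "i \<in> {..<N}" "j \<in> {..<N}" "i \<noteq> j" "\<not> adj i j" for i j
      using stress_strut[OF g, of i j] inj that by (auto dest: inj_onD)
    show "v = i \<or> v = j" if h: "adj i j" "v \<in> {..<N}" "C v \<in> closed_segment (C i) (C j)" for i j v
    proof -
      obtain e where e: "e < m" "i = e \<and> j = tg e \<or> i = tg e \<and> j = e" using h(1) by (auto simp: adj_def)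
      then have "C v \<in> closed_segment (C e) (C (tg e))" using h(3) by (auto simp: closed_segment_commute)
      then show ?thesis using nt_vertex[OF nt, of v e] h(2) e by auto
    qed
    show "z \<in> C ` {..<N}" if h: "adj i j" "adj k l" "{i,j} \<noteq> {k,l}"
      "z \<in> closed_segment (C i) (C j)" "z \<in> closed_segment (C k) (C l)" for i j k l z
    proof -
      obtain e where e: "e < m" "i = e \<and> j = tg e \<or> i = tg e \<and> j = e" using h(1) by (auto simp: adj_def)
      obtain f where f: "f < m" "k = f \<and> l = tg f \<or> k = tg f \<and> l = f" using h(2) by (auto simp: adj_def)
      have "e \<noteq> f" using h(3) e f by auto
      moreover have "z \<in> closed_segment (C e) (C (tg e))" "z \<in> closed_segment (C f) (C (tg f))"
        using h(4,5) e f by (auto simp: closed_segment_commute)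
      ultimately have "z \<in> {C e, C (tg e)}" using nt e(1) f(1) unfolding nt_def by blast
      then show ?thesis using e(1) N by auto
    qed
  qed (use inj in auto)
  then show ?thesis using CW by blast
qed

end

section \<open>Stressed chains are convex polygons\<close>

lemma cr_parallel:
  assumes "cr q x = 0" "cr q y = 0" "q \<noteq> 0"
  shows "cr x y = 0"
  using cr_eq_0_imp[of x q y] assms cr_commute[of q x] cr_commute[of q y] by auto

context chain begin

definition flat where
  "flat C \<longleftrightarrow> (\<forall>i<N. \<forall>j<N. \<forall>k<N. cr (C j - C i) (C k - C i) = 0)"

lemma flatI:
  assumes "q \<noteq> 0" "\<And>k. k < N \<Longrightarrow> cr q (C k - C v) = 0"
  shows "flat C"
  unfolding flat_def
proof (intro allI impI)
  fix i j k assume h: "i < N" "j < N" "k < N"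
  have "cr q (C x - C i) = 0" if "x < N" for x
  proof -
    have "cr q (C x - C i) = cr q (C x - C v) - cr q (C i - C v)" by (simp add: cr_def algebra_simps)
    then show ?thesis using assms(2) that h by simp
  qed
  then show "cr (C j - C i) (C k - C i) = 0" using h cr_parallel[OF _ _ assms(1)] by blast
qed

text \<open>The witness \<open>q\<close> is the direction of a supporting line through
  \<open>C v\<close> with the whole configuration on its left; in \<open>supporting\<close> that
  line runs along a segment, with the side given by the sign \<open>\<sigma>\<close>.\<close>

definition hull_vertex where
  "hull_vertex C v \<longleftrightarrow> v < N \<and> (\<exists>q. q \<noteq> 0 \<and> (\<forall>k<N. 0 \<le> cr q (C k - C v)))"

definition supporting where
  "supporting \<sigma> C v j \<longleftrightarrow> (\<forall>k<N. 0 \<le> \<sigma> * cr (C j - C v) (C k - C v))"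

lemma supporting_hull_vertex:
  assumes s: "supporting \<sigma> C v j" and \<sigma>: "\<sigma> \<noteq> 0" and j: "j < N" "C j \<noteq> C v"
  shows "hull_vertex C j"
  unfolding hull_vertex_def
proof (intro conjI exI allI impI)
  show "\<sigma> *\<^sub>R (C j - C v) \<noteq> 0" using \<sigma> j by simp
  show "0 \<le> cr (\<sigma> *\<^sub>R (C j - C v)) (C k - C j)" if "k < N" for k
  proof -
    have "cr (\<sigma> *\<^sub>R (C j - C v)) (C k - C j) = \<sigma> * cr (C j - C v) (C k - C v)"
      by (simp add: cr_def algebra_simps)
    then show ?thesis using s that by (simp add: supporting_def)
  qed
qed (rule j)

lemma adj_neq: "adj i j \<Longrightarrow> i \<noteq> j" using tg_neq by (auto simp: adj_def)
lemma adj_less: "adj i j \<Longrightarrow> i < N \<and> j < N" using N by (auto simp: adj_def)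

lemma supporting_flat:
  assumes "supporting 1 C v j" "supporting (-1) C v j" "C j \<noteq> C v"
  shows "flat C"
proof (rule flatI)
  show "C j - C v \<noteq> 0" using assms(3) by simp
  show "cr (C j - C v) (C k - C v) = 0" if "k < N" for k
    using assms(1,2) that unfolding supporting_def by force
qed

end

locale stressed_chain = chain + S: stressed "{..<N}" adj w C for w C +
  assumes nt: "nt C" and notflat: "\<not> flat C"
begin

lemma C_neq: "adj i j \<Longrightarrow> C i \<noteq> C j"
  using adj_neq adj_less nt unfolding nt_def by (metis inj_onD lessThan_iff)

lemma supporting_bars:
  assumes "hull_vertex C v"
  shows "\<exists>j. adj v j \<and> supporting 1 C v j" "\<exists>j. adj v j \<and> supporting (-1) C v j"
proof -
  obtain q where v: "v < N" and q: "q \<noteq> 0" "\<And>k. k < N \<Longrightarrow> 0 \<le> cr q (C k - C v)"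
    using assms unfolding hull_vertex_def by blast
  obtain k0 where k0: "k0 < N" "cr q (C k0 - C v) \<noteq> 0"
    using flatI[OF q(1), of C v] notflat by blast
  show "\<exists>j. adj v j \<and> supporting 1 C v j"
    using S.next_bar[of v q k0] v q k0 unfolding supporting_def by auto
  show "\<exists>j. adj v j \<and> supporting (-1) C v j"
    using S.prev_bar[of v q k0] v q k0 unfolding supporting_def by auto
qed

lemma not_both: "adj v j \<Longrightarrow> supporting 1 C v j \<Longrightarrow> \<not> supporting (-1) C v j"
  using supporting_flat notflat C_neq by metis

text \<open>The hull edges at \<open>v\<close> on the two sides are bars by
  \<open>supporting_bars\<close>; they differ because a bar that supports on both sides would have
  everything on its line.\<close>

lemma hull_neighbours:
  assumes "hull_vertex C v"
  shows "\<exists>i j. adj v i \<and> adj v j \<and> i \<noteq> j \<and> hull_vertex C i \<and> hull_vertex C j"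
proof -
  obtain i where i: "adj v i" "supporting 1 C v i" using supporting_bars(1)[OF assms] by blast
  obtain j where j: "adj v j" "supporting (-1) C v j" using supporting_bars(2)[OF assms] by blast
  have "i \<noteq> j" using not_both i j by auto
  moreover have "hull_vertex C i"
    by (rule supporting_hull_vertex[OF i(2)]) (use C_neq[OF i(1)] adj_less[OF i(1)] in auto)
  moreover have "hull_vertex C j"
    by (rule supporting_hull_vertex[OF j(2)]) (use C_neq[OF j(1)] adj_less[OF j(1)] in auto)
  ultimately show ?thesis using i j by blast
qed

lemma ex_hull_vertex: "\<exists>v. hull_vertex C v"
proof -
  have "finite {..<N}" "{..<N} \<noteq> {}" using N by (auto simp: lessThan_empty_iff)
  then obtain v where "v \<in> {..<N}" "\<And>k. k \<in> {..<N} \<Longrightarrow> \<not> Re (C k) < Re (C v)"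
    using arg_min_if_finite[of "{..<N}" "\<lambda>v. Re (C v)"] by metis
  then have "hull_vertex C v"
    unfolding hull_vertex_def by (intro conjI exI[of _ "- \<i>"]) (auto simp: cr_def not_less)
  then show ?thesis ..
qed

text \<open>In an open chain vertex 0 has only one neighbour and so is not on the hull, and if
  \<open>Suc v\<close> were on the hull, so would be \<open>v\<close>. By induction there would be
  no hull vertex at all.\<close>

lemma is_closed: "m = N"
proof (rule ccontr)
  assume "m \<noteq> N"
  then have m: "m = N - 1" using size by auto
  have adj: "j = Suc v \<or> v = Suc j" if h: "adj v j" for v j
  proof -
    obtain e where e: "e < m" "v = e \<and> j = tg e \<or> v = tg e \<and> j = e" using h unfolding adj_def by blast
    have "tg e = Suc e" using e(1) m by (intro tg_Suc) simp
    then show ?thesis using e(2) by auto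
  qed
  have "hull_vertex C v \<Longrightarrow> False" for v
  proof (induction v)
    case 0
    then show ?case using hull_neighbours adj by (metis nat.distinct(1) nat.inject)
  next
    case (Suc v)
    then show ?case using hull_neighbours[OF Suc.prems] adj by (metis nat.inject)
  qed
  then show False using ex_hull_vertex by blast
qed

lemma adj_closed: "adj v j \<Longrightarrow> j = tg v \<or> v = tg j"
  by (auto simp: adj_def)

text \<open>A hull vertex has two hull neighbours, hence all its neighbours are on the hull, and the
  property travels around the cycle.\<close>

lemma all_hull: "v < N \<Longrightarrow> hull_vertex C v"
proof -
  have step: "hull_vertex C (tg v)" if h: "hull_vertex C v" for v
  proof -
    obtain i j where ij: "adj v i" "adj v j" "i \<noteq> j" "hull_vertex C i" "hull_vertex C j"
      using hull_neighbours[OF h] by blast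
    have "i = tg v \<or> j = tg v"
      using adj_closed[OF ij(1)] adj_closed[OF ij(2)] ij adj_less tg_inj by metis
    then show ?thesis using ij by auto
  qed
  obtain u where u: "hull_vertex C u" using ex_hull_vertex by blast
  have "hull_vertex C ((u + k) mod N)" for k
  proof (induction k)
    case 0
    then show ?case using u by (simp add: hull_vertex_def)
  next
    case (Suc k)
    then show ?case using step[OF Suc] by (simp add: tg_def mod_Suc_eq)
  qed
  from this[of "N - u + v"] show "v < N \<Longrightarrow> hull_vertex C v"
    using u by (simp add: hull_vertex_def)
qed

text \<open>Seen from its other end a bar supports with the opposite sign. So the bar supporting
  with sign \<open>\<sigma>\<close> at \<open>tg v\<close> cannot lead back to \<open>v\<close>, and
  the sign found at vertex 0 is passed on along the cycle.\<close>

lemma oriented: "\<exists>\<sigma>\<in>{1,-1}. \<forall>v<N. supporting \<sigma> C v (tg v)"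
proof -
  have flip: "supporting (- \<sigma>) C u v" if "supporting \<sigma> C v u" for \<sigma> u v
    unfolding supporting_def
  proof (intro allI impI)
    fix k assume "k < N"
    have "- \<sigma> * cr (C v - C u) (C k - C u) = \<sigma> * cr (C u - C v) (C k - C v)"
      by (simp add: cr_def algebra_simps)
    then show "0 \<le> - \<sigma> * cr (C v - C u) (C k - C u)"
      using that \<open>k < N\<close> by (simp add: supporting_def)
  qed
  have some: "\<exists>j. adj v j \<and> supporting \<sigma> C v j" if "v < N" "\<sigma> = 1 \<or> \<sigma> = -1" for v \<sigma>
    using supporting_bars[OF all_hull[OF that(1)]] that(2) by auto
  have nb: "\<not> supporting (- \<sigma>) C v j" if "adj v j" "supporting \<sigma> C v j" "\<sigma> = 1 \<or> \<sigma> = -1" for v j \<sigma>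
    using not_both[OF that(1)] that(2,3) by auto
  have step: "supporting \<sigma> C (tg v) (tg (tg v))"
    if v: "v < N" "supporting \<sigma> C v (tg v)" "\<sigma> = 1 \<or> \<sigma> = -1" for v \<sigma>
  proof -
    obtain j where j: "adj (tg v) j" "supporting \<sigma> C (tg v) j" using some[of "tg v" \<sigma>] v by auto
    have "j \<noteq> v" using nb[OF j v(3)] flip[OF v(2)] by auto
    then have "j = tg (tg v)" using adj_closed[OF j(1)] tg_inj[of v j] v adj_less[OF j(1)] by auto
    then show ?thesis using j by simp
  qed
  obtain \<sigma> where \<sigma>: "\<sigma> = 1 \<or> \<sigma> = -1" "supporting \<sigma> C 0 (tg 0)"
  proof -
    obtain j where j: "adj 0 j" "supporting 1 C 0 j" using some[of 0 1] N by auto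
    obtain j' where j': "adj 0 j'" "supporting (-1) C 0 j'" using some[of 0 "-1"] N by auto
    have "j \<noteq> j'" using not_both j j' by auto
    then have "j = tg 0 \<or> j' = tg 0"
      using adj_closed[OF j(1)] adj_closed[OF j'(1)] adj_less[OF j(1)] adj_less[OF j'(1)] tg_inj by metis
    then show thesis using that j j' by blast
  qed
  have "supporting \<sigma> C v (tg v)" if "v < N" for v
    using that
  proof (induction v)
    case (Suc v)
    then show ?case using step[of v \<sigma>] \<sigma>(1) tg_Suc[OF Suc.prems] by simp
  qed (use \<sigma> in simp)
  then show ?thesis using \<sigma>(1) by blast
qed

text \<open>Perpendicular to \<open>d\<close> the bars at \<open>v\<close> exert no force while
  every strut to a vertex off the line pulls to the same side. Equilibrium thus forces the
  configuration onto the line.\<close>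

lemma no_straight_vertex:
  assumes v: "v < N" and d: "d \<noteq> 0" and side: "\<And>k. k < N \<Longrightarrow> 0 \<le> cr d (C k - C v)"
    and bars: "\<And>j. adj v j \<Longrightarrow> cr d (C j - C v) = 0"
  shows False
proof -
  have z: "(\<Sum>j<N. w v j * cr (C j - C v) (- d)) = 0" using S.equil_cr[of v "- d"] v by simp
  have tm: "w v j * cr (C j - C v) (- d) = w v j * cr d (C j - C v)" for j
    by (simp add: cr_def algebra_simps)
  have nn: "0 \<le> w v j * cr d (C j - C v)" if "j \<in> {..<N}" for j
  proof (cases "adj v j \<or> j = v")
    case False
    then have "0 < w v j" using S.strut[of v j] v that by auto
    then show ?thesis using side[of j] that by simp
  qed (use bars in auto)
  have zero: "w v j * cr d (C j - C v) = 0" if "j < N" for j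
    using sum_nonneg_eq_0_iff[of "{..<N}" "\<lambda>j. w v j * cr d (C j - C v)"] nn z that unfolding tm by auto
  have "cr d (C j - C v) = 0" if j: "j < N" for j
  proof (cases "adj v j \<or> j = v")
    case False
    then have "0 < w v j" using S.strut[of v j] v j by auto
    then show ?thesis using zero[OF j] by simp
  qed (use bars in auto)
  then have "flat C" by (rule flatI[OF d])
  then show False using notflat by simp
qed

text \<open>A further vertex on the line of a side lies beyond one of its ends. The neighbouring
  side at that end has to support both ends of the given side and the further vertex, so it lies on
  the same line, and that end is a straight vertex.\<close>

theorem strictly_convex:
  "\<exists>\<sigma>\<in>{1,-1}. \<forall>v<N. \<forall>k<N. k \<noteq> v \<longrightarrow> k \<noteq> tg v \<longrightarrow> 0 < \<sigma> * cr (C (tg v) - C v) (C k - C v)"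
proof -
  obtain \<sigma> where \<sigma>: "\<sigma> = 1 \<or> \<sigma> = -1" and sup: "\<And>v k. v < N \<Longrightarrow> k < N \<Longrightarrow> 0 \<le> \<sigma> * cr (C (tg v) - C v) (C k - C v)"
    using oriented unfolding supporting_def by blast
  have "0 < \<sigma> * cr (C (tg v) - C v) (C k - C v)" if h: "v < N" "k < N" "k \<noteq> v" "k \<noteq> tg v" for v k
  proof (rule ccontr)
    assume "\<not> 0 < \<sigma> * cr (C (tg v) - C v) (C k - C v)"
    then have "\<sigma> * cr (C (tg v) - C v) (C k - C v) = 0" using sup[OF h(1,2)] by linarith
    then have z: "cr (C (tg v) - C v) (C k - C v) = 0" using \<sigma> by auto
    define d where "d = C (tg v) - C v"
    have vm: "v < m" using h is_closed by simp
    have d0: "d \<noteq> 0" using C_neq[OF adj_tg[OF vm]] by (simp add: d_def)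
    obtain r where r: "C k - C v = r *\<^sub>R d"
    proof -
      define r where "r = Re ((C k - C v) / d)"
      have "Im ((C k - C v) / d) = 0" using z unfolding d_def[symmetric] by (simp add: Im_divide cr_def algebra_simps)
      then have "(C k - C v) / d = of_real r" by (simp add: complex_eq_iff r_def)
      then have "C k - C v = r *\<^sub>R d" using d0 by (simp add: field_simps scaleR_conv_of_real)
      then show thesis by (rule that)
    qed
    have sgn0: "Q = 0" if "0 \<le> s * Q" "0 < s" "0 \<le> - Q" for s Q :: real
      using that by (simp add: zero_le_mult_iff)
    have "r < 0 \<or> 1 < r"
    proof (rule ccontr)
      assume "\<not> (r < 0 \<or> 1 < r)"
      moreover have "C k = C v + r *\<^sub>R (C (tg v) - C v)" using r by (simp add: d_def algebra_simps)
      ultimately have "C k \<in> closed_segment (C v) (C (tg v))" unfolding in_segment_iff by (intro exI[of _ r]) auto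
      then show False using nt_vertex[OF nt h(2) vm h(3,4)] by simp
    qed
    then show False
    proof
      assume r1: "1 < r"
      let ?u = "tg v"
      have ku: "C k - C ?u = (r - 1) *\<^sub>R d" "C v - C ?u = (- 1) *\<^sub>R d"
        using r by (simp_all add: d_def algebra_simps)
      have "0 \<le> (r - 1) * (\<sigma> * cr (C (tg ?u) - C ?u) d)" "0 \<le> - (\<sigma> * cr (C (tg ?u) - C ?u) d)"
        using sup[of ?u k] sup[of ?u v] h unfolding ku cr_scale_right by (auto simp: algebra_simps)
      then have "\<sigma> * cr (C (tg ?u) - C ?u) d = 0" by (intro sgn0[of "r - 1"]) (use r1 in auto)
      then have u': "cr d (C (tg ?u) - C ?u) = 0" using \<sigma> cr_commute[of d] by auto
      show False
      proof (rule no_straight_vertex[of ?u "\<sigma> *\<^sub>R d"])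
        show "0 \<le> cr (\<sigma> *\<^sub>R d) (C k - C ?u)" if "k < N" for k
        proof -
          have "cr (\<sigma> *\<^sub>R d) (C k - C ?u) = \<sigma> * cr d (C k - C v)" by (simp add: d_def cr_def algebra_simps)
          then show ?thesis using sup[OF h(1) that] by (simp add: d_def)
        qed
        show "cr (\<sigma> *\<^sub>R d) (C j - C ?u) = 0" if "adj ?u j" for j
        proof -
          have "j = tg ?u \<or> j = v" using adj_closed[OF that] tg_inj[of v j] h adj_less[OF that] by auto
          then show ?thesis using u' ku(2) by (auto simp: cr_scale_left cr_scale_right cr_minus_right)
        qed
      qed (use \<sigma> d0 in auto)
    next
      assume r0: "r < 0"
      obtain x where x: "x < N" "v = tg x"
      proof (cases "v = 0")
        case True then show thesis using that[of "N - 1"] N tg_last by auto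
      next
        case False then show thesis using that[of "v - 1"] h tg_Suc[of "v - 1"] by auto
      qed
      let ?g = "C v - C x"
      have "cr ?g (C y - C x) = cr ?g (C y - C v)" for y by (simp add: cr_def algebra_simps)
      then have "0 \<le> \<sigma> * cr ?g d" "0 \<le> \<sigma> * cr ?g (r *\<^sub>R d)"
        using sup[OF x(1), of "tg v"] sup[OF x(1), of k] h unfolding x(2)[symmetric] r[symmetric] unfolding d_def by auto
      then have "0 \<le> \<sigma> * cr ?g d" "0 \<le> r * (\<sigma> * cr ?g d)" by (auto simp: cr_scale_right algebra_simps)
      then have "- (\<sigma> * cr ?g d) = 0" by (intro sgn0[of "- r" "- (\<sigma> * cr ?g d)"]) (use r0 in auto)
      then have "\<sigma> * cr ?g d = 0" by simp
      then have u': "cr d (C x - C v) = 0" using \<sigma> by (auto simp: cr_def algebra_simps)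
      show False
      proof (rule no_straight_vertex[of v "\<sigma> *\<^sub>R d"])
        show "0 \<le> cr (\<sigma> *\<^sub>R d) (C k - C v)" if "k < N" for k
          using sup[OF h(1) that] by (simp add: d_def cr_scale_left)
        show "cr (\<sigma> *\<^sub>R d) (C j - C v) = 0" if "adj v j" for j
        proof -
          have "j = tg v \<or> j = x" using adj_closed[OF that] tg_inj[of x j] x adj_less[OF that] by auto
          then show ?thesis using u' by (auto simp: cr_scale_left d_def[symmetric])
        qed
      qed (use \<sigma> d0 h in auto)
    qed
  qed
  then show ?thesis using \<sigma> by blast
qed

end

section \<open>Open chains\<close>

text \<open>A connected subset is contained in every component that it meets, so two components
  would overlap.\<close>

lemma connected_if_components_meet:
  assumes T: "connected T" "T \<subseteq> S" and meet: "\<And>W. W \<in> components S \<Longrightarrow> W \<inter> T \<noteq> {}"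
  shows "connected S"
proof (cases "components S = {}")
  case True
  then have "S = {}" by (metis Union_components Union_empty)
  then show ?thesis by simp
next
  case False
  then obtain W where W: "W \<in> components S" by blast
  have sub: "T \<subseteq> W'" if "W' \<in> components S" for W'
    using components_maximal[OF that T] meet[OF that] by blast
  have eq: "W' = W" if "W' \<in> components S" for W'
    using sub[OF that] sub[OF W] meet[OF W] components_eq[OF that W] by blast
  have "\<Union>(components S) \<subseteq> W" using eq by (intro Union_least) blast
  then have "S = W" using Union_components[of S] in_components_subset[OF W] by auto
  then show ?thesis using in_components_connected[OF W] by simp
qed

lemma connected_box_fun:
  fixes I :: "'i \<Rightarrow> real set"
  assumes "\<And>e. convex (I e)"
  shows "connected {l. \<forall>e. l e \<in> I e}"
  unfolding connected_iff_connected_component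
proof (intro ballI)
  fix l l' assume l: "l \<in> {l. \<forall>e. l e \<in> I e}" "l' \<in> {l. \<forall>e. l e \<in> I e}"
  let ?h = "\<lambda>t e. (1 - t) * l e + t * l' e"
  let ?A = "?h ` {0..1::real}"
  have "continuous_on {0..1} ?h"
    by (rule continuous_on_coordinatewise_then_product) (intro continuous_intros)
  then have "connected ?A" by (intro connected_continuous_image) simp_all
  moreover have "?A \<subseteq> {l. \<forall>e. l e \<in> I e}"
    using l assms unfolding convex_alt by (auto simp: image_subset_iff)
  moreover have "l \<in> ?A" by (rule image_eqI[of _ _ 0]) auto
  moreover have "l' \<in> ?A" by (rule image_eqI[of _ _ 1]) auto
  ultimately show "connected_component {l. \<forall>e. l e \<in> I e} l l'" unfolding connected_component_def by blast
qed

text \<open>A negative ratio means folding back, which puts \<open>x\<close> on the segment before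
  or \<open>p\<close> on the segment after, according to which is longer.\<close>

lemma straight_step:
  assumes "p \<noteq> q" "x \<noteq> q" "cr (q - p) (x - q) = 0" "p \<notin> closed_segment q x" "x \<notin> closed_segment p q"
  shows "\<exists>r>0. x - q = r *\<^sub>R (q - p)"
proof -
  define d where "d = q - p"
  have d0: "d \<noteq> 0" using assms(1) by (simp add: d_def)
  define r where "r = Re ((x - q) / d)"
  have "Im ((x - q) / d) = 0" using assms(3) unfolding d_def[symmetric] by (simp add: Im_divide cr_def algebra_simps)
  then have "(x - q) / d = of_real r" by (simp add: complex_eq_iff r_def)
  then have r: "x - q = r *\<^sub>R d" using d0 by (simp add: field_simps scaleR_conv_of_real)
  have "r \<noteq> 0" using r assms(2) by auto
  moreover have "\<not> r < 0"
  proof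
    assume r0: "r < 0"
    show False
    proof (cases "- 1 \<le> r")
      case True
      have "x = p + (1 + r) *\<^sub>R (q - p)" using r by (simp add: d_def algebra_simps)
      then have "x \<in> closed_segment p q" unfolding in_segment_iff using True r0 by (intro exI[of _ "1 + r"]) auto
      then show False using assms(5) by simp
    next
      case False
      have "p = q + (- (1 / r)) *\<^sub>R (x - q)" using r r0 by (simp add: d_def)
      then have "p \<in> closed_segment q x" unfolding in_segment_iff using False r0
        by (intro exI[of _ "- (1 / r)"]) (auto simp: field_simps)
      then show False using assms(4) by simp
    qed
  qed
  ultimately show ?thesis using r d_def by (intro exI[of _ r]) auto
qed

context chain begin

lemma nt_neq: "nt C \<Longrightarrow> e < m \<Longrightarrow> C e \<noteq> C (tg e)"
  using tg_neq[of e] N unfolding nt_def by (auto dest: inj_onD)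

lemma flat_parallel:
  assumes nt: "nt C" and flat: "flat C" and e: "e < m"
  shows "\<exists>r>0. C (tg e) - C e = r *\<^sub>R (C 1 - C 0)"
  using e
proof (induction e)
  case 0
  then show ?case using N tg_Suc[of 0] by (intro exI[of _ 1]) auto
next
  case (Suc e)
  then obtain r where r: "r > 0" "C (tg e) - C e = r *\<^sub>R (C 1 - C 0)" by auto
  have te: "tg e = Suc e" using Suc.prems N by (intro tg_Suc) linarith
  let ?x = "tg (Suc e)"
  have xe: "?x \<noteq> e" "?x \<noteq> Suc e"
    using Suc.prems size tg_neq[OF Suc.prems] by (auto simp: tg_cases split: if_splits)
  have "\<exists>r>0. C ?x - C (Suc e) = r *\<^sub>R (C (Suc e) - C e)"
  proof (rule straight_step)
    show "C e \<noteq> C (Suc e)" using nt_neq[OF nt, of e] Suc.prems te by simp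
    show "C ?x \<noteq> C (Suc e)" using nt_neq[OF nt, of "Suc e"] Suc.prems by simp
    have "cr (C (Suc e) - C e) (C ?x - C e) = 0" using flat Suc.prems N unfolding flat_def by simp
    then show "cr (C (Suc e) - C e) (C ?x - C (Suc e)) = 0" by (simp add: cr_def algebra_simps)
    show "C e \<notin> closed_segment (C (Suc e)) (C ?x)"
      by (rule nt_vertex[OF nt]) (use Suc.prems N xe in auto)
    show "C ?x \<notin> closed_segment (C e) (C (Suc e))"
      using nt_vertex[OF nt, of ?x e] te xe Suc.prems by auto
  qed
  then obtain r' where "r' > 0" "C ?x - C (Suc e) = r' *\<^sub>R (C (Suc e) - C e)" by blast
  then have "r' * r > 0" "C ?x - C (Suc e) = (r' * r) *\<^sub>R (C 1 - C 0)" using r te by auto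
  then show ?case by blast
qed

text \<open>The sides would be positive multiples of one vector and could not add up to
  zero.\<close>

lemma closed_not_flat:
  assumes "m = N" "nt C"
  shows "\<not> flat C"
proof
  assume flat: "flat C"
  have d0: "C 1 - C 0 \<noteq> 0" using nt_neq[OF assms(2), of 0] N tg_Suc[of 0] by auto
  obtain r where r: "\<And>e. e < m \<Longrightarrow> r e > 0 \<and> C (tg e) - C e = r e *\<^sub>R (C 1 - C 0)"
    using flat_parallel[OF assms(2) flat] by metis
  have sum: "C v - C 0 = (\<Sum>e<v. r e) *\<^sub>R (C 1 - C 0)" if "v < N" for v
    using that
  proof (induction v)
    case (Suc v)
    have "C (Suc v) - C v = r v *\<^sub>R (C 1 - C 0)" using r[of v] tg_Suc[OF Suc.prems] assms(1) Suc.prems by auto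
    moreover have "C (Suc v) - C 0 = (C v - C 0) + (C (Suc v) - C v)" by simp
    ultimately show ?case using Suc by (simp only: sum.lessThan_Suc scaleR_left_distrib Suc_lessD)
  qed simp
  have "C 0 - C (N - 1) = r (N - 1) *\<^sub>R (C 1 - C 0)" using r[of "N - 1"] tg_last assms(1) N by simp
  moreover have "C (N - 1) - C 0 = (\<Sum>e<N - 1. r e) *\<^sub>R (C 1 - C 0)" using sum[of "N - 1"] N by simp
  ultimately have "(r (N - 1) + (\<Sum>e<N - 1. r e)) *\<^sub>R (C 1 - C 0) = 0"
    by (simp add: scaleR_left_distrib) (metis add.commute diff_add_cancel diff_self add_diff_eq)
  then have "r (N - 1) + (\<Sum>e<N - 1. r e) = 0" using d0 by simp
  moreover have "0 \<le> (\<Sum>e<N - 1. r e)" by (rule sum_nonneg) (use r assms(1) in \<open>auto intro: less_imp_le\<close>)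
  ultimately show False using r[of "N - 1"] assms(1) N by auto
qed

definition straight where
  "straight u l = (\<lambda>k. if k < N then of_real (\<Sum>i<k. l i) * u else (0::complex))"

lemma flat_straight:
  assumes m: "m = N - 1" and C: "C \<in> confs a b" and flat: "flat C"
  shows "\<exists>u l. cmod u = 1 \<and> (\<forall>e. l e \<in> (if e < m then {a e<..<b e} else {0})) \<and> C = straight u l"
proof -
  have nt: "nt C" and C0: "C 0 = 0" "\<And>v. v \<ge> N \<Longrightarrow> C v = 0" using C by (auto simp: confs_def)
  have tgS: "tg e = Suc e" if "e < m" for e using that m by (intro tg_Suc) linarith
  define u where "u = sgn (C 1 - C 0)"
  define l where "l = (\<lambda>e. if e < m then cmod (C (tg e) - C e) else 0)"
  have d0: "C 1 - C 0 \<noteq> 0" using nt_neq[OF nt, of 0] N tg_Suc[of 0] by auto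
  then have "cmod u = 1" by (simp add: u_def norm_sgn)
  moreover have "\<forall>e. l e \<in> (if e < m then {a e<..<b e} else {0})"
    using C by (simp add: l_def confs_def)
  moreover have step: "C (Suc e) - C e = of_real (l e) * u" if e: "e < m" for e
  proof -
    obtain r where r: "r > 0" "C (tg e) - C e = r *\<^sub>R (C 1 - C 0)" using flat_parallel[OF nt flat e] by blast
    have "of_real (l e) * u = C (tg e) - C e"
    proof -
      have "l e = r * cmod (C 1 - C 0)" using e r by (simp add: l_def)
      then have "of_real (l e) * u = r *\<^sub>R (cmod (C 1 - C 0) *\<^sub>R u)" by (simp add: scaleR_conv_of_real)
      also have "cmod (C 1 - C 0) *\<^sub>R u = C 1 - C 0" using d0 by (simp add: u_def sgn_div_norm)
      finally show ?thesis using r by simp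
    qed
    then show ?thesis using tgS[OF e] by simp
  qed
  have "C v = of_real (\<Sum>i<v. l i) * u" if "v < N" for v
    using that
  proof (induction v)
    case (Suc v)
    have "C (Suc v) = C v + of_real (l v) * u" using step[of v] Suc.prems m by (simp add: algebra_simps)
    then show ?case using Suc by (simp add: algebra_simps)
  qed (use C0 in simp)
  then have "C = straight u l" using C0 by (auto simp: straight_def)
  ultimately show ?thesis by blast
qed

lemma straight_confs:
  assumes m: "m = N - 1" and u: "cmod u = 1" and l: "\<And>e. e < m \<Longrightarrow> 0 \<le> a e \<and> a e < l e \<and> l e < b e"
  shows "straight u l \<in> confs a b"
proof -
  let ?s = "\<lambda>k. \<Sum>i<k. l i"
  have u0: "u \<noteq> 0" using u by auto
  have tgS: "tg e = Suc e" if "e < m" for e using that m by (intro tg_Suc) linarith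
  have lt: "e < N" "Suc e < N" if "e < m" for e using that m by auto
  have mono: "?s i < ?s j" if "i < j" "j < N" for i j
    using that
  proof (induction j)
    case (Suc j)
    have "j < m" using Suc.prems m by simp
    from l[OF this] have "l j > 0" by linarith
    then show ?case using Suc by (cases "i = j") auto
  qed simp
  have str: "straight u l k = of_real (?s k) * u" if "k < N" for k using that by (simp add: straight_def)
  have seg: "\<exists>s. ?s e \<le> s \<and> s \<le> ?s (Suc e) \<and> z = of_real s * u"
    if h: "z \<in> closed_segment (straight u l e) (straight u l (tg e))" "e < m" for z e
  proof -
    obtain t where t: "0 \<le> t" "t \<le> 1" "z = straight u l e + t *\<^sub>R (straight u l (tg e) - straight u l e)"
      using h(1) unfolding in_segment_iff by blast
    have "0 < l e" using l[OF h(2)] by linarith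
    moreover have "z = of_real (?s e + t * l e) * u"
      using t(3) lt[OF h(2)] by (simp add: str tgS[OF h(2)] scaleR_conv_of_real algebra_simps)
    ultimately show ?thesis using t(1,2) by (intro exI[of _ "?s e + t * l e"]) (auto simp: mult_left_le_one_le)
  qed
  have "nt (straight u l)"
    unfolding nt_def
  proof (intro conjI allI impI)
    show "inj_on (straight u l) {..<N}"
    proof (rule inj_onI, rule ccontr)
      fix i j assume h: "i \<in> {..<N}" "j \<in> {..<N}" "straight u l i = straight u l j" "i \<noteq> j"
      then have "?s i = ?s j" using u0 by (simp add: str del: of_real_sum)
      then show False using mono[of i j] mono[of j i] h by (cases "i < j") auto
    qed
    have key: "closed_segment (straight u l e) (straight u l (tg e)) \<inter> closed_segment (straight u l f) (straight u l (tg f))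
        \<subseteq> {straight u l (tg e)} \<inter> {straight u l f}" if h: "e < m" "f < m" "e < f" for e f
    proof
      fix z assume "z \<in> closed_segment (straight u l e) (straight u l (tg e)) \<inter> closed_segment (straight u l f) (straight u l (tg f))"
      then obtain s t where s: "s \<le> ?s (Suc e)" "z = of_real s * u" and t: "?s f \<le> t" "z = of_real t * u"
        using seg[of z e] seg[of z f] h by blast
      have "s = t" using s(2) t(2) u0 by simp
      moreover have "?s (Suc e) \<le> ?s f" using mono[of "Suc e" f] h lt[OF h(2)] by (cases "Suc e = f") auto
      ultimately have "s = ?s (Suc e)" "t = ?s f" using s t by linarith+
      then show "z \<in> {straight u l (tg e)} \<inter> {straight u l f}"
        using s t lt[OF h(1)] lt[OF h(2)] by (simp add: str tgS[OF h(1)])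
    qed
    fix e f assume h: "e < m" "f < m" "e \<noteq> f"
    show "closed_segment (straight u l e) (straight u l (tg e)) \<inter> closed_segment (straight u l f) (straight u l (tg f))
        \<subseteq> {straight u l e, straight u l (tg e)} \<inter> {straight u l f, straight u l (tg f)}"
      using key[of e f] key[of f e] h by (cases "e < f") auto
  qed
  moreover have "cmod (straight u l (tg e) - straight u l e) = l e" if "e < m" for e
  proof -
    have "straight u l (tg e) - straight u l e = of_real (l e) * u"
      using lt[OF that] by (simp add: str tgS[OF that] algebra_simps)
    moreover have "0 \<le> l e" using l[OF that] by linarith
    ultimately show ?thesis using u by (simp add: norm_mult)
  qed
  ultimately show ?thesis using l N by (simp add: confs_def straight_def)
qed

text \<open>A minimiser that is not flat would belong to a closed chain, so every component contains
  a straight chain; straight chains are parametrised by the circle of directions and a box of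
  lengths.\<close>

theorem connected_open_confs:
  assumes m: "m = N - 1" and a: "\<And>e. e < m \<Longrightarrow> 0 \<le> a e"
  shows "connected (confs a b)"
proof -
  let ?B = "{l. \<forall>e. l e \<in> (if e < m then {a e<..<b e} else {0})}"
  define T where "T = (\<lambda>(u,l). straight u l) ` (sphere 0 1 \<times> ?B)"
  have "continuous_on (sphere 0 1 \<times> ?B) (\<lambda>(u,l). straight u l)"
    unfolding case_prod_unfold
  proof (rule continuous_on_coordinatewise_then_product)
    fix k
    have c: "continuous_on S (\<lambda>q :: complex \<times> (nat \<Rightarrow> real). snd q i)" for S i
      by (rule continuous_on_product_then_coordinatewise) (rule continuous_on_snd[OF continuous_on_id])
    show "continuous_on (sphere 0 1 \<times> ?B) (\<lambda>q. straight (fst q) (snd q) k)"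
      unfolding straight_def by (cases "k < N") (simp_all, intro continuous_intros c)
  qed
  moreover have "connected (sphere (0::complex) 1)" by (rule connected_sphere) simp
  moreover have "connected ?B" by (rule connected_box_fun) auto
  ultimately have "connected T" unfolding T_def by (intro connected_continuous_image connected_Times)
  moreover have "T \<subseteq> confs a b"
  proof
    fix C assume "C \<in> T"
    then obtain u l where C: "C = straight u l" "cmod u = 1" "\<And>e. l e \<in> (if e < m then {a e<..<b e} else {0})"
      unfolding T_def by auto
    show "C \<in> confs a b" unfolding C(1)
      by (rule straight_confs[OF m C(2)]) (use C(3) a in \<open>force split: if_splits\<close>)
  qed
  ultimately show ?thesis
  proof (rule connected_if_components_meet)
    fix W assume W: "W \<in> components (confs a b)"
    obtain C where C: "C \<in> W" "stressed {..<N} adj (stress {..<N} cf (kf a b) gaps C) C"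
      using component_stressed[OF a W] by blast
    have Cc: "C \<in> confs a b" using in_components_subset[OF W] C by auto
    have "flat C"
    proof (rule ccontr)
      assume "\<not> flat C"
      then interpret stressed_chain N m "stress {..<N} cf (kf a b) gaps C" C
        using Cc C(2) chain_axioms unfolding stressed_chain_def stressed_chain_axioms_def by (simp add: confs_def)
      show False using is_closed m N by simp
    qed
    then obtain u l where "cmod u = 1" "\<forall>e. l e \<in> (if e < m then {a e<..<b e} else {0})" "C = straight u l"
      using flat_straight[OF m Cc] by blast
    then have "(u,l) \<in> sphere 0 1 \<times> ?B" "C = (\<lambda>(u,l). straight u l) (u,l)" by simp_all
    then have "C \<in> T" unfolding T_def by blast
    then show "W \<inter> T \<noteq> {}" using C by blast
  qed
qed

end

section \<open>Closing polygons by Moebius transformations\<close>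

text \<open>The automorphism of the unit disc that sends \<open>z\<close> to 0, used for its action
  on the boundary circle.\<close>

definition mob :: "complex \<Rightarrow> complex \<Rightarrow> complex" where
  "mob z u = (u - z) / (1 - cnj z * u)"

lemma mob_denom:
  assumes "cmod z < 1" "cmod u = 1"
  shows "1 - cnj z * u \<noteq> 0" "u - z \<noteq> 0"
proof -
  have "cmod (cnj z * u) < 1" using assms by (simp add: norm_mult)
  then show "1 - cnj z * u \<noteq> 0" by auto
  show "u - z \<noteq> 0" using assms by auto
qed

lemma unit_cnj: "cmod u = 1 \<Longrightarrow> u * cnj u = 1"
  by (simp add: complex_norm_square[symmetric])

lemma mob_denom_mult:
  assumes "cmod u = 1"
  shows "(1 - cnj z * u) * (u - z) = u * of_real ((cmod (1 - cnj z * u))\<^sup>2)"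
proof -
  have "of_real ((cmod (1 - cnj z * u))\<^sup>2) = (1 - cnj z * u) * cnj (1 - cnj z * u)"
    by (rule complex_norm_square)
  moreover have "u * cnj (1 - cnj z * u) = u - z"
    using unit_cnj[OF assms] by (simp add: algebra_simps)
  ultimately show ?thesis by (simp add: mult.commute mult.left_commute)
qed

lemma cmod_mob:
  assumes "cmod z < 1" "cmod u = 1"
  shows "cmod (mob z u) = 1"
proof -
  have "u * cnj (1 - cnj z * u) = u - z * (u * cnj u)" by (simp add: algebra_simps)
  then have "cmod (u - z) = cmod (u * cnj (1 - cnj z * u))" by (simp only: unit_cnj[OF assms(2)] mult_1_right)
  then have "cmod (u - z) = cmod (1 - cnj z * u)" using assms(2) by (simp only: norm_mult complex_mod_cnj)
  then show ?thesis using mob_denom[OF assms] by (simp add: mob_def norm_divide)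
qed

lemma mob_0 [simp]: "mob 0 u = u" by (simp add: mob_def)

text \<open>Two disc automorphisms that send \<open>z'\<close> to 0 differ by a rotation, which is
  the leading factor. This permits moving a base point \<open>z\<close> to 0.\<close>

lemma mob_comp:
  assumes z: "cmod z < 1" and z': "cmod z' < 1" and u: "cmod u = 1"
  shows "mob z' u = (1 - cnj z * z') / (1 - z * cnj z') * mob ((z' - z) / (1 - cnj z * z')) (mob z u)"
proof -
  have n1: "1 - cnj z * u \<noteq> 0" "1 - cnj z' * u \<noteq> 0" using mob_denom z z' u by auto
  have zz: "cmod (cnj z * z') < 1"
    using mult_strict_mono'[of "cmod z" 1 "cmod z'" 1] z z' by (simp add: norm_mult)
  then have n2: "1 - cnj z * z' \<noteq> 0" by auto
  have n3: "1 - z * cnj z' \<noteq> 0" using n2 by (metis complex_cnj_cnj complex_cnj_diff complex_cnj_mult complex_cnj_one complex_cnj_zero_iff)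
  have "z * cnj z = of_real ((cmod z)\<^sup>2)" by (rule complex_norm_square[symmetric])
  moreover have "(cmod z)\<^sup>2 < 1" using z by (simp add: abs_square_less_1)
  ultimately have n4: "1 - z * cnj z \<noteq> 0" by (metis of_real_1 of_real_eq_iff order_less_irrefl right_minus_eq)
  define w where "w = (z' - z) / (1 - cnj z * z')"
  have num: "mob z u - w = (1 - z * cnj z) * (u - z') / ((1 - cnj z * u) * (1 - cnj z * z'))"
    unfolding mob_def w_def using n1 n2 by (simp add: field_simps)
  have den: "1 - cnj w * mob z u = (1 - z * cnj z) * (1 - cnj z' * u) / ((1 - cnj z * u) * (1 - z * cnj z'))"
  proof -
    have "(1 - cnj z * u) * (1 - z * cnj z') - (cnj z' - cnj z) * (u - z) = (1 - z * cnj z) * (1 - cnj z' * u)"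
      by (simp add: algebra_simps)
    moreover have "cnj w = (cnj z' - cnj z) / (1 - z * cnj z')" by (simp add: w_def)
    moreover have "1 - A / B * (C / D) = (D * B - A * C) / (D * B)" if "B \<noteq> 0" "D \<noteq> 0" for A B C D :: complex
      using that by (simp add: field_simps)
    ultimately show ?thesis unfolding mob_def using n1(1) n3 by simp
  qed
  have "mob w (mob z u) = (mob z u - w) / (1 - cnj w * mob z u)" by (simp add: mob_def[of w])
  also have "\<dots> = (1 - z * cnj z') / (1 - cnj z * z') * mob z' u"
    unfolding num den mob_def[of z'] using n1 n2 n3 n4 by (simp add: divide_simps)
  finally show ?thesis unfolding w_def using n2 n3 by simp
qed

text \<open>The source of uniqueness: \<open>mob z\<close> pushes every unit vector away from the
  direction of \<open>z\<close>, strictly unless the vector is parallel to \<open>z\<close>.\<close>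

lemma mob_real_part:
  assumes "cmod z < 1" "cmod u = 1"
  shows "Re (cnj z * mob z u) = Re (cnj z * u) - 2 * (Im (cnj z * u))\<^sup>2 / (cmod (1 - cnj z * u))\<^sup>2"
proof -
  define q where "q = cnj z * u"
  have r: "(cmod z)\<^sup>2 = (Re q)\<^sup>2 + (Im q)\<^sup>2"
    using assms(2) cmod_power2[of q] by (simp add: q_def norm_mult)
  have zz: "cnj z * z = of_real ((cmod z)\<^sup>2)" by (metis complex_norm_square mult.commute)
  have n: "1 - q \<noteq> 0" using mob_denom[OF assms] by (simp add: q_def)
  have nn: "(cmod (1 - q))\<^sup>2 = (1 - Re q)\<^sup>2 + (Im q)\<^sup>2" by (simp add: cmod_power2)
  have np: "(1 - Re q)\<^sup>2 + (Im q)\<^sup>2 \<noteq> 0" using n nn by auto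
  have "cnj z * mob z u = (q - of_real ((cmod z)\<^sup>2)) / (1 - q)"
    unfolding mob_def q_def zz[symmetric] by (simp add: algebra_simps)
  then have "Re (cnj z * mob z u) = ((Re q - (cmod z)\<^sup>2) * (1 - Re q) - (Im q)\<^sup>2) / ((1 - Re q)\<^sup>2 + (Im q)\<^sup>2)"
    by (simp add: Re_divide power2_eq_square)
  also have "\<dots> = Re q - 2 * (Im q)\<^sup>2 / ((1 - Re q)\<^sup>2 + (Im q)\<^sup>2)"
    using np unfolding r by (simp add: field_simps) (simp add: power2_eq_square algebra_simps)
  finally show ?thesis unfolding q_def[symmetric] nn .
qed

text \<open>Projecting both closing conditions to the direction of \<open>z\<close>, the terms can
  only decrease by \<open>mob_real_part\<close>, yet both sums vanish. So every direction is
  parallel to \<open>z\<close>, which leaves two directions only.\<close>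

lemma mob_closing_zero:
  assumes I: "finite I" and z: "cmod z < 1" and u: "\<And>i. i \<in> I \<Longrightarrow> cmod (u i) = 1" and l: "\<And>i. i \<in> I \<Longrightarrow> 0 < l i"
    and three: "card (u ` I) \<ge> 3"
    and c0: "(\<Sum>i\<in>I. of_real (l i) * u i) = 0" and c1: "(\<Sum>i\<in>I. of_real (l i) * mob z (u i)) = 0"
  shows "z = 0"
proof (rule ccontr)
  assume z0: "z \<noteq> 0"
  have "(\<Sum>i\<in>I. l i * Re (cnj z * u i)) = Re (cnj z * (\<Sum>i\<in>I. of_real (l i) * u i))"
    by (simp add: sum_distrib_left algebra_simps sum.distrib[symmetric])
  then have s0: "(\<Sum>i\<in>I. l i * Re (cnj z * u i)) = 0" using c0 by simp
  have "(\<Sum>i\<in>I. l i * Re (cnj z * mob z (u i))) = Re (cnj z * (\<Sum>i\<in>I. of_real (l i) * mob z (u i)))"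
    by (simp add: sum_distrib_left algebra_simps sum.distrib[symmetric])
  then have s1: "(\<Sum>i\<in>I. l i * Re (cnj z * mob z (u i))) = 0" using c1 by simp
  have "(\<Sum>i\<in>I. l i * (2 * (Im (cnj z * u i))\<^sup>2 / (cmod (1 - cnj z * u i))\<^sup>2))
     = (\<Sum>i\<in>I. l i * Re (cnj z * u i)) - (\<Sum>i\<in>I. l i * Re (cnj z * mob z (u i)))"
    unfolding sum_subtractf[symmetric] by (intro sum.cong refl) (simp add: mob_real_part[OF z u] right_diff_distrib del: times_complex.sel)
  then have "(\<Sum>i\<in>I. l i * (2 * (Im (cnj z * u i))\<^sup>2 / (cmod (1 - cnj z * u i))\<^sup>2)) = 0" using s0 s1 by simp
  then have "\<forall>i\<in>I. l i * (2 * (Im (cnj z * u i))\<^sup>2 / (cmod (1 - cnj z * u i))\<^sup>2) = 0"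
    by (subst (asm) sum_nonneg_eq_0_iff[OF I]) (use l in \<open>auto intro!: mult_nonneg_nonneg divide_nonneg_nonneg intro: less_imp_le simp del: times_complex.sel\<close>)
  then have im: "Im (cnj z * u i) = 0" if "i \<in> I" for i
    using that l[OF that] mob_denom[OF z u[OF that]] by force
  have "u ` I \<subseteq> {sgn z, - sgn z}"
  proof
    fix y assume "y \<in> u ` I"
    then obtain i where i: "i \<in> I" "y = u i" by auto
    define q where "q = Re (cnj z * u i)"
    have q: "cnj z * u i = of_real q" using im[OF i(1)] by (simp add: complex_eq_iff q_def)
    have qa: "\<bar>q\<bar> = cmod z" using arg_cong[OF q, of cmod] u[OF i(1)] by (simp add: norm_mult)
    have "z * (cnj z * u i) = of_real ((cmod z)\<^sup>2) * u i"
      by (simp only: complex_norm_square mult.assoc)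
    then have "of_real ((cmod z)\<^sup>2) * u i = z * of_real q" using q by simp
    then have ui: "u i = of_real (q / (cmod z)\<^sup>2) * z" using z0 by (simp add: field_simps)
    have "q = cmod z \<or> q = - cmod z" using qa by linarith
    then have qq: "q / (cmod z)\<^sup>2 = 1 / cmod z \<or> q / (cmod z)\<^sup>2 = - (1 / cmod z)"
      using z0 by (auto simp: power2_eq_square)
    have sz: "sgn z = of_real (1 / cmod z) * z" by (simp add: sgn_div_norm scaleR_conv_of_real divide_inverse)
    show "y \<in> {sgn z, - sgn z}"
      unfolding i(2) ui sz using qq by (elim disjE) (simp_all only: of_real_minus minus_mult_left[symmetric] insert_iff simp_thms)
  qed
  then have "card (u ` I) \<le> card {sgn z, - sgn z}" by (intro card_mono) auto
  also have "\<dots> \<le> 2" by (simp add: card_insert_if)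
  finally show False using three by simp
qed

text \<open>After the directions are replaced by \<open>mob z (u i)\<close>, the two solutions
  become 0 and \<open>w\<close>; the rotation in \<open>mob_comp\<close> does not affect a vanishing
  sum.\<close>

lemma mob_closing_unique:
  assumes I: "finite I" and z: "cmod z < 1" and z': "cmod z' < 1" and u: "\<And>i. i \<in> I \<Longrightarrow> cmod (u i) = 1"
    and l: "\<And>i. i \<in> I \<Longrightarrow> 0 < l i" and three: "card (u ` I) \<ge> 3"
    and c0: "(\<Sum>i\<in>I. of_real (l i) * mob z (u i)) = 0" and c1: "(\<Sum>i\<in>I. of_real (l i) * mob z' (u i)) = 0"
  shows "z = z'"
proof -
  define w where "w = (z' - z) / (1 - cnj z * z')"
  define c where "c = (1 - cnj z * z') / (1 - z * cnj z')"
  have zz: "cmod (cnj z * z') < 1"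
    using mult_strict_mono'[of "cmod z" 1 "cmod z'" 1] z z' by (simp add: norm_mult)
  then have n2: "1 - cnj z * z' \<noteq> 0" by auto
  have n3: "1 - z * cnj z' \<noteq> 0" using n2 by (metis complex_cnj_cnj complex_cnj_diff complex_cnj_mult complex_cnj_one complex_cnj_zero_iff)
  have c: "c \<noteq> 0" using n2 n3 by (simp add: c_def)
  have "1 - (cmod w)\<^sup>2 = (1 - (cmod z)\<^sup>2) * (1 - (cmod z')\<^sup>2) / (cmod (1 - cnj z * z'))\<^sup>2"
  proof -
    have p: "(cmod (1 - cnj z * z'))\<^sup>2 \<noteq> 0" using n2 by simp
    have "(cmod w)\<^sup>2 = (cmod (z' - z))\<^sup>2 / (cmod (1 - cnj z * z'))\<^sup>2" by (simp add: w_def norm_divide power_divide)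
    moreover have "(cmod (1 - cnj z * z'))\<^sup>2 - (cmod (z' - z))\<^sup>2 = (1 - (cmod z)\<^sup>2) * (1 - (cmod z')\<^sup>2)"
      unfolding cmod_power2 by (simp add: power2_eq_square algebra_simps)
    ultimately show ?thesis using p by (simp add: field_simps)
  qed
  also have "\<dots> > 0" using z z' n2 by (intro divide_pos_pos mult_pos_pos) (auto simp: abs_square_less_1)
  finally have "(cmod w)\<^sup>2 < 1\<^sup>2" by simp
  then have w: "cmod w < 1" by (rule power2_less_imp_less) simp
  have inj: "inj_on (mob z) (u ` I)"
  proof (rule inj_onI)
    fix a b assume "a \<in> u ` I" "b \<in> u ` I" "mob z a = mob z b"
    moreover from this have ab: "cmod a = 1" "cmod b = 1" using u by auto
    ultimately have "(a - z) * (1 - cnj z * b) = (b - z) * (1 - cnj z * a)"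
      using mob_denom[OF z] by (simp add: mob_def frac_eq_eq)
    then have "(1 - z * cnj z) * (a - b) = 0" by (simp add: algebra_simps)
    moreover have "z * cnj z = of_real ((cmod z)\<^sup>2)" by (rule complex_norm_square[symmetric])
    moreover have "(cmod z)\<^sup>2 < 1" using z by (simp add: abs_square_less_1)
    ultimately show "a = b" by (metis mult_eq_0_iff of_real_1 of_real_eq_iff order_less_irrefl right_minus_eq)
  qed
  have "w = 0"
  proof (rule mob_closing_zero[OF I w, of "\<lambda>i. mob z (u i)" l])
    show "3 \<le> card ((\<lambda>i. mob z (u i)) ` I)"
      using three card_image[OF inj] by (simp add: image_image)
    have "(\<Sum>i\<in>I. of_real (l i) * mob z' (u i)) = c * (\<Sum>i\<in>I. of_real (l i) * mob w (mob z (u i)))"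
      unfolding sum_distrib_left by (intro sum.cong refl) (simp add: mob_comp[OF z z' u] c_def w_def)
    then show "(\<Sum>i\<in>I. of_real (l i) * mob w (mob z (u i))) = 0" using c1 c by simp
  qed (use u l c0 cmod_mob[OF z] in auto)
  then show ?thesis using n2 by (simp add: w_def)
qed

text \<open>The potential whose critical points in the disc are the \<open>z\<close> with
  \<open>\<Sum> l i * mob z (u i) = 0\<close>: a weighted sum of Busemann functions.\<close>
definition pot :: "nat \<Rightarrow> (nat \<Rightarrow> complex) \<Rightarrow> (nat \<Rightarrow> real) \<Rightarrow> complex \<Rightarrow> real" where
  "pot N u l z = (\<Sum>i<N. l i * (2 * ln (cmod (u i - z)) - ln (1 - (cmod z)\<^sup>2)))"

text \<open>With \<open>\<epsilon>\<close> the distance of \<open>z\<close> to the circle, all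
  directions but the nearest one stay at distance \<open>\<delta> / 2\<close> or more and gain
  \<open>- ln \<epsilon>\<close> each, while the nearest loses at most as much. The balance is the
  total weight minus twice one weight, hence at least \<open>c\<close>.\<close>

lemma pot_far:
  assumes u: "\<And>i. i < N \<Longrightarrow> cmod (u i) = 1" and sep: "\<And>i j. i < N \<Longrightarrow> j < N \<Longrightarrow> i \<noteq> j \<Longrightarrow> \<delta> \<le> cmod (u i - u j)"
    and l: "\<And>i. i < N \<Longrightarrow> 0 < l i" and M: "(\<Sum>i<N. l i) \<le> M"
    and c: "\<And>k. k < N \<Longrightarrow> c \<le> (\<Sum>i<N. l i) - 2 * l k" and pos: "0 < \<delta>" "\<delta> \<le> 2" "0 < c"
    and z: "cmod z < 1" and N: "0 < N"
  shows "- c * ln (1 - cmod z) - M * (ln 2 - 2 * ln (\<delta> / 2)) \<le> pot N u l z"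
proof -
  define \<epsilon> where "\<epsilon> = 1 - cmod z"
  have \<epsilon>: "0 < \<epsilon>" "\<epsilon> \<le> 1" using z by (auto simp: \<epsilon>_def)
  have e: "1 - (cmod z)\<^sup>2 = \<epsilon> * (2 - \<epsilon>)" by (simp add: \<epsilon>_def power2_eq_square algebra_simps)
  have "1 - (cmod z)\<^sup>2 \<le> 2 * \<epsilon>" "0 < 1 - (cmod z)\<^sup>2" unfolding e using \<epsilon> by (simp_all add: right_diff_distrib)
  then have L: "ln (1 - (cmod z)\<^sup>2) \<le> ln 2 + ln \<epsilon>"
    using \<epsilon> by (metis ln_le_cancel_iff ln_mult_pos mult_pos_pos zero_less_numeral)
  have le: "ln \<epsilon> \<le> 0" using \<epsilon> by (simp add: ln_le_zero_iff)
  have ld: "ln (\<delta> / 2) \<le> 0" using pos by simp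
  obtain k where k: "k < N" "\<And>i. i < N \<Longrightarrow> cmod (u k - z) \<le> cmod (u i - z)"
    using arg_min_if_finite[of "{..<N}" "\<lambda>i. cmod (u i - z)"] N by (metis finite_lessThan lessThan_iff lessThan_empty_iff not_less order_less_irrefl)
  have tk: "ln \<epsilon> + 2 * ln (\<delta> / 2) - ln 2 \<le> 2 * ln (cmod (u k - z)) - ln (1 - (cmod z)\<^sup>2)"
  proof -
    have "\<epsilon> \<le> cmod (u k - z)" using norm_triangle_ineq2[of "u k" z] u[OF k(1)] by (simp add: \<epsilon>_def)
    then have "ln \<epsilon> \<le> ln (cmod (u k - z))" using \<epsilon>(1) by (subst ln_le_cancel_iff) auto
    then show ?thesis using L ld by linarith
  qed
  have ti: "- ln \<epsilon> + 2 * ln (\<delta> / 2) - ln 2 \<le> 2 * ln (cmod (u i - z)) - ln (1 - (cmod z)\<^sup>2)" if i: "i < N" "i \<noteq> k" for i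
  proof -
    have "\<delta> \<le> cmod (u i - u k)" using sep i k by simp
    also have "\<dots> \<le> cmod (u i - z) + cmod (u k - z)" by (metis norm_minus_commute norm_diff_triangle_ineq norm_triangle_sub add.commute dist_norm dist_triangle2)
    also have "\<dots> \<le> 2 * cmod (u i - z)" using k(2)[OF i(1)] by simp
    finally have "\<delta> / 2 \<le> cmod (u i - z)" by simp
    then have "ln (\<delta> / 2) \<le> ln (cmod (u i - z))" using pos by (subst ln_le_cancel_iff) auto
    then show ?thesis using L by linarith
  qed
  define S where "S = (\<Sum>i\<in>{..<N} - {k}. l i)"
  have Sk: "(\<Sum>i<N. l i) = l k + S" unfolding S_def by (rule sum.remove) (use k in auto)
  have "pot N u l z = l k * (2 * ln (cmod (u k - z)) - ln (1 - (cmod z)\<^sup>2))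
     + (\<Sum>i\<in>{..<N} - {k}. l i * (2 * ln (cmod (u i - z)) - ln (1 - (cmod z)\<^sup>2)))"
    unfolding pot_def by (rule sum.remove) (use k in auto)
  moreover have "l k * (ln \<epsilon> + 2 * ln (\<delta> / 2) - ln 2) \<le> l k * (2 * ln (cmod (u k - z)) - ln (1 - (cmod z)\<^sup>2))"
    using tk l[OF k(1)] by simp
  moreover have "(\<Sum>i\<in>{..<N} - {k}. l i * (- ln \<epsilon> + 2 * ln (\<delta> / 2) - ln 2))
      \<le> (\<Sum>i\<in>{..<N} - {k}. l i * (2 * ln (cmod (u i - z)) - ln (1 - (cmod z)\<^sup>2)))"
    using ti l by (intro sum_mono mult_left_mono) (auto intro: less_imp_le)
  moreover have "(\<Sum>i\<in>{..<N} - {k}. l i * (- ln \<epsilon> + 2 * ln (\<delta> / 2) - ln 2)) = S * (- ln \<epsilon> + 2 * ln (\<delta> / 2) - ln 2)"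
    by (simp add: S_def sum_distrib_right)
  ultimately have "l k * (ln \<epsilon> + 2 * ln (\<delta> / 2) - ln 2) + S * (- ln \<epsilon> + 2 * ln (\<delta> / 2) - ln 2) \<le> pot N u l z"
    by linarith
  moreover have "l k * (ln \<epsilon> + 2 * ln (\<delta> / 2) - ln 2) + S * (- ln \<epsilon> + 2 * ln (\<delta> / 2) - ln 2)
     = (S - l k) * (- ln \<epsilon>) - (l k + S) * (ln 2 - 2 * ln (\<delta> / 2))" by (simp add: algebra_simps)
  moreover have "c * (- ln \<epsilon>) \<le> (S - l k) * (- ln \<epsilon>)"
    using c[OF k(1)] Sk le by (intro mult_right_mono) auto
  moreover have "(l k + S) * (ln 2 - 2 * ln (\<delta> / 2)) \<le> M * (ln 2 - 2 * ln (\<delta> / 2))"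
  proof (rule mult_right_mono)
    show "0 \<le> ln 2 - 2 * ln (\<delta> / 2)" using ld ln_gt_zero[of 2] by linarith
  qed (use M Sk in simp)
  ultimately show ?thesis by (simp add: \<epsilon>_def)
qed

lemma pot_DERIV:
  assumes u: "\<And>i. i < N \<Longrightarrow> cmod (u i) = 1" and z: "cmod z < 1"
  shows "((\<lambda>t. pot N u l (z + t *\<^sub>R d)) has_real_derivative
     - 2 / (1 - (cmod z)\<^sup>2) * inner (\<Sum>i<N. of_real (l i) * mob z (u i)) d) (at 0)"
proof -
  define r where "r = 1 - (cmod z)\<^sup>2"
  have r: "r > 0" using z by (simp add: r_def abs_square_less_1)
  have D1: "((\<lambda>t. ln (1 - (cmod (z + t *\<^sub>R d))\<^sup>2)) has_real_derivative (- 2 * inner z d / r)) (at 0)"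
  proof -
    have e: "1 - (cmod (z + t *\<^sub>R d))\<^sup>2 = 1 - inner z z - 2 * t * inner z d - t\<^sup>2 * inner d d" for t
      unfolding power2_norm_eq_inner by (simp add: inner_add inner_commute power2_eq_square algebra_simps)
    have "1 - inner z z = r" by (simp add: r_def power2_norm_eq_inner)
    then show ?thesis unfolding e using r by (auto intro!: derivative_eq_intros simp: divide_simps)
  qed
  have D2: "((\<lambda>t. ln (cmod (u i - (z + t *\<^sub>R d)))) has_real_derivative
      (- inner (u i - z) d / (cmod (u i - z))\<^sup>2)) (at 0)" if "i < N" for i
  proof -
    have n: "u i - z \<noteq> 0" using u[OF that] z by auto
    have e: "u i - (z + t *\<^sub>R d) = (u i - z) + t *\<^sub>R (- d)" for t by simp
    have "((\<lambda>t. cmod ((u i - z) + t *\<^sub>R (- d))) has_real_derivative inner (sgn (u i - z)) (- d)) (at 0)"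
      by (rule norm_line_DERIV) (use n in simp)
    have "DERIV ln (cmod ((u i - z) + 0 *\<^sub>R (- d))) :> 1 / cmod ((u i - z) + 0 *\<^sub>R (- d))"
      by (rule DERIV_ln_divide) (use n in simp)
    from DERIV_chain2[OF this \<open>((\<lambda>t. cmod ((u i - z) + t *\<^sub>R (- d))) has_real_derivative inner (sgn (u i - z)) (- d)) (at 0)\<close>]
    have "((\<lambda>t. ln (cmod ((u i - z) + t *\<^sub>R (- d)))) has_real_derivative
       1 / cmod (u i - z) * inner (sgn (u i - z)) (- d)) (at 0)" by simp
    moreover have "1 / cmod (u i - z) * inner (sgn (u i - z)) (- d) = - inner (u i - z) d / (cmod (u i - z))\<^sup>2"
      by (simp add: sgn_div_norm power2_eq_square divide_inverse)
    ultimately show ?thesis unfolding e by simp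
  qed
  have "((\<lambda>t. pot N u l (z + t *\<^sub>R d)) has_real_derivative
    (\<Sum>i<N. l i * (2 * (- inner (u i - z) d / (cmod (u i - z))\<^sup>2) - (- 2 * inner z d / r)))) (at 0)"
    unfolding pot_def by (intro DERIV_sum DERIV_cmult DERIV_diff D1 D2) auto
  moreover have "l i * (2 * (- inner (u i - z) d / (cmod (u i - z))\<^sup>2) - (- 2 * inner z d / r))
      = - 2 / r * inner (of_real (l i) * mob z (u i)) d" if i: "i < N" for i
  proof -
    have n: "u i - z \<noteq> 0" "1 - cnj z * u i \<noteq> 0" using mob_denom[OF z u[OF i]] by auto
    have nz: "cnj (u i - z) \<noteq> 0" using n by simp
    have inv: "inverse (of_real ((cmod (u i - z))\<^sup>2)) * (u i - z) = 1 / cnj (u i - z)"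
    proof -
      have "inverse (w * cnj w) * w = 1 / cnj w" if "w \<noteq> 0" for w using that by (simp add: field_simps)
      from this[OF n(1)] show ?thesis unfolding complex_norm_square .
    qed
    have rz: "of_real r = 1 - z * cnj z" unfolding r_def by (simp add: complex_norm_square del: of_real_power)
    have uc: "u i * cnj (u i - z) = 1 - cnj z * u i" using unit_cnj[OF u[OF i]] by (simp add: algebra_simps)
    have "of_real r * (1 / cnj (u i - z)) - z = mob z (u i)"
    proof -
      have "of_real r * (1 / cnj (u i - z)) = of_real r * u i / (1 - cnj z * u i)"
        unfolding uc[symmetric] using u[OF i] by auto
      moreover have "a / b - z = (a - z * b) / b" if "b \<noteq> 0" for a b
        using that by (simp add: diff_divide_distrib)
      moreover have "of_real r * u i - z * (1 - cnj z * u i) = u i - z"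
        unfolding rz by (simp add: algebra_simps)
      ultimately show ?thesis unfolding mob_def using n(2) by simp
    qed
    \<comment> \<open>In this form \<open>mob z (u i)\<close> is visibly a combination of the
      gradients of the two logarithms.\<close>
    then have m: "mob z (u i) = (r / (cmod (u i - z))\<^sup>2) *\<^sub>R (u i - z) - z"
      using inv by (simp add: scaleR_conv_of_real divide_inverse mult.assoc)
    have "- 2 / r * inner (of_real (l i) * mob z (u i)) d = - 2 / r * (l i * inner (mob z (u i)) d)"
      by (simp add: scaleR_conv_of_real[symmetric])
    also have "\<dots> = l i * (2 * (- inner (u i - z) d / (cmod (u i - z))\<^sup>2) - (- 2 * inner z d / r))"
    proof -
      have alg: "- 2 / r * (x * (r / n * P - Q)) = x * (2 * (- P / n) - (- 2 * Q / r))" for x n P Q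
        using r by (cases "n = 0") (simp_all add: field_simps)
      have "inner (mob z (u i)) d = r / (cmod (u i - z))\<^sup>2 * inner (u i - z) d - inner z d"
        by (subst m) (simp only: inner_diff_left[of "(r / (cmod (u i - z))\<^sup>2) *\<^sub>R (u i - z)" z] inner_scaleR_left)
      then show ?thesis by (simp only: alg)
    qed
    finally show ?thesis by simp
  qed
  ultimately show ?thesis
    unfolding r_def[symmetric] by (simp add: inner_sum_left sum_distrib_left)
qed

text \<open>The radius depends only on \<open>N\<close>, \<open>\<delta>\<close>, \<open>c\<close>
  and \<open>M\<close>. Solutions for varying directions and lengths thus stay in one compact disc,
  which later turns uniqueness into continuity.\<close>

lemma mob_closing_exists:
  fixes N :: nat and M :: real
  assumes N: "0 < N" and pos: "0 < \<delta>" "\<delta> \<le> 2" "0 < c"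
  shows "\<exists>\<rho>. 0 \<le> \<rho> \<and> \<rho> < 1 \<and> (\<forall>u l. (\<forall>i<N. cmod (u i) = 1 \<and> 0 < l i \<and> c \<le> (\<Sum>i<N. l i) - 2 * l i) \<longrightarrow>
     (\<forall>i<N. \<forall>j<N. i \<noteq> j \<longrightarrow> \<delta> \<le> cmod (u i - u j)) \<longrightarrow> (\<Sum>i<N. l i) \<le> M \<longrightarrow>
     (\<exists>z\<in>cball 0 \<rho>. (\<Sum>i<N. of_real (l i) * mob z (u i)) = 0))"
proof -
  define B where "B = M * (ln 2 - 2 * ln (\<delta> / 2))"
  \<comment> \<open>Chosen so that beyond this radius the lower bound of \<open>pot_far\<close> is
    positive, whereas the potential is 0 at the centre; the minimum over the smaller disc is then a
    minimum over the open unit disc.\<close>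
  define \<rho> where "\<rho> = 1 - exp (- (\<bar>B\<bar> + 1) / c)"
  have e: "- (\<bar>B\<bar> + 1) / c \<le> 0" using pos by (simp add: divide_nonpos_pos)
  have \<rho>: "0 \<le> \<rho>" "\<rho> < 1" using e by (auto simp: \<rho>_def)
  have "\<exists>z\<in>cball 0 \<rho>. (\<Sum>i<N. of_real (l i) * mob z (u i)) = 0"
    if ul: "\<forall>i<N. cmod (u i) = 1 \<and> 0 < l i \<and> c \<le> (\<Sum>i<N. l i) - 2 * l i"
      and sep: "\<forall>i<N. \<forall>j<N. i \<noteq> j \<longrightarrow> \<delta> \<le> cmod (u i - u j)" and M: "(\<Sum>i<N. l i) \<le> M" for u :: "nat \<Rightarrow> complex" and l
  proof -
    have u: "\<And>i. i < N \<Longrightarrow> cmod (u i) = 1" using ul by auto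
    have far: "0 < pot N u l z" if z: "\<rho> < cmod z" "cmod z < 1" for z
    proof -
      have "1 - cmod z < exp (- (\<bar>B\<bar> + 1) / c)" using z by (simp add: \<rho>_def)
      then have "ln (1 - cmod z) < - (\<bar>B\<bar> + 1) / c" using z by (metis diff_gt_0_iff_gt exp_less_cancel_iff exp_ln)
      then have "c * ln (1 - cmod z) < - (\<bar>B\<bar> + 1)" using pos by (simp add: field_simps)
      moreover have "- c * ln (1 - cmod z) - B \<le> pot N u l z"
        unfolding B_def by (rule pot_far) (use ul sep M pos z N in auto)
      ultimately show ?thesis by linarith
    qed
    have "continuous_on (cball 0 \<rho>) (pot N u l)"
      unfolding pot_def[abs_def]
    proof (intro continuous_intros ballI)
      fix i :: nat and z :: complex assume i: "i \<in> {..<N}" and z: "z \<in> cball 0 \<rho>"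
      show "cmod (u i - z) \<noteq> 0" using u[of i] i z \<rho> by auto
      have "cmod z < 1" using z \<rho> by simp
      then show "1 - (cmod z)\<^sup>2 \<noteq> 0" using abs_square_less_1[of "cmod z"] by simp
    qed
    then obtain z where z: "z \<in> cball 0 \<rho>" "\<And>y. y \<in> cball 0 \<rho> \<Longrightarrow> pot N u l z \<le> pot N u l y"
      using continuous_attains_inf[of "cball 0 \<rho>" "pot N u l"] \<rho> by auto
    have "pot N u l 0 = 0" using u by (simp add: pot_def)
    then have "pot N u l z \<le> 0" using z(2)[of 0] \<rho> by simp
    then have min: "pot N u l z \<le> pot N u l y" if "cmod y < 1" for y
      using far[of y] z(2)[of y] that by (cases "cmod y \<le> \<rho>") auto
    have z1: "cmod z < 1" using z \<rho> by simp
    define S where "S = (\<Sum>i<N. of_real (l i) * mob z (u i))"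
    have "inner S d = 0" for d
    proof -
      have D: "((\<lambda>t. pot N u l (z + t *\<^sub>R d)) has_real_derivative - 2 / (1 - (cmod z)\<^sup>2) * inner S d) (at 0)"
        unfolding S_def by (rule pot_DERIV[OF u z1])
      have "- 2 / (1 - (cmod z)\<^sup>2) * inner S d = 0"
      proof (rule DERIV_local_min[OF D])
        show "0 < (1 - cmod z) / (1 + cmod d)" using z1 by (simp add: add_pos_nonneg)
        show "\<forall>t. \<bar>0 - t\<bar> < (1 - cmod z) / (1 + cmod d) \<longrightarrow> pot N u l (z + 0 *\<^sub>R d) \<le> pot N u l (z + t *\<^sub>R d)"
        proof (intro allI impI)
          fix t assume "\<bar>0 - t\<bar> < (1 - cmod z) / (1 + cmod d)"
          then have "\<bar>t\<bar> * (1 + cmod d) < 1 - cmod z" by (simp add: pos_less_divide_eq add_pos_nonneg)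
          moreover have "\<bar>t\<bar> * cmod d \<le> \<bar>t\<bar> * (1 + cmod d)" by (intro mult_left_mono) auto
          moreover have "cmod (z + t *\<^sub>R d) \<le> cmod z + \<bar>t\<bar> * cmod d"
            using norm_triangle_ineq[of z "t *\<^sub>R d"] by simp
          ultimately have "cmod (z + t *\<^sub>R d) < 1" by linarith
          then show "pot N u l (z + 0 *\<^sub>R d) \<le> pot N u l (z + t *\<^sub>R d)" using min by simp
        qed
      qed
      moreover have "1 - (cmod z)\<^sup>2 > 0" using z1 by (simp add: abs_square_less_1)
      ultimately show ?thesis by simp
    qed
    then have "S = 0" by (metis inner_eq_zero_iff)
    then show ?thesis using z(1) by (auto simp: S_def)
  qed
  then show ?thesis using \<rho> by blast
qed

section \<open>Cyclic order of directions\<close>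

definition K3 :: "complex \<Rightarrow> complex \<Rightarrow> complex \<Rightarrow> real" where
  "K3 a b c = - Im ((a - b) * (b - c) * (c - a) / (a * b * c))"

lemma cis_diff: "cis \<alpha> - cis \<beta> = 2 * \<i> * of_real (sin ((\<alpha> - \<beta>) / 2)) * cis ((\<alpha> + \<beta>) / 2)"
proof -
  have "\<alpha> = (\<alpha> + \<beta>) / 2 + (\<alpha> - \<beta>) / 2" "\<beta> = (\<alpha> + \<beta>) / 2 - (\<alpha> - \<beta>) / 2" by (simp_all add: field_simps)
  then have "cis \<alpha> = cis ((\<alpha> + \<beta>) / 2) * cis ((\<alpha> - \<beta>) / 2)" "cis \<beta> = cis ((\<alpha> + \<beta>) / 2) * cnj (cis ((\<alpha> - \<beta>) / 2))"
    by (metis cis_mult) (metis cis_mult cis_cnj diff_conv_add_uminus \<open>\<beta> = (\<alpha> + \<beta>) / 2 - (\<alpha> - \<beta>) / 2\<close>)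
  then have "cis \<alpha> - cis \<beta> = cis ((\<alpha> + \<beta>) / 2) * (cis ((\<alpha> - \<beta>) / 2) - cnj (cis ((\<alpha> - \<beta>) / 2)))"
    by (simp add: algebra_simps)
  also have "cis ((\<alpha> - \<beta>) / 2) - cnj (cis ((\<alpha> - \<beta>) / 2)) = 2 * \<i> * of_real (sin ((\<alpha> - \<beta>) / 2))"
    by (simp add: complex_eq_iff)
  finally show ?thesis by (simp add: mult_ac)
qed

text \<open>Shows what \<open>K3\<close> is for: for angles within one turn its sign is the cyclic
  orientation of the three directions, while its form as a rational expression makes the effect of
  Moebius transformations computable.\<close>

lemma K3_cis: "K3 (cis \<alpha>) (cis \<beta>) (cis \<gamma>) = 8 * sin ((\<beta> - \<alpha>) / 2) * sin ((\<gamma> - \<beta>) / 2) * sin ((\<gamma> - \<alpha>) / 2)"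
proof -
  have c: "cis ((\<alpha> + \<beta>) / 2) * cis ((\<beta> + \<gamma>) / 2) * cis ((\<gamma> + \<alpha>) / 2) = cis \<alpha> * cis \<beta> * cis \<gamma>"
    unfolding cis_mult by (rule arg_cong[where f = cis]) (simp add: field_simps)
  have "(cis \<alpha> - cis \<beta>) * (cis \<beta> - cis \<gamma>) * (cis \<gamma> - cis \<alpha>)
     = (2 * \<i>) ^ 3 * of_real (sin ((\<alpha> - \<beta>) / 2) * sin ((\<beta> - \<gamma>) / 2) * sin ((\<gamma> - \<alpha>) / 2))
        * (cis ((\<alpha> + \<beta>) / 2) * cis ((\<beta> + \<gamma>) / 2) * cis ((\<gamma> + \<alpha>) / 2))"
    unfolding cis_diff by (simp add: power3_eq_cube mult_ac)
  then have "(cis \<alpha> - cis \<beta>) * (cis \<beta> - cis \<gamma>) * (cis \<gamma> - cis \<alpha>) / (cis \<alpha> * cis \<beta> * cis \<gamma>)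
     = (2 * \<i>) ^ 3 * of_real (sin ((\<alpha> - \<beta>) / 2) * sin ((\<beta> - \<gamma>) / 2) * sin ((\<gamma> - \<alpha>) / 2))"
    unfolding c by simp
  moreover have "(2 * \<i>) ^ 3 = - (8 * \<i>)" by (simp add: power3_eq_cube)
  moreover have "sin ((\<alpha> - \<beta>) / 2) = - sin ((\<beta> - \<alpha>) / 2)" "sin ((\<beta> - \<gamma>) / 2) = - sin ((\<gamma> - \<beta>) / 2)"
    by (metis minus_diff_eq minus_divide_left sin_minus)+
  ultimately show ?thesis unfolding K3_def by simp
qed

lemma mob_diff:
  assumes "cmod z < 1" "cmod a = 1" "cmod b = 1"
  shows "mob z a - mob z b = of_real (1 - (cmod z)\<^sup>2) * (a - b) / ((1 - cnj z * a) * (1 - cnj z * b))"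
proof -
  have n: "1 - cnj z * a \<noteq> 0" "1 - cnj z * b \<noteq> 0" using mob_denom assms by auto
  have r: "of_real (1 - (cmod z)\<^sup>2) = 1 - z * cnj z" by (simp add: complex_norm_square del: of_real_power)
  have "mob z a - mob z b = ((a - z) * (1 - cnj z * b) - (b - z) * (1 - cnj z * a)) / ((1 - cnj z * a) * (1 - cnj z * b))"
    unfolding mob_def using n by (simp add: diff_frac_eq)
  also have "(a - z) * (1 - cnj z * b) - (b - z) * (1 - cnj z * a) = (1 - z * cnj z) * (a - b)"
    by (simp add: algebra_simps)
  finally show ?thesis unfolding r .
qed

lemma Im_complex_of_real_times: "Im (of_real q * x) = q * Im x"
  by simp

text \<open>The three differences and the three values produce the same complex factors
  \<open>A\<close>, \<open>B\<close>, \<open>C\<close>, which cancel up to their moduli; a positive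
  real factor remains.\<close>

lemma K3_mob:
  assumes z: "cmod z < 1" and u: "cmod a = 1" "cmod b = 1" "cmod c = 1"
  shows "\<exists>q>0. K3 (mob z a) (mob z b) (mob z c) = q * K3 a b c"
proof -
  define r where "r = 1 - (cmod z)\<^sup>2"
  have r: "0 < r" using z by (simp add: r_def abs_square_less_1)
  define A B C where "A = 1 - cnj z * a" and "B = 1 - cnj z * b" and "C = 1 - cnj z * c"
  have n: "A \<noteq> 0" "B \<noteq> 0" "C \<noteq> 0" using mob_denom(1)[OF z] u by (auto simp: A_def B_def C_def)
  have m: "A * (a - z) = a * of_real ((cmod A)\<^sup>2)" "B * (b - z) = b * of_real ((cmod B)\<^sup>2)" "C * (c - z) = c * of_real ((cmod C)\<^sup>2)"
    using mob_denom_mult[of _ z] u by (auto simp: A_def B_def C_def)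
  have d: "mob z a - mob z b = of_real r * (a - b) / (A * B)" "mob z b - mob z c = of_real r * (b - c) / (B * C)"
    "mob z c - mob z a = of_real r * (c - a) / (C * A)"
    using mob_diff[OF z] u by (auto simp: A_def B_def C_def r_def)
  have v: "mob z a = a * of_real ((cmod A)\<^sup>2) / (A * A)" "mob z b = b * of_real ((cmod B)\<^sup>2) / (B * B)" "mob z c = c * of_real ((cmod C)\<^sup>2) / (C * C)"
    unfolding m[symmetric] mob_def A_def[symmetric] B_def[symmetric] C_def[symmetric] using n by auto
  define q where "q = r ^ 3 / ((cmod A)\<^sup>2 * (cmod B)\<^sup>2 * (cmod C)\<^sup>2)"
  have ne: "a \<noteq> 0" "b \<noteq> 0" "c \<noteq> 0" using u by auto
  have "(mob z a - mob z b) * (mob z b - mob z c) * (mob z c - mob z a) / (mob z a * mob z b * mob z c)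
     = of_real q * ((a - b) * (b - c) * (c - a) / (a * b * c))"
  proof -
    have "(\<rho> * x / (A * B)) * (\<rho> * y / (B * C)) * (\<rho> * t / (C * A)) /
        ((a * na / (A * A)) * (b * nb / (B * B)) * (c * nc / (C * C))) = \<rho> ^ 3 / (na * nb * nc) * (x * y * t / (a * b * c))"
      if "na \<noteq> 0" "nb \<noteq> 0" "nc \<noteq> 0" for \<rho> x y t na nb nc
      using n ne that by (simp add: field_simps power3_eq_cube)
    from this[of "of_real ((cmod A)\<^sup>2)" "of_real ((cmod B)\<^sup>2)" "of_real ((cmod C)\<^sup>2)"
        "of_real r" "a - b" "b - c" "c - a"]
    show ?thesis unfolding d unfolding v q_def using n by simp
  qed
  then have "K3 (mob z a) (mob z b) (mob z c) = q * K3 a b c"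
    unfolding K3_def by (simp only: Im_complex_of_real_times mult_minus_right)
  moreover have "q > 0" unfolding q_def using r n by (intro divide_pos_pos mult_pos_pos) auto
  ultimately show ?thesis by blast
qed

text \<open>Counterclockwise directions within one turn, lifted to real angles: in the lifted form
  the condition is convex, so two such families can be joined by linear interpolation.\<close>

definition ordered :: "nat \<Rightarrow> (nat \<Rightarrow> real) \<Rightarrow> bool" where
  "ordered N \<theta> \<longleftrightarrow> (\<forall>i j. i < j \<longrightarrow> j < N \<longrightarrow> \<theta> i < \<theta> j) \<and> (\<forall>i<N. \<theta> i < \<theta> 0 + 2 * pi)"

lemma ordered_pair:
  assumes "ordered N \<theta>" "i < j" "j < N"
  shows "0 < (\<theta> j - \<theta> i) / 2" "(\<theta> j - \<theta> i) / 2 < pi" "0 < sin ((\<theta> j - \<theta> i) / 2)"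
proof -
  have "\<theta> 0 \<le> \<theta> i" using assms unfolding ordered_def by (cases "i = 0") (auto intro: less_imp_le)
  moreover have "\<theta> j < \<theta> 0 + 2 * pi" "\<theta> i < \<theta> j" using assms unfolding ordered_def by auto
  ultimately show "0 < (\<theta> j - \<theta> i) / 2" "(\<theta> j - \<theta> i) / 2 < pi" by auto
  then show "0 < sin ((\<theta> j - \<theta> i) / 2)" by (rule sin_gt_zero)
qed

text \<open>Measuring angles from \<open>u 0\<close> in \<open>[0, 2 pi)\<close> makes two of the
  three sines in \<open>K3_cis\<close> positive, so the third decides the order of \<open>i\<close>
  and \<open>j\<close>.\<close>

lemma ordered_of_K3:
  assumes N: "0 < N" and u: "\<And>i. i < N \<Longrightarrow> cmod (u i) = 1" and ne: "\<And>i. 0 < i \<Longrightarrow> i < N \<Longrightarrow> u i \<noteq> u 0"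
    and K: "\<And>i j. 0 < i \<Longrightarrow> i < j \<Longrightarrow> j < N \<Longrightarrow> 0 < K3 (u 0) (u i) (u j)"
  shows "\<exists>\<theta>. ordered N \<theta> \<and> (\<forall>i<N. u i = cis (\<theta> i))"
proof -
  define \<alpha> where "\<alpha> = Arg2pi (u 0)"
  have cisA: "x = cis (Arg2pi x)" if "cmod x = 1" for x
    using Arg2pi_eq[of x] that by (simp add: cis_conv_exp)
  define \<phi> where "\<phi> = (\<lambda>i. Arg2pi (u i / u 0))"
  define \<theta> where "\<theta> = (\<lambda>i. \<alpha> + \<phi> i)"
  have u0: "u 0 \<noteq> 0" "cmod (u 0) = 1" using u[OF N] by auto
  have phi0: "\<phi> 0 = 0" using u0 by (simp add: \<phi>_def Arg2pi_eq_0)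
  have eq: "u i = cis (\<theta> i)" if "i < N" for i
  proof -
    have "cmod (u i / u 0) = 1" using u[OF that] u0 by (simp add: norm_divide)
    then have "u i / u 0 = cis (\<phi> i)" unfolding \<phi>_def by (rule cisA)
    then have "u i = u 0 * cis (\<phi> i)" using u0(1) by (simp add: field_simps)
    then show ?thesis using cisA[OF u0(2)] by (simp add: \<theta>_def \<alpha>_def cis_mult[symmetric])
  qed
  have ran: "0 \<le> \<phi> i" "\<phi> i < 2 * pi" for i by (simp_all add: \<phi>_def Arg2pi_ge_0 Arg2pi_lt_2pi)
  have pos: "0 < \<phi> i" if "0 < i" "i < N" for i
  proof (rule ccontr)
    assume "\<not> 0 < \<phi> i"
    then have "\<phi> i = 0" using ran(1)[of i] by simp
    then have "u i = u 0" using eq[OF that(2)] eq[OF N] phi0 by (simp add: \<theta>_def)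
    then show False using ne that by simp
  qed
  have "\<phi> i < \<phi> j" if ij: "i < j" "j < N" for i j
  proof (cases "i = 0")
    case True
    then show ?thesis using pos[of j] ij phi0 by simp
  next
    case False
    then have "0 < K3 (cis (\<theta> 0)) (cis (\<theta> i)) (cis (\<theta> j))" using K[of i j] ij eq N by simp
    then have "0 < sin ((\<phi> i) / 2) * sin ((\<phi> j - \<phi> i) / 2) * sin (\<phi> j / 2)"
      unfolding K3_cis by (simp add: \<theta>_def phi0 mult.assoc zero_less_mult_iff)
    moreover have "0 < sin (\<phi> i / 2)" "0 < sin (\<phi> j / 2)"
      using pos[of i] pos[of j] ran(2)[of i] ran(2)[of j] False ij by (auto intro!: sin_gt_zero simp: mult.commute)
    ultimately have s: "0 < sin ((\<phi> j - \<phi> i) / 2)" by (simp add: zero_less_mult_iff)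
    show ?thesis
    proof (rule ccontr)
      assume "\<not> \<phi> i < \<phi> j"
      then have "0 \<le> (\<phi> i - \<phi> j) / 2" "(\<phi> i - \<phi> j) / 2 \<le> pi" using ran[of i] ran[of j] by auto
      then have "0 \<le> sin ((\<phi> i - \<phi> j) / 2)" by (rule sin_ge_zero)
      moreover have "sin ((\<phi> i - \<phi> j) / 2) = - sin ((\<phi> j - \<phi> i) / 2)" by (metis minus_diff_eq minus_divide_left sin_minus)
      ultimately show False using s by simp
    qed
  qed
  then have "ordered N \<theta>" unfolding ordered_def using ran phi0 by (auto simp: \<theta>_def)
  then show ?thesis using eq by blast
qed

lemma mob_ordered:
  assumes N: "0 < N" and \<theta>: "ordered N \<theta>" and z: "cmod z < 1"
  shows "\<exists>\<theta>'. ordered N \<theta>' \<and> (\<forall>i<N. mob z (cis (\<theta> i)) = cis (\<theta>' i))"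
proof (rule ordered_of_K3[OF N])
  show "cmod (mob z (cis (\<theta> i))) = 1" for i using cmod_mob[OF z] by simp
  show "mob z (cis (\<theta> i)) \<noteq> mob z (cis (\<theta> 0))" if i: "0 < i" "i < N" for i
  proof
    assume eq: "mob z (cis (\<theta> i)) = mob z (cis (\<theta> 0))"
    have "1 - (cmod z)\<^sup>2 > 0" using z by (simp add: abs_square_less_1)
    then have "of_real (1 - (cmod z)\<^sup>2) \<noteq> (0::complex)" by (metis of_real_eq_0_iff order_less_irrefl)
    moreover have "1 - cnj z * cis (\<theta> i) \<noteq> 0" "1 - cnj z * cis (\<theta> 0) \<noteq> 0" using mob_denom(1)[OF z] by auto
    moreover have "of_real (1 - (cmod z)\<^sup>2) * (cis (\<theta> i) - cis (\<theta> 0)) / ((1 - cnj z * cis (\<theta> i)) * (1 - cnj z * cis (\<theta> 0))) = 0"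
      using mob_diff[OF z, of "cis (\<theta> i)" "cis (\<theta> 0)"] eq by simp
    ultimately have "cis (\<theta> i) - cis (\<theta> 0) = 0" by (simp add: divide_eq_0_iff del: of_real_diff of_real_power)
    then have "sin ((\<theta> i - \<theta> 0) / 2) = 0" unfolding cis_diff by simp
    then show False using ordered_pair(3)[OF \<theta> i] by simp
  qed
  show "0 < K3 (mob z (cis (\<theta> 0))) (mob z (cis (\<theta> i))) (mob z (cis (\<theta> j)))" if ij: "0 < i" "i < j" "j < N" for i j
  proof -
    obtain q where q: "q > 0" "K3 (mob z (cis (\<theta> 0))) (mob z (cis (\<theta> i))) (mob z (cis (\<theta> j))) = q * K3 (cis (\<theta> 0)) (cis (\<theta> i)) (cis (\<theta> j))"
      using K3_mob[OF z, of "cis (\<theta> 0)" "cis (\<theta> i)" "cis (\<theta> j)"] by auto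
    have "0 < K3 (cis (\<theta> 0)) (cis (\<theta> i)) (cis (\<theta> j))"
      unfolding K3_cis using ordered_pair(3)[OF \<theta>] ij by (intro mult_pos_pos) auto
    then show ?thesis using q by simp
  qed
qed

section \<open>Convex polygons\<close>

lemma cr_cis: "cr (of_real a * cis \<alpha>) (of_real b * cis \<beta>) = a * b * sin (\<beta> - \<alpha>)"
  by (simp add: cr_def sin_diff algebra_simps)

text \<open>The strict polygon inequality, from projecting the closing condition to
  \<open>u k\<close>. Equality would make all other directions opposite to \<open>u k\<close>, but
  there are at least two others and they are distinct. It supplies the constant \<open>c\<close> of
  \<open>mob_closing_exists\<close>.\<close>

lemma weights_unbalanced:
  fixes N :: nat and u :: "nat \<Rightarrow> complex"
  assumes l: "\<And>i. i < N \<Longrightarrow> 0 < l i" and u: "\<And>i. i < N \<Longrightarrow> cmod (u i) = 1"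
    and inj: "inj_on u {..<N}" and N: "3 \<le> N"
    and c: "(\<Sum>i<N. of_real (l i) * u i) = 0" and k: "k < N"
  shows "0 < (\<Sum>i<N. l i) - 2 * l k"
proof -
  have one: "Re (u k * cnj (u k)) = 1" using unit_cnj[OF u[OF k]] by simp
  have "0 = Re ((\<Sum>i<N. of_real (l i) * u i) * cnj (u k))" using c by simp
  also have "\<dots> = (\<Sum>i<N. l i * Re (u i * cnj (u k)))"
    unfolding sum_distrib_right Re_sum by (intro sum.cong refl) (simp add: algebra_simps)
  also have "\<dots> = l k * Re (u k * cnj (u k)) + (\<Sum>i\<in>{..<N} - {k}. l i * Re (u i * cnj (u k)))"
    by (rule sum.remove) (use k in auto)
  finally have 1: "l k = - (\<Sum>i\<in>{..<N} - {k}. l i * Re (u i * cnj (u k)))" using one by simp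
  have 2: "(\<Sum>i<N. l i) = l k + (\<Sum>i\<in>{..<N} - {k}. l i)" by (rule sum.remove) (use k in auto)
  have eq: "(\<Sum>i<N. l i) - 2 * l k = (\<Sum>i\<in>{..<N} - {k}. l i * (1 + Re (u i * cnj (u k))))"
    using 1 2 by (simp add: distrib_left sum.distrib)
  have bd: "- 1 \<le> Re (u i * cnj (u k))" if "i < N" for i
    using abs_Re_le_cmod[of "u i * cnj (u k)"] u[OF that] u[OF k] by (simp add: norm_mult)
  have "\<exists>j\<in>{..<N} - {k}. u j \<noteq> - u k"
  proof (rule ccontr)
    assume "\<not> (\<exists>j\<in>{..<N} - {k}. u j \<noteq> - u k)"
    then have all: "u j = - u k" if "j < N" "j \<noteq> k" for j using that by auto
    have "card ({..<N} - {k}) = N - 1" using k by simp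
    moreover have "card ({..<N} - {k}) \<le> 1"
    proof (subst card_le_Suc0_iff_eq[unfolded One_nat_def[symmetric]])
      show "\<forall>a\<in>{..<N} - {k}. \<forall>b\<in>{..<N} - {k}. a = b"
        using inj all by (auto simp: inj_on_def)
    qed simp
    ultimately show False using N by simp
  qed
  then obtain j where j: "j < N" "j \<noteq> k" "u j \<noteq> - u k" by auto
  have "Re (u j * cnj (u k)) \<noteq> - 1"
  proof
    assume r: "Re (u j * cnj (u k)) = - 1"
    have "cmod (u j * cnj (u k)) = 1" using u j k by (simp add: norm_mult)
    then have "(Re (u j * cnj (u k)))\<^sup>2 + (Im (u j * cnj (u k)))\<^sup>2 = 1" using cmod_power2[of "u j * cnj (u k)"] by simp
    then have "Im (u j * cnj (u k)) = 0" unfolding r by simp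
    then have "u j * cnj (u k) = - 1" using r by (simp add: complex_eq_iff)
    then have "u j * (u k * cnj (u k)) = - u k" by (metis mult.assoc mult.commute mult_minus1)
    then show False using unit_cnj[OF u[OF k]] j by simp
  qed
  then have "0 < l j * (1 + Re (u j * cnj (u k)))" using bd[OF j(1)] l[OF j(1)] by (intro mult_pos_pos) auto
  moreover have "0 \<le> l i * (1 + Re (u i * cnj (u k)))" if "i \<in> {..<N} - {k}" for i
    using bd[of i] l[of i] that by (intro mult_nonneg_nonneg) auto
  ultimately show ?thesis
    unfolding eq using j by (intro sum_pos2[of _ j]) auto
qed

context chain begin

definition convex_at where
  "convex_at \<sigma> C \<longleftrightarrow> (\<forall>v<N. \<forall>k<N. k \<noteq> v \<longrightarrow> k \<noteq> tg v \<longrightarrow> 0 < \<sigma> * cr (C (tg v) - C v) (C k - C v))"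

definition polygon where
  "polygon u l = (\<lambda>k. if k < N then \<Sum>i<k. of_real (l i) * u i else (0::complex))"

text \<open>Side \<open>v\<close> against the diagonal to the vertex \<open>r\<close> sides further
  on gives a sum of sines of angle differences. If the last difference is below \<open>pi\<close>,
  all terms are nonnegative. Otherwise the rest of the turn has only negative terms, while the sum
  over a full turn is zero.\<close>

lemma ordered_convex:
  assumes m: "m = N" and \<theta>: "ordered N \<theta>" and l: "\<And>i. i < N \<Longrightarrow> 0 < l i"
    and c: "(\<Sum>i<N. of_real (l i) * cis (\<theta> i)) = 0"
  shows "convex_at 1 (polygon (\<lambda>i. cis (\<theta> i)) l)"
proof -
  have N3: "3 \<le> N" using size m by auto
  \<comment> \<open>The angles are continued with period \<open>N\<close>, gaining
    \<open>2 * pi\<close> per turn, so that no case distinction is needed when a range of sides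
    passes vertex 0.\<close>
  define \<theta>' where "\<theta>' = (\<lambda>i. \<theta> (i mod N) + 2 * pi * real (i div N))"
  define l' where "l' = (\<lambda>i. l (i mod N))"
  define Q where "Q = (\<lambda>n. \<Sum>i<n. of_real (l' i) * cis (\<theta>' i))"
  let ?P = "polygon (\<lambda>i. cis (\<theta> i)) l"
  have cis': "cis (\<theta>' i) = cis (\<theta> (i mod N))" for i
  proof -
    have "cis (2 * pi * real (i div N)) = 1" by (rule cis_multiple_2pi) simp
    then show ?thesis unfolding \<theta>'_def cis_mult[symmetric] by simp
  qed
  have l'pos: "0 < l' i" for i using l N3 by (simp add: l'_def)
  have mono1: "\<theta>' i < \<theta>' (Suc i)" for i
  proof (cases "Suc (i mod N) = N")
    case True
    then have "Suc i mod N = 0" "Suc i div N = Suc (i div N)" by (simp_all add: mod_Suc div_Suc)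
    moreover have "\<theta> (i mod N) < \<theta> 0 + 2 * pi" using \<theta> N3 unfolding ordered_def by simp
    ultimately show ?thesis by (simp add: \<theta>'_def algebra_simps)
  next
    case False
    then have s: "Suc i mod N = Suc (i mod N)" "Suc i div N = i div N" by (simp_all add: mod_Suc div_Suc)
    moreover have "i mod N < N" using N3 by simp
    then have "Suc (i mod N) < N" using False by linarith
    ultimately show ?thesis using \<theta> unfolding ordered_def by (simp add: \<theta>'_def)
  qed
  then have mono: "\<theta>' i < \<theta>' j" if "i < j" for i j using that by (rule lift_Suc_mono_less)
  have per: "\<theta>' (i + N) = \<theta>' i + 2 * pi" for i
    using N3 by (simp add: \<theta>'_def algebra_simps)
  have QN: "Q N = 0"
  proof -
    have "Q N = (\<Sum>i<N. of_real (l i) * cis (\<theta> i))" unfolding Q_def cis' l'_def by (intro sum.cong) auto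
    then show ?thesis using c by simp
  qed
  have Qadd: "Q (N + n) = Q N + (\<Sum>i<n. of_real (l' i) * cis (\<theta>' i))" for n
  proof -
    let ?f = "\<lambda>i. of_real (l' i) * cis (\<theta>' i)"
    have "Q (N + n) = Q N + sum ?f {N..<N + n}"
      using sum.atLeastLessThan_concat[of 0 N "N + n" ?f] by (simp add: Q_def atLeast0LessThan)
    also have "sum ?f {N..<N + n} = (\<Sum>i\<in>{0..<n}. ?f (i + N))"
      using sum.shift_bounds_nat_ivl[of ?f 0 N n] by (simp add: add.commute)
    also have "\<dots> = (\<Sum>i<n. ?f i)"
      unfolding cis' l'_def by (simp add: atLeast0LessThan)
    finally show ?thesis .
  qed
  have Qper: "Q (N + n) = Q n" for n unfolding Qadd QN by (simp add: Q_def)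
  have QP: "Q k = ?P k" if "k < N" for k
    unfolding Q_def polygon_def cis' l'_def using that by (auto intro!: sum.cong)
  have Qtg: "Q (Suc v) = ?P (tg v)" if "v < N" for v
  proof (cases "Suc v = N")
    case True
    then have "tg v = 0" using tg_last by (metis diff_Suc_1)
    then show ?thesis using True QN N3 by (simp add: polygon_def)
  next
    case False
    then have "Suc v < N" using that by simp
    then show ?thesis using QP tg_Suc by simp
  qed
  have Qdiff: "Q (v + r) - Q v = (\<Sum>i\<in>{v..<v + r}. of_real (l' i) * cis (\<theta>' i))" for v r
    using sum.atLeastLessThan_concat[of 0 v "v + r" "\<lambda>i. of_real (l' i) * cis (\<theta>' i)"]
    by (simp add: Q_def atLeast0LessThan algebra_simps)
  have H: "cr (Q (Suc v) - Q v) (Q (v + r) - Q v) = l' v * (\<Sum>i\<in>{v..<v + r}. l' i * sin (\<theta>' i - \<theta>' v))" for v r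
  proof -
    have "Q (Suc v) - Q v = of_real (l' v) * cis (\<theta>' v)" by (simp add: Q_def)
    then show ?thesis unfolding Qdiff by (simp add: cr_sum_right cr_cis sum_distrib_left mult.assoc)
  qed
  have pos: "0 < cr (Q (Suc v) - Q v) (Q (v + r) - Q v)" if r: "2 \<le> r" "r < N" for v r
  proof -
    let ?h = "\<lambda>i. l' i * sin (\<theta>' i - \<theta>' v)"
    have "0 < sum ?h {v..<v + r}"
    proof (cases "\<theta>' (v + r - 1) - \<theta>' v < pi")
      case True
      have p: "0 < ?h i" if i: "v < i" "i < v + r" for i
      proof -
        have "i < v + r - 1 \<or> i = v + r - 1" using i by linarith
        then have "\<theta>' i \<le> \<theta>' (v + r - 1)" using mono[of i "v + r - 1"] by (elim disjE) simp_all
        then have "0 < sin (\<theta>' i - \<theta>' v)" using mono[OF i(1)] True by (intro sin_gt_zero) auto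
        then show ?thesis using l'pos by simp
      qed
      show ?thesis
      proof (rule sum_pos2[of _ "Suc v"])
        show "0 < ?h (Suc v)" using p[of "Suc v"] r by simp
        show "0 \<le> ?h i" if "i \<in> {v..<v + r}" for i
          using p[of i] that by (cases "i = v") (auto intro: less_imp_le)
      qed (use r in auto)
    next
      case False
      have n: "?h i < 0" if i: "v + r \<le> i" "i < v + N" for i
      proof -
        have "\<theta>' (v + r - 1) < \<theta>' i" using mono i r by simp
        moreover have "\<theta>' i < \<theta>' v + 2 * pi" using mono[OF i(2)] per[of v] by simp
        ultimately have "sin (\<theta>' i - \<theta>' v) < 0" using False by (intro sin_lt_zero) auto
        then show ?thesis using l'pos by (simp add: mult_pos_neg)
      qed
      have "sum ?h {v..<v + N} = 0"
        using H[of v N] Qper[of v] l'pos[of v] by (simp add: add.commute)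
      moreover have "sum ?h {v..<v + N} = sum ?h {v..<v + r} + sum ?h {v + r..<v + N}"
        using r by (intro sum.atLeastLessThan_concat[symmetric]) auto
      moreover have "sum ?h {v + r..<v + N} < 0"
      proof -
        have "sum ?h {v + r..<v + N} < sum (\<lambda>_. 0) {v + r..<v + N}"
          by (rule sum_strict_mono) (use n r in auto)
        then show ?thesis by simp
      qed
      ultimately show ?thesis by linarith
    qed
    then show ?thesis unfolding H using l'pos by simp
  qed
  show ?thesis
    unfolding convex_at_def
  proof (intro allI impI)
    fix v k assume h: "v < N" "k < N" "k \<noteq> v" "k \<noteq> tg v"
    \<comment> \<open>The number of sides from \<open>v\<close> forward to \<open>k\<close>; it is
      at least 2 because \<open>k\<close> is neither \<open>v\<close> nor
      \<open>tg v\<close>.\<close>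
    define r where "r = (if v < k then k - v else k + N - v)"
    have Qr: "Q (v + r) = ?P k"
      using h QP[of k] Qper[of k] by (auto simp: r_def add.commute)
    have r: "2 \<le> r" "r < N"
    proof -
      show "r < N" using h by (auto simp: r_def)
      have "r \<noteq> 1" using h by (auto simp: r_def tg_cases split: if_splits)
      then show "2 \<le> r" using h by (auto simp: r_def)
    qed
    show "0 < 1 * cr (?P (tg v) - ?P v) (?P k - ?P v)"
      using pos[OF r, of v] h by (simp add: Qr Qtg QP)
  qed
qed

text \<open>Every side lies on a supporting line. A common point with another side is a weighted
  mean of two nonnegative heights and has height 0, so an end of positive height gets weight 0 and
  the point is the other end.\<close>

lemma convex_nt:
  assumes m: "m = N" and \<sigma>: "\<sigma> \<noteq> 0" and C: "convex_at \<sigma> C"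
  shows "nt C"
proof -
  have N3: "3 \<le> N" using size m by auto
  have tt: "tg (tg v) \<noteq> v" if "v < N" for v
    using that N3 by (auto simp: tg_cases split: if_splits)
  have pos: "0 < \<sigma> * cr (C (tg v) - C v) (C k - C v)" if "v < N" "k < N" "k \<noteq> v" "k \<noteq> tg v" for v k
    using C that unfolding convex_at_def by blast
  have neq: "C k \<noteq> C v" if "v < N" "k < N" "k \<noteq> v" for v k
  proof (cases "k = tg v")
    case False
    then show ?thesis using pos[OF that False] by auto
  next
    case True
    then have "v \<noteq> tg k" using tt that by metis
    then show ?thesis using pos[of k v] that by auto
  qed
  have "closed_segment (C e) (C (tg e)) \<inter> closed_segment (C f) (C (tg f)) \<subseteq> {C e, C (tg e)} \<inter> {C f, C (tg f)}"
    if efm: "e < m" "f < m" "e \<noteq> f" for e f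
  proof -
    have ef: "e < N" "f < N" "e \<noteq> f" using efm m by auto
    have key: "z \<in> {C f, C (tg f)}"
      if h: "z \<in> closed_segment (C e) (C (tg e))" "z \<in> closed_segment (C f) (C (tg f))" and ef: "e < N" "f < N" "e \<noteq> f" for e f z
    proof -
      let ?d = "C (tg e) - C e"
      obtain s where s: "z = C e + s *\<^sub>R (C (tg e) - C e)" using h(1) unfolding in_segment_iff by blast
      obtain t where t: "0 \<le> t" "t \<le> 1" "z = C f + t *\<^sub>R (C (tg f) - C f)" using h(2) unfolding in_segment_iff by blast
      have nn: "0 \<le> \<sigma> * cr ?d (C k - C e)" if "k < N" for k
        using pos[OF ef(1) that] by (cases "k = e \<or> k = tg e") (auto intro: less_imp_le)
      have "cr ?d (z - C e) = 0" by (simp add: s cr_scale_right)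
      moreover have "cr ?d (z - C e) = (1 - t) * cr ?d (C f - C e) + t * cr ?d (C (tg f) - C e)"
        by (simp add: t(3) cr_def algebra_simps)
      ultimately have "(1 - t) * (\<sigma> * cr ?d (C f - C e)) + t * (\<sigma> * cr ?d (C (tg f) - C e)) = 0"
        by (metis (no_types) distrib_left mult.left_commute mult_zero_right)
      moreover have "0 \<le> (1 - t) * (\<sigma> * cr ?d (C f - C e))" "0 \<le> t * (\<sigma> * cr ?d (C (tg f) - C e))"
        using t nn ef by auto
      ultimately have z: "(1 - t) * (\<sigma> * cr ?d (C f - C e)) = 0" "t * (\<sigma> * cr ?d (C (tg f) - C e)) = 0" by linarith+
      show ?thesis
      proof (cases "f = tg e")
        case True
        have "tg f \<noteq> e" using tt ef True by auto
        moreover have "tg f \<noteq> tg e" using tg_inj ef by blast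
        ultimately have "0 < \<sigma> * cr ?d (C (tg f) - C e)" using pos ef by auto
        then have "t = 0" using z(2) by (metis mult_eq_0_iff order_less_irrefl)
        then show ?thesis using t(3) by simp
      next
        case False
        then have "0 < \<sigma> * cr ?d (C f - C e)" using pos ef by auto
        then have "1 - t = 0" using z(1) by (metis mult_eq_0_iff order_less_irrefl)
        then show ?thesis using t(3) by simp
      qed
    qed
    show ?thesis using key[of _ e f] key[of _ f e] ef by blast
  qed
  moreover have "inj_on C {..<N}" using neq by (meson inj_onI lessThan_iff)
  ultimately show ?thesis unfolding nt_def by blast
qed

text \<open>Consecutive sides turn left by less than \<open>pi\<close>; what has to be excluded is
  that the directions go around more than once. Vertex 0 does this: it is on the left of all
  sides.\<close>

lemma convex_ordered:
  assumes m: "m = N" and C: "convex_at 1 C"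
  shows "\<exists>\<theta>. ordered N \<theta> \<and> (\<forall>i<N. C (tg i) - C i = of_real (cmod (C (tg i) - C i)) * cis (\<theta> i))"
proof -
  have N3: "3 \<le> N" using size m by auto
  have pos: "0 < cr (C (tg v) - C v) (C k - C v)" if "v < N" "k < N" "k \<noteq> v" "k \<noteq> tg v" for v k
    using C that unfolding convex_at_def by auto
  have nn: "0 \<le> cr (C (tg v) - C v) (C k - C v)" if "v < N" "k < N" for v k
    using pos[OF that] by (cases "k = v \<or> k = tg v") (auto intro: less_imp_le)
  have nt: "nt C" using convex_nt[OF m _ C] by simp
  define e where "e = (\<lambda>i. C (tg i) - C i)"
  define u where "u = (\<lambda>i. sgn (e i))"
  have e0: "e i \<noteq> 0" if "i < N" for i using nt_neq[OF nt, of i] that m by (auto simp: e_def)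
  have u1: "cmod (u i) = 1" if "i < N" for i using e0[OF that] by (simp add: u_def norm_sgn)
  have eu: "e i = of_real (cmod (e i)) * u i" if "i < N" for i
    using e0[OF that] by (simp add: u_def sgn_div_norm scaleR_conv_of_real)
  have u0: "cmod (u 0) = 1" "u 0 \<noteq> 0" using u1[of 0] N3 by auto
  define \<phi> where "\<phi> = (\<lambda>i. Arg2pi (u i / u 0))"
  have cisA: "x = cis (Arg2pi x)" if "cmod x = 1" for x
    using Arg2pi_eq[of x] that by (simp add: cis_conv_exp)
  have cphi: "u i / u 0 = cis (\<phi> i)" if "i < N" for i
    unfolding \<phi>_def by (rule cisA) (use u1[OF that] u0 in \<open>simp add: norm_divide\<close>)
  have up: "u i = u 0 * cis (\<phi> i)" if "i < N" for i
    unfolding cphi[OF that, symmetric] using u0 by simp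
  have ran: "0 \<le> \<phi> i" "\<phi> i < 2 * pi" for i by (simp_all add: \<phi>_def Arg2pi_ge_0 Arg2pi_lt_2pi)
  have phi0: "\<phi> 0 = 0" using u0 by (simp add: \<phi>_def Arg2pi_eq_0)
  have step: "\<phi> i < \<phi> (Suc i)" if i: "Suc i < N" for i
  proof (rule ccontr)
    \<comment> \<open>A left turn to a smaller angle means that the direction of the first side has
      been passed, with \<open>\<phi> i\<close> beyond \<open>pi\<close> and the next angle below
      \<open>pi\<close>.\<close>
    assume le: "\<not> \<phi> i < \<phi> (Suc i)"
    have ti: "tg i = Suc i" using tg_Suc[OF i] .
    let ?j = "Suc i"
    have tj: "tg ?j < N" "tg ?j \<noteq> i" "tg ?j \<noteq> ?j"
      using i N3 by (auto simp: tg_cases split: if_splits)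
    have crij: "0 < cr (e i) (e ?j)"
    proof -
      have "cr (e i) (e ?j) = cr (C (tg i) - C i) (C (tg ?j) - C i)" by (simp add: e_def ti cr_def algebra_simps)
      then show ?thesis using pos[of i "tg ?j"] i tj ti by simp
    qed
    have crp: "cr (e i) (e ?j) = cmod (e i) * cmod (e ?j) * sin (\<phi> ?j - \<phi> i)"
    proof -
      have "cr (e i) (e ?j) = cr (of_real (cmod (e i)) * cis (\<phi> i) * u 0) (of_real (cmod (e ?j)) * cis (\<phi> ?j) * u 0)"
        using eu[of i] eu[of ?j] up[of i] up[of ?j] i by (simp add: mult_ac)
      then show ?thesis unfolding cr_rotate cr_cis using u0 by simp
    qed
    have "0 < cmod (e i) * cmod (e ?j)" using e0[of i] e0[of ?j] i by simp
    then have s: "0 < sin (\<phi> ?j - \<phi> i)"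
      using zero_less_mult_pos[of "cmod (e i) * cmod (e ?j)" "sin (\<phi> ?j - \<phi> i)"] crij crp by metis
    have "pi < \<phi> i - \<phi> ?j"
    proof (rule ccontr)
      assume "\<not> pi < \<phi> i - \<phi> ?j"
      then have "0 \<le> sin (\<phi> i - \<phi> ?j)" using le by (intro sin_ge_zero) auto
      moreover have "sin (\<phi> i - \<phi> ?j) = - sin (\<phi> ?j - \<phi> i)" by (metis minus_diff_eq sin_minus)
      ultimately show False using s by simp
    qed
    then have pi: "pi < \<phi> i" "\<phi> ?j < pi" using ran[of i] ran[of ?j] by linarith+
    then have i0: "i \<noteq> 0" using phi0 pi_gt_zero by (metis less_asym)
    have si: "sin (\<phi> i) < 0" using pi ran(2)[of i] by (intro sin_lt_zero) auto
    have sj: "0 \<le> sin (\<phi> ?j)" using pi ran(1)[of ?j] by (intro sin_ge_zero) auto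
    \<comment> \<open>The way back to vertex 0, seen with the first side pointing along the real
      axis. The sides around the passage force it not to point downwards, while \<open>C ?j\<close>,
      being strictly left of the first side, forces it to.\<close>
    define d where "d = (C 0 - C ?j) / u 0"
    have cd: "C 0 - C ?j = d * u 0" using u0 by (simp add: d_def)
    have "0 \<le> cr (e i) (C 0 - C ?j)"
    proof -
      have "cr (e i) (C 0 - C ?j) = cr (C (tg i) - C i) (C 0 - C i)" by (simp add: e_def ti cr_def algebra_simps)
      then show ?thesis using nn[of i 0] i by simp
    qed
    moreover have "cr (e i) (C 0 - C ?j) = cmod (e i) * cr (cis (\<phi> i)) d"
    proof -
      have "e i = (cmod (e i) *\<^sub>R cis (\<phi> i)) * u 0" using eu[of i] up[of i] i by (simp add: scaleR_conv_of_real mult_ac)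
      then have "cr (e i) (C 0 - C ?j) = cr ((cmod (e i) *\<^sub>R cis (\<phi> i)) * u 0) (d * u 0)" using cd by simp
      then show ?thesis unfolding cr_rotate cr_scale_left using u0 by simp
    qed
    ultimately have A: "0 \<le> cr (cis (\<phi> i)) d" using e0[of i] i by (simp add: zero_le_mult_iff)
    have "0 \<le> cr (e ?j) (C 0 - C ?j)" using nn[of ?j 0] i by (simp add: e_def)
    moreover have "cr (e ?j) (C 0 - C ?j) = cmod (e ?j) * cr (cis (\<phi> ?j)) d"
    proof -
      have "e ?j = (cmod (e ?j) *\<^sub>R cis (\<phi> ?j)) * u 0" using eu[of ?j] up[of ?j] i by (simp add: scaleR_conv_of_real mult_ac)
      then have "cr (e ?j) (C 0 - C ?j) = cr ((cmod (e ?j) *\<^sub>R cis (\<phi> ?j)) * u 0) (d * u 0)" using cd by simp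
      then show ?thesis unfolding cr_rotate cr_scale_left using u0 by simp
    qed
    ultimately have B: "0 \<le> cr (cis (\<phi> ?j)) d" using e0[of ?j] i by (simp add: zero_le_mult_iff)
    \<comment> \<open>Elimination of \<open>Re d\<close> from the two side conditions.\<close>
    have "sin (\<phi> ?j - \<phi> i) * Im d = cr (cis (\<phi> i)) d * sin (\<phi> ?j) - cr (cis (\<phi> ?j)) d * sin (\<phi> i)"
      by (simp add: cr_def sin_diff algebra_simps)
    also have "\<dots> \<ge> 0"
      using mult_nonneg_nonneg[OF A sj] mult_nonneg_nonpos[OF B less_imp_le[OF si]] by linarith
    finally have "0 \<le> Im d" using s by (simp add: zero_le_mult_iff)
    moreover have "Im d < 0"
    proof -
      have "0 < cr (e 0) (C ?j - C 0)" using pos[of 0 ?j] i i0 tg_Suc[of 0] N3 by (simp add: e_def)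
      moreover have "e 0 = (cmod (e 0) *\<^sub>R 1) * u 0" using eu[of 0] N3 by (simp add: scaleR_conv_of_real)
      moreover have "C ?j - C 0 = (- d) * u 0" using cd by (simp add: algebra_simps)
      ultimately have "0 < cr ((cmod (e 0) *\<^sub>R 1) * u 0) ((- d) * u 0)" by metis
      then show ?thesis unfolding cr_rotate cr_scale_left using u0 by (simp add: cr_def zero_less_mult_iff mult_less_0_iff)
    qed
    ultimately show False by simp
  qed
  have mono: "\<phi> i < \<phi> j" if "i < j" "j < N" for i j
    using that
  proof (induction j)
    case (Suc j)
    then show ?case using step[of j] by (cases "i = j") auto
  qed simp
  have "ordered N (\<lambda>i. Arg2pi (u 0) + \<phi> i)"
    unfolding ordered_def using mono ran phi0 by auto
  moreover have "C (tg i) - C i = of_real (cmod (C (tg i) - C i)) * cis (Arg2pi (u 0) + \<phi> i)" if "i < N" for i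
    using eu[OF that] up[OF that] cisA[OF u0(1)] by (simp add: e_def cis_mult[symmetric])
  ultimately show ?thesis by blast
qed

end

lemma uniform_pos:
  fixes f :: "'i \<Rightarrow> real \<Rightarrow> real"
  assumes "finite P" "\<And>p. p \<in> P \<Longrightarrow> continuous_on {0..1} (f p)" "\<And>p s. p \<in> P \<Longrightarrow> s \<in> {0..1} \<Longrightarrow> 0 < f p s"
  shows "\<exists>\<delta>>0. \<forall>p\<in>P. \<forall>s\<in>{0..1}. \<delta> \<le> f p s"
  using assms
proof (induction P)
  case empty
  then show ?case by (intro exI[of _ 1]) auto
next
  case (insert p P)
  then obtain \<delta> where \<delta>: "\<delta> > 0" "\<forall>p\<in>P. \<forall>s\<in>{0..1}. \<delta> \<le> f p s" by auto
  obtain s0 where s0: "s0 \<in> {0..1}" "\<And>s. s \<in> {0..1} \<Longrightarrow> f p s0 \<le> f p s"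
    using continuous_attains_inf[of "{0..1::real}" "f p"] insert.prems by auto
  then show ?case
    using \<delta> insert.prems(2)[of p s0] by (intro exI[of _ "min \<delta> (f p s0)"]) (auto intro: min.coboundedI1 min.coboundedI2)
qed

lemma ordered_inj:
  assumes "ordered N \<theta>"
  shows "inj_on (\<lambda>i. cis (\<theta> i)) {..<N}"
proof (rule inj_onI, rule ccontr)
  fix i j assume h: "i \<in> {..<N}" "j \<in> {..<N}" "cis (\<theta> i) = cis (\<theta> j)" "i \<noteq> j"
  have "cis (\<theta> i) \<noteq> cis (\<theta> j)" if "i < j" "j < N" for i j
  proof
    assume "cis (\<theta> i) = cis (\<theta> j)"
    then have "cis (\<theta> j) - cis (\<theta> i) = 0" by simp
    then have "sin ((\<theta> j - \<theta> i) / 2) = 0" unfolding cis_diff by simp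
    then show False using ordered_pair(3)[OF assms that] by simp
  qed
  then show False using h by (metis lessThan_iff linorder_neqE_nat)
qed

lemma ordered_convex_combination:
  assumes "ordered N \<theta>" "ordered N \<theta>'" "0 \<le> s" "s \<le> 1"
  shows "ordered N (\<lambda>i. (1 - s) * \<theta> i + s * \<theta>' i)"
proof -
  have lt: "(1 - s) * x + s * y < (1 - s) * x' + s * y'" if "x < x'" "y < y'" for x y x' y'
  proof (cases "s = 0")
    case False
    then have "s * y < s * y'" using assms that by simp
    moreover have "(1 - s) * x \<le> (1 - s) * x'" using assms that by (intro mult_left_mono) auto
    ultimately show ?thesis by linarith
  qed (use that in simp)
  have "(1 - s) * \<theta> i + s * \<theta>' i < (1 - s) * \<theta> 0 + s * \<theta>' 0 + 2 * pi" if "i < N" for i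
  proof -
    have "(1 - s) * \<theta> i + s * \<theta>' i < (1 - s) * (\<theta> 0 + 2 * pi) + s * (\<theta>' 0 + 2 * pi)"
      using assms that unfolding ordered_def by (intro lt) auto
    then show ?thesis by (simp add: algebra_simps)
  qed
  then show ?thesis using assms lt unfolding ordered_def by auto
qed

context chain begin

lemma polygon_edge:
  assumes m: "m = N" and c: "(\<Sum>i<N. of_real (l i) * u i) = 0" and v: "v < N"
  shows "polygon u l (tg v) - polygon u l v = of_real (l v) * u v"
proof (cases "Suc v < N")
  case True
  then show ?thesis using v by (simp add: polygon_def tg_Suc)
next
  case False
  then have v: "Suc v = N" using v by simp
  then have "tg v = 0" using tg_last by (metis diff_Suc_1)
  moreover have "(\<Sum>i<v. of_real (l i) * u i) + of_real (l v) * u v = 0" using c unfolding v[symmetric] by simp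
  then have "of_real (l v) * u v = - (\<Sum>i<v. of_real (l i) * u i)" by (simp add: add_eq_0_iff)
  ultimately show ?thesis using v N by (simp add: polygon_def)
qed

lemma polygon_eq:
  assumes m: "m = N" and C0: "C 0 = 0" "\<And>v. v \<ge> N \<Longrightarrow> C v = 0"
    and e: "\<And>i. i < N \<Longrightarrow> C (tg i) - C i = of_real (l i) * u i"
  shows "C = polygon u l" "(\<Sum>i<N. of_real (l i) * u i) = 0"
proof -
  have P: "C v = (\<Sum>i<v. of_real (l i) * u i)" if "v < N" for v
    using that
  proof (induction v)
    case (Suc v)
    have "C (Suc v) = C v + of_real (l v) * u v" using e[of v] Suc.prems by (simp add: tg_Suc algebra_simps)
    then show ?case using Suc by simp
  qed (use C0 in simp)
  then show "C = polygon u l" using C0 by (auto simp: polygon_def)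
  have "(\<Sum>i<N. of_real (l i) * u i) = (\<Sum>i<N - 1. of_real (l i) * u i) + of_real (l (N - 1)) * u (N - 1)"
    using N sum.lessThan_Suc[of "\<lambda>i. of_real (l i) * u i" "N - 1"] by simp
  also have "\<dots> = C (N - 1) + (C 0 - C (N - 1))" using P[of "N - 1"] e[of "N - 1"] N tg_last by simp
  finally show "(\<Sum>i<N. of_real (l i) * u i) = 0" using C0 by simp
qed

lemma polygon_confs:
  assumes m: "m = N" and \<theta>: "ordered N \<theta>" and l: "\<And>i. i < N \<Longrightarrow> 0 < l i \<and> a i < l i \<and> l i < b i"
    and c: "(\<Sum>i<N. of_real (l i) * cis (\<theta> i)) = 0"
  shows "polygon (\<lambda>i. cis (\<theta> i)) l \<in> confs a b \<and> convex_at 1 (polygon (\<lambda>i. cis (\<theta> i)) l)"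
proof -
  have cv: "convex_at 1 (polygon (\<lambda>i. cis (\<theta> i)) l)" using ordered_convex[OF m \<theta> _ c] l by blast
  have "cmod (polygon (\<lambda>i. cis (\<theta> i)) l (tg e) - polygon (\<lambda>i. cis (\<theta> i)) l e) = l e" if "e < N" for e
    unfolding polygon_edge[OF m c that] using l[OF that] by (simp add: norm_mult)
  then have "polygon (\<lambda>i. cis (\<theta> i)) l \<in> confs a b"
    unfolding confs_def using convex_nt[OF m _ cv] l m N by (auto simp: polygon_def)
  then show ?thesis using cv by simp
qed

text \<open>Angles and lengths are interpolated linearly; order, length bounds and polygon
  inequality are convex conditions and persist. The closing condition gets lost on the way and is
  restored by the unique centre \<open>Z s\<close>, which is 0 at both ends since the given polygons
  are closed.\<close>

lemma connected_ccw:
  fixes a b :: "nat \<Rightarrow> real"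
  assumes m: "m = N" and a: "\<And>e. e < N \<Longrightarrow> 0 \<le> a e"
  shows "connected {C \<in> confs a b. convex_at 1 C}"
  unfolding connected_iff_connected_component
proof (intro ballI)
  have N3: "3 \<le> N" using size m by auto
  have param: "\<exists>\<theta> l. ordered N \<theta> \<and> (\<forall>i<N. 0 < l i \<and> a i < l i \<and> l i < b i) \<and>
      (\<Sum>i<N. of_real (l i) * cis (\<theta> i)) = 0 \<and> C = polygon (\<lambda>i. cis (\<theta> i)) l"
    if C: "C \<in> confs a b" "convex_at 1 C" for C
  proof -
    obtain \<theta> where \<theta>: "ordered N \<theta>" "\<And>i. i < N \<Longrightarrow> C (tg i) - C i = of_real (cmod (C (tg i) - C i)) * cis (\<theta> i)"
      using convex_ordered[OF m C(2)] by blast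
    have "C 0 = 0" "\<And>v. v \<ge> N \<Longrightarrow> C v = 0" using C(1) by (auto simp: confs_def)
    note p = polygon_eq[OF m this \<theta>(2)]
    have "0 < cmod (C (tg i) - C i) \<and> a i < cmod (C (tg i) - C i) \<and> cmod (C (tg i) - C i) < b i" if "i < N" for i
      using C(1) a[OF that] that m unfolding confs_def by (auto intro: le_less_trans)
    then show ?thesis
      by (intro exI[of _ \<theta>] exI[of _ "\<lambda>i. cmod (C (tg i) - C i)"] conjI \<theta>(1) p allI impI) auto
  qed
  fix C0 C1 assume "C0 \<in> {C \<in> confs a b. convex_at 1 C}" "C1 \<in> {C \<in> confs a b. convex_at 1 C}"
  then obtain \<theta>0 l0 \<theta>1 l1 where
    0: "ordered N \<theta>0" "\<forall>i<N. 0 < l0 i \<and> a i < l0 i \<and> l0 i < b i" "(\<Sum>i<N. of_real (l0 i) * cis (\<theta>0 i)) = 0" "C0 = polygon (\<lambda>i. cis (\<theta>0 i)) l0"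
    and 1: "ordered N \<theta>1" "\<forall>i<N. 0 < l1 i \<and> a i < l1 i \<and> l1 i < b i" "(\<Sum>i<N. of_real (l1 i) * cis (\<theta>1 i)) = 0" "C1 = polygon (\<lambda>i. cis (\<theta>1 i)) l1"
    using param[of C0] param[of C1] by blast
  define \<theta> where "\<theta> = (\<lambda>s i. (1 - s) * \<theta>0 i + s * \<theta>1 i)"
  define l where "l = (\<lambda>s i. (1 - s) * l0 i + s * l1 i)"
  have ord: "ordered N (\<theta> s)" if "s \<in> {0..1}" for s
    unfolding \<theta>_def using ordered_convex_combination[OF 0(1) 1(1)] that by simp
  have convI: "(1 - s) * x + s * y \<in> S" if "s \<in> {0..1}" "convex S" "x \<in> S" "y \<in> S" for s x y :: real and S
    using convexD[OF that(2-4), of "1 - s" s] that(1) by simp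
  have lb: "0 < l s i \<and> a i < l s i \<and> l s i < b i" if s: "s \<in> {0..1}" and i: "i < N" for s i
  proof -
    have "l s i \<in> {max 0 (a i)<..<b i}" unfolding l_def
      by (rule convI[OF s]) (use 0(2) 1(2) i in auto)
    then show ?thesis by auto
  qed
  have un: "0 < (\<Sum>i<N. l s i) - 2 * l s k" if s: "s \<in> {0..1}" and k: "k < N" for s k
  proof -
    have "(\<Sum>i<N. l s i) - 2 * l s k = (1 - s) * ((\<Sum>i<N. l0 i) - 2 * l0 k) + s * ((\<Sum>i<N. l1 i) - 2 * l1 k)"
    proof -
      have "(\<Sum>i<N. l s i) = (1 - s) * (\<Sum>i<N. l0 i) + s * (\<Sum>i<N. l1 i)"
        unfolding l_def sum.distrib sum_distrib_left ..
      then show ?thesis by (simp add: l_def algebra_simps)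
    qed
    also have "\<dots> \<in> {0<..}"
    proof (rule convI[OF s])
      show "(\<Sum>i<N. l0 i) - 2 * l0 k \<in> {0<..}"
        using weights_unbalanced[OF _ _ ordered_inj[OF 0(1)] N3 0(3) k] 0(2) by simp
      show "(\<Sum>i<N. l1 i) - 2 * l1 k \<in> {0<..}"
        using weights_unbalanced[OF _ _ ordered_inj[OF 1(1)] N3 1(3) k] 1(2) by simp
    qed simp
    finally show ?thesis by simp
  qed
  have cont\<theta>: "continuous_on S (\<lambda>s. \<theta> s i)" and contl: "continuous_on S (\<lambda>s. l s i)" for S i
    unfolding \<theta>_def l_def by (intro continuous_intros)+
  obtain c where c: "c > 0" "\<And>k s. k < N \<Longrightarrow> s \<in> {0..1} \<Longrightarrow> c \<le> (\<Sum>i<N. l s i) - 2 * l s k"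
  proof -
    have "continuous_on {0..1} (\<lambda>s. (\<Sum>i<N. l s i) - 2 * l s k)" for k
      by (intro continuous_intros contl)
    then have "\<exists>\<delta>>0. \<forall>k\<in>{..<N}. \<forall>s\<in>{0..1}. \<delta> \<le> (\<Sum>i<N. l s i) - 2 * l s k"
      using un by (intro uniform_pos) auto
    then show thesis using that by blast
  qed
  have contc: "continuous_on S (\<lambda>s. cis (\<theta> s i))" for S i
    unfolding cis_conv_exp by (intro continuous_intros cont\<theta>)
  obtain \<delta>' where \<delta>': "\<delta>' > 0" "\<And>q s. q \<in> {(i,j)\<in>{..<N}\<times>{..<N}. i \<noteq> j} \<Longrightarrow> s \<in> {0..1} \<Longrightarrow> \<delta>' \<le> cmod (cis (\<theta> s (fst q)) - cis (\<theta> s (snd q)))"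
  proof -
    let ?Q = "{(i,j)\<in>{..<N}\<times>{..<N}. i \<noteq> j}"
    have "finite ?Q" by (rule finite_subset[of _ "{..<N}\<times>{..<N}"]) auto
    moreover have "continuous_on {0..1} (\<lambda>s. cmod (cis (\<theta> s (fst q)) - cis (\<theta> s (snd q))))" for q :: "nat \<times> nat"
      by (intro continuous_intros contc)
    moreover have "0 < cmod (cis (\<theta> s (fst q)) - cis (\<theta> s (snd q)))" if "q \<in> ?Q" "s \<in> {0..1}" for q s
      using ordered_inj[OF ord[OF that(2)]] that(1) by (auto simp: inj_on_def)
    ultimately have "\<exists>\<delta>>0. \<forall>q\<in>?Q. \<forall>s\<in>{0..1}. \<delta> \<le> cmod (cis (\<theta> s (fst q)) - cis (\<theta> s (snd q)))"
      by (rule uniform_pos)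
    then show thesis using that by blast
  qed
  \<comment> \<open>The cap at 2 is required by \<open>mob_closing_exists\<close>, whose estimates
    use that \<open>ln (\<delta> / 2)\<close> is not positive.\<close>
  define \<delta> where "\<delta> = min \<delta>' 2"
  have \<delta>: "0 < \<delta>" "\<delta> \<le> 2" "\<And>i j s. i < N \<Longrightarrow> j < N \<Longrightarrow> i \<noteq> j \<Longrightarrow> s \<in> {0..1} \<Longrightarrow> \<delta> \<le> cmod (cis (\<theta> s i) - cis (\<theta> s j))"
    using \<delta>' by (auto simp: \<delta>_def min_le_iff_disj)
  have "0 < N" using N3 by simp
  from mob_closing_exists[OF this \<delta>(1,2) c(1), of "\<Sum>i<N. b i"]
  obtain \<rho> where \<rho>: "0 \<le> \<rho>" "\<rho> < 1" and ex: "\<And>u l. (\<forall>i<N. cmod (u i) = 1 \<and> 0 < l i \<and> c \<le> (\<Sum>i<N. l i) - 2 * l i) \<Longrightarrow>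
     (\<forall>i<N. \<forall>j<N. i \<noteq> j \<longrightarrow> \<delta> \<le> cmod (u i - u j)) \<Longrightarrow> (\<Sum>i<N. l i) \<le> (\<Sum>i<N. b i) \<Longrightarrow>
     (\<exists>z\<in>cball 0 \<rho>. (\<Sum>i<N. of_real (l i) * mob z (u i)) = 0)" by blast
  let ?G = "\<lambda>s z. \<Sum>i<N. of_real (l s i) * mob z (cis (\<theta> s i))"
  have "\<exists>z\<in>cball 0 \<rho>. ?G s z = 0" if s: "s \<in> {0..1}" for s
  proof (rule ex)
    show "(\<Sum>i<N. l s i) \<le> (\<Sum>i<N. b i)" using lb[OF s] by (intro sum_mono) (auto intro: less_imp_le)
  qed (use lb[OF s] c(2) s \<delta>(3) in auto)
  then obtain Z where Z: "\<And>s. s \<in> {0..1} \<Longrightarrow> Z s \<in> cball 0 \<rho> \<and> ?G s (Z s) = 0" by metis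
  have Z1: "cmod (Z s) < 1" if "s \<in> {0..1}" for s using Z[OF that] \<rho> by simp
  have uniq: "z = Z s" if s: "s \<in> {0..1}" and z: "cmod z < 1" "?G s z = 0" for s z
  proof (rule mob_closing_unique[of "{..<N}" z "Z s" "\<lambda>i. cis (\<theta> s i)" "l s"])
    show "3 \<le> card ((\<lambda>i. cis (\<theta> s i)) ` {..<N})"
      using card_image[OF ordered_inj[OF ord[OF s]]] N3 by simp
  qed (use z Z1[OF s] Z[OF s] lb[OF s] in auto)
  \<comment> \<open>By uniqueness the graph of \<open>Z\<close> is the zero set of a continuous
    function on a compact product, hence closed; a closed graph with values in a compact set belongs
    to a continuous function.\<close>
  have contZ: "continuous_on {0..1} Z"
  proof (rule continuous_from_closed_graph[of "cball 0 \<rho>"])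
    show "Z \<in> {0..1} \<rightarrow> cball 0 \<rho>" using Z by blast
    have "(\<lambda>s. (s, Z s)) ` {0..1} = ({0..1} \<times> cball 0 \<rho>) \<inter> (\<lambda>q. ?G (fst q) (snd q)) -` {0}"
      using Z uniq \<rho> by (force simp: image_iff)
    moreover have "continuous_on ({0..1} \<times> cball 0 \<rho>) (\<lambda>q. ?G (fst q) (snd q))"
      unfolding mob_def
    proof (intro continuous_on_sum continuous_on_mult continuous_on_divide continuous_on_diff continuous_on_of_real
        continuous_on_const continuous_on_cnj continuous_on_snd continuous_on_id ballI)
      show "continuous_on ({0..1} \<times> cball 0 \<rho>) (\<lambda>q. l (fst q) i)" for i
        by (rule continuous_on_compose2[OF contl[of UNIV]]) (auto intro: continuous_intros)
      show "continuous_on ({0..1} \<times> cball 0 \<rho>) (\<lambda>q. cis (\<theta> (fst q) i))" "continuous_on ({0..1} \<times> cball 0 \<rho>) (\<lambda>q. cis (\<theta> (fst q) i))" for i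
        by (rule continuous_on_compose2[OF contc[of UNIV]]; auto intro: continuous_intros)+
      show "1 - cnj (snd q) * cis (\<theta> (fst q) i) \<noteq> 0" if "q \<in> {0..1} \<times> cball 0 \<rho>" for q i
        using mob_denom(1)[of "snd q" "cis (\<theta> (fst q) i)"] that \<rho> by auto
    qed
    ultimately show "closed ((\<lambda>s. (s, Z s)) ` {0..1})"
      using continuous_closed_preimage[of "{0..1} \<times> cball 0 \<rho>" "\<lambda>q. ?G (fst q) (snd q)" "{0}"]
      by (simp add: closed_Times)
  qed auto
  define \<Gamma> where "\<Gamma> = (\<lambda>s. polygon (\<lambda>i. mob (Z s) (cis (\<theta> s i))) (l s))"
  have cont\<Gamma>: "continuous_on {0..1} \<Gamma>"
  proof (rule continuous_on_coordinatewise_then_product)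
    fix k
    show "continuous_on {0..1} (\<lambda>s. \<Gamma> s k)"
    proof (cases "k < N")
      case True
      have "continuous_on {0..1} (\<lambda>s. \<Sum>i<k. of_real (l s i) * ((cis (\<theta> s i) - Z s) / (1 - cnj (Z s) * cis (\<theta> s i))))"
        using mob_denom(1)[OF Z1] by (intro continuous_intros contl contc contZ) auto
      then show ?thesis using True by (simp add: \<Gamma>_def polygon_def mob_def)
    qed (simp add: \<Gamma>_def polygon_def)
  qed
  have \<Gamma>in: "\<Gamma> s \<in> {C \<in> confs a b. convex_at 1 C}" if s: "s \<in> {0..1}" for s
  proof -
    obtain \<theta>' where \<theta>': "ordered N \<theta>'" "\<And>i. i < N \<Longrightarrow> mob (Z s) (cis (\<theta> s i)) = cis (\<theta>' i)"
      using mob_ordered[OF \<open>0 < N\<close> ord[OF s] Z1[OF s]] by blast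
    have "\<Gamma> s = polygon (\<lambda>i. cis (\<theta>' i)) (l s)"
      unfolding \<Gamma>_def polygon_def by (auto simp: \<theta>'(2) intro!: sum.cong)
    moreover have "(\<Sum>i<N. of_real (l s i) * cis (\<theta>' i)) = 0"
      using Z[OF s] by (simp add: \<theta>'(2))
    ultimately show ?thesis using polygon_confs[OF m \<theta>'(1) lb[OF s]] by simp
  qed
  have "Z 0 = 0" by (rule uniq[symmetric]) (use 0 in \<open>auto simp: \<theta>_def l_def\<close>)
  then have \<Gamma>0: "\<Gamma> 0 = C0" by (simp add: \<Gamma>_def 0(4) \<theta>_def l_def)
  have "Z 1 = 0" by (rule uniq[symmetric]) (use 1 in \<open>auto simp: \<theta>_def l_def\<close>)
  then have \<Gamma>1: "\<Gamma> 1 = C1" by (simp add: \<Gamma>_def 1(4) \<theta>_def l_def)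
  have "connected (\<Gamma> ` {0..1})" using cont\<Gamma> by (intro connected_continuous_image) auto
  moreover have "\<Gamma> ` {0..1} \<subseteq> {C \<in> confs a b. convex_at 1 C}" using \<Gamma>in by blast
  moreover have "C0 \<in> \<Gamma> ` {0..1}" "C1 \<in> \<Gamma> ` {0..1}"
    using \<Gamma>0 \<Gamma>1 by (force intro: image_eqI[of _ _ "0::real"] image_eqI[of _ _ "1::real"])+
  ultimately show "connected_component {C \<in> confs a b. convex_at 1 C} C0 C1"
    unfolding connected_component_def by blast
qed

lemma reflect_confs:
  assumes "C \<in> confs a b"
  shows "(\<lambda>v. cnj (C v)) \<in> confs a b"
proof -
  have seg: "closed_segment (cnj x) (cnj y) = cnj ` closed_segment x y" for x y
    by (rule closed_segment_linear_image) (rule bounded_linear.linear[OF bounded_linear_cnj])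
  have inj: "inj cnj" by (auto simp: inj_on_def)
  have "nt C" using assms by (simp add: confs_def)
  have "nt (\<lambda>v. cnj (C v))"
    unfolding nt_def
  proof (intro conjI allI impI)
    fix e f assume "e < m" "f < m" "e \<noteq> f"
    then have "closed_segment (C e) (C (tg e)) \<inter> closed_segment (C f) (C (tg f)) \<subseteq> {C e, C (tg e)} \<inter> {C f, C (tg f)}"
      using \<open>nt C\<close> unfolding nt_def by blast
    then have "cnj ` (closed_segment (C e) (C (tg e)) \<inter> closed_segment (C f) (C (tg f))) \<subseteq> cnj ` ({C e, C (tg e)} \<inter> {C f, C (tg f)})"
      by (rule image_mono)
    then show "closed_segment (cnj (C e)) (cnj (C (tg e))) \<inter> closed_segment (cnj (C f)) (cnj (C (tg f)))
        \<subseteq> {cnj (C e), cnj (C (tg e))} \<inter> {cnj (C f), cnj (C (tg f))}"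
      unfolding seg image_Int[OF inj] by simp
  next
    show "inj_on (\<lambda>v. cnj (C v)) {..<N}" using \<open>nt C\<close> unfolding nt_def inj_on_def by simp
  qed
  moreover have "cmod (cnj x - cnj y) = cmod (x - y)" for x y by (metis complex_cnj_diff complex_mod_cnj)
  ultimately show ?thesis using assms unfolding confs_def by simp
qed

lemma connected_cw:
  fixes a b :: "nat \<Rightarrow> real"
  assumes m: "m = N" and a: "\<And>e. e < N \<Longrightarrow> 0 \<le> a e"
  shows "connected {C \<in> confs a b. convex_at (-1) C}"
proof -
  let ?r = "\<lambda>C v. cnj (C v)"
  have cr: "cr (cnj x - cnj y) (cnj z - cnj w) = - cr (x - y) (z - w)" for x y z w
    by (simp add: cr_def algebra_simps)
  have cv: "convex_at \<sigma> (?r C) \<longleftrightarrow> convex_at (- \<sigma>) C" for \<sigma> C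
    unfolding convex_at_def cr by simp
  have eq: "{C \<in> confs a b. convex_at (-1) C} = ?r ` {C \<in> confs a b. convex_at 1 C}"
  proof (intro equalityI subsetI)
    fix C assume C: "C \<in> {C \<in> confs a b. convex_at (-1) C}"
    have "C = ?r (?r C)" by simp
    moreover have "?r C \<in> {C \<in> confs a b. convex_at 1 C}" using C reflect_confs cv by simp
    ultimately show "C \<in> ?r ` {C \<in> confs a b. convex_at 1 C}" by (rule image_eqI)
  qed (use reflect_confs cv in auto)
  have "continuous_on {C \<in> confs a b. convex_at 1 C} ?r"
    by (rule continuous_on_coordinatewise_then_product) (intro continuous_intros)
  then show ?thesis unfolding eq by (rule connected_continuous_image) (rule connected_ccw[OF m a])
qed

theorem closed_component_convex:
  fixes a b :: "nat \<Rightarrow> real"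
  assumes m: "m = N" and a: "\<And>e. e < m \<Longrightarrow> 0 \<le> a e" and W: "W \<in> components (confs a b)"
  shows "\<exists>C\<in>W. convex_at 1 C \<or> convex_at (-1) C"
proof -
  obtain C where C: "C \<in> W" "stressed {..<N} adj (stress {..<N} cf (kf a b) gaps C) C"
    using component_stressed[OF a W] by blast
  have nt: "nt C" using in_components_subset[OF W] C by (auto simp: confs_def)
  interpret stressed_chain N m "stress {..<N} cf (kf a b) gaps C" C
    using nt closed_not_flat[OF m nt] C(2) chain_axioms
    unfolding stressed_chain_def stressed_chain_axioms_def by simp
  show ?thesis using strictly_convex C(1) unfolding convex_at_def by auto
qed

end

section \<open>Continuity of the order function\<close>

lemma measure_lebesgue_Icc: "measure lebesgue {c..d::real} = max 0 (d - c)"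
  by (cases "c \<le> d") (simp_all add: measure_completion)

text \<open>Here \<open>\<alpha>\<close>, \<open>\<beta>\<close> are the ends of \<open>e\<^sub>2\<close> after \<open>e\<^sub>1\<close> has been moved onto \<open>{0..L}\<close>.\<close>
definition above :: "real \<Rightarrow> complex \<Rightarrow> complex \<Rightarrow> real set" where
  "above L \<alpha> \<beta> = {x \<in> {0..L}. \<exists>y. y \<ge> 0 \<and> Complex x y \<in> closed_segment \<alpha> \<beta>}"

definition below :: "real \<Rightarrow> complex \<Rightarrow> complex \<Rightarrow> real set" where
  "below L \<alpha> \<beta> = {x \<in> {0..L}. \<exists>y. - y \<ge> 0 \<and> Complex x y \<in> closed_segment \<alpha> \<beta>}"

text \<open>For \<open>p = q\<close> the value of \<open>sgn\<close> is 0 and the whole plane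
  collapses to 0; this case is never computed with and is treated by bounds on
  \<open>Ord\<close>.\<close>

definition frame :: "complex \<Rightarrow> complex \<Rightarrow> complex \<Rightarrow> complex" where
  "frame p q z = (z - p) * cnj (sgn (q - p))"

lemma frame_segment: "frame p q ` closed_segment a b = closed_segment (frame p q a) (frame p q b)"
proof -
  have "linear (\<lambda>z. z * cnj (sgn (q - p)))" by (rule bounded_linear.linear[OF bounded_linear_mult_left])
  from closed_segment_linear_image[OF this, of "a - p" "b - p"]
  have "closed_segment (frame p q a) (frame p q b) = (\<lambda>z. z * cnj (sgn (q - p))) ` closed_segment (a - p) (b - p)"
    by (simp add: frame_def)
  also have "closed_segment (a - p) (b - p) = (\<lambda>z. z - p) ` closed_segment a b"
    using closed_segment_translation[of "- p" a b] by (simp add: add.commute)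
  finally show ?thesis by (simp add: image_image frame_def)
qed

lemma Ord_eq:
  "Ord p q a b = measure lebesgue (above (cmod (q - p)) (frame p q a) (frame p q b))
     - measure lebesgue (below (cmod (q - p)) (frame p q a) (frame p q b))"
  unfolding Ord_def Let_def above_def below_def frame_segment[symmetric] by (simp add: frame_def[abs_def])

lemma below_eq: "below L \<alpha> \<beta> = above L (cnj \<alpha>) (cnj \<beta>)"
proof -
  have seg: "closed_segment (cnj \<alpha>) (cnj \<beta>) = cnj ` closed_segment \<alpha> \<beta>"
    by (rule closed_segment_linear_image) (rule bounded_linear.linear[OF bounded_linear_cnj])
  have "Complex x y \<in> cnj ` S \<longleftrightarrow> Complex x (- y) \<in> S" for x y S
  proof
    assume "Complex x (- y) \<in> S"
    then show "Complex x y \<in> cnj ` S" by (rule rev_image_eqI) (simp add: complex_eq_iff)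
  qed (auto simp: complex_eq_iff)
  then have "(\<exists>y. y \<ge> 0 \<and> Complex x y \<in> cnj ` closed_segment \<alpha> \<beta>) \<longleftrightarrow> (\<exists>y. - y \<ge> 0 \<and> Complex x y \<in> closed_segment \<alpha> \<beta>)" for x
    by (metis minus_minus)
  then show ?thesis unfolding above_def below_def seg by simp
qed

lemma compact_above: "compact (above L \<alpha> \<beta>)"
proof -
  have "above L \<alpha> \<beta> = Re ` (closed_segment \<alpha> \<beta> \<inter> {z. 0 \<le> Im z} \<inter> {z. 0 \<le> Re z} \<inter> {z. Re z \<le> L})"
    unfolding above_def by (force simp: image_iff intro: complex.collapse[symmetric])
  moreover have "compact (closed_segment \<alpha> \<beta> \<inter> {z. 0 \<le> Im z} \<inter> {z. 0 \<le> Re z} \<inter> {z. Re z \<le> L})"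
    by (intro compact_Int_closed compact_segment closed_Collect_le continuous_intros)
  ultimately show ?thesis
    using compact_continuous_image[OF continuous_on_Re[OF continuous_on_id]] by metis
qed

text \<open>\<open>lo\<close> and \<open>hi\<close> bound the overlap of the first segment with the
  projection of the second; a missing overlap shows as \<open>hi < lo\<close>.\<close>

definition lo where "lo \<alpha> \<beta> = max 0 (min (Re \<alpha>) (Re \<beta>))"
definition hi where "hi L \<alpha> \<beta> = min L (max (Re \<alpha>) (Re \<beta>))"

lemma Re_segment: "z \<in> closed_segment \<alpha> \<beta> \<Longrightarrow> min (Re \<alpha>) (Re \<beta>) \<le> Re z \<and> Re z \<le> max (Re \<alpha>) (Re \<beta>)"
proof -
  assume "z \<in> closed_segment \<alpha> \<beta>"
  then have "Re z \<in> closed_segment (Re \<alpha>) (Re \<beta>)"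
    using closed_segment_linear_image[OF bounded_linear.linear[OF bounded_linear_Re], of \<alpha> \<beta>] by auto
  then show ?thesis by (auto simp: closed_segment_eq_real_ivl split: if_splits)
qed

lemma above_subset: "above L \<alpha> \<beta> \<subseteq> {lo \<alpha> \<beta>..hi L \<alpha> \<beta>}"
proof
  fix x assume "x \<in> above L \<alpha> \<beta>"
  then obtain y where "0 \<le> x" "x \<le> L" "Complex x y \<in> closed_segment \<alpha> \<beta>" by (auto simp: above_def)
  then show "x \<in> {lo \<alpha> \<beta>..hi L \<alpha> \<beta>}" using Re_segment[of "Complex x y" \<alpha> \<beta>] by (simp add: lo_def hi_def)
qed

lemma measure_above_le: "measure lebesgue (above L \<alpha> \<beta>) \<le> max 0 (hi L \<alpha> \<beta> - lo \<alpha> \<beta>)"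
proof -
  have "measure lebesgue (above L \<alpha> \<beta>) \<le> measure lebesgue {lo \<alpha> \<beta>..hi L \<alpha> \<beta>}"
    by (rule measure_mono_fmeasurable[OF above_subset])
      (auto intro: lmeasurable_compact compact_above fmeasurableD)
  then show ?thesis by (simp add: measure_lebesgue_Icc split: if_splits)
qed

text \<open>This bound and its consequences settle continuity wherever the limit of
  \<open>Ord\<close> is 0: degenerate segments, perpendicular ones, and projections that do not
  overlap in an interval.\<close>

lemma Ord_bound:
  "\<bar>Ord p q a b\<bar> \<le> max 0 (hi (cmod (q - p)) (frame p q a) (frame p q b) - lo (frame p q a) (frame p q b))"
proof -
  let ?L = "cmod (q - p)" and ?a = "frame p q a" and ?b = "frame p q b"
  have "measure lebesgue (below ?L ?a ?b) \<le> max 0 (hi ?L ?a ?b - lo ?a ?b)"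
    unfolding below_eq using measure_above_le[of ?L "cnj ?a" "cnj ?b"] by (simp add: hi_def lo_def)
  then show ?thesis
    unfolding Ord_eq using measure_above_le[of ?L ?a ?b]
      measure_nonneg[of lebesgue "above ?L ?a ?b"] measure_nonneg[of lebesgue "below ?L ?a ?b"] by linarith
qed

lemma Ord_bound1: "\<bar>Ord p q a b\<bar> \<le> cmod (q - p)"
  by (rule order_trans[OF Ord_bound]) (auto simp: hi_def lo_def)

lemma Ord_bound2: "\<bar>Ord p q a b\<bar> \<le> \<bar>Re (frame p q a) - Re (frame p q b)\<bar>"
  by (rule order_trans[OF Ord_bound]) (auto simp: hi_def lo_def)

lemma Ord_bound3: "\<bar>Ord p q a b\<bar> \<le> cmod (a - b)"
proof -
  have "\<bar>Re (frame p q a) - Re (frame p q b)\<bar> = \<bar>Re ((a - b) * cnj (sgn (q - p)))\<bar>"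
    by (simp add: frame_def algebra_simps)
  also have "\<dots> \<le> cmod ((a - b) * cnj (sgn (q - p)))" by (rule abs_Re_le_cmod)
  also have "\<dots> \<le> cmod (a - b)" by (simp add: norm_mult norm_sgn)
  finally show ?thesis using Ord_bound2[of p q a b] by linarith
qed

text \<open>Here \<open>y\<close> and \<open>y'\<close> are the values at \<open>c\<close> and
  \<open>d\<close> of an affine function. The point is a single expression for all sign patterns
  that is continuous in \<open>y\<close> and \<open>y'\<close> away from the common zero.\<close>

lemma measure_affine_nonneg:
  fixes c d y y' :: real
  assumes cd: "c < d" and y: "y \<noteq> 0 \<or> y' \<noteq> 0"
  shows "measure lebesgue {x\<in>{c..d}. 0 \<le> y * (d - x) + y' * (x - c)}
     = (d - c) * (max 0 y + max 0 y') / (\<bar>y\<bar> + \<bar>y'\<bar>)"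
proof -
  consider "0 \<le> y" "0 \<le> y'" | "y \<le> 0" "y' \<le> 0" "\<not> (0 \<le> y \<and> 0 \<le> y')" | "y < 0" "0 < y'" | "0 < y" "y' < 0" by linarith
  then show ?thesis
  proof cases
    case 1
    then have "{x\<in>{c..d}. 0 \<le> y * (d - x) + y' * (x - c)} = {c..d}" by auto
    moreover have "y + y' \<noteq> 0" using 1 y by linarith
    ultimately show ?thesis using 1 cd by (simp add: measure_lebesgue_Icc)
  next
    case 2
    have "{x\<in>{c..d}. 0 \<le> y * (d - x) + y' * (x - c)} \<subseteq> {c, d}"
    proof
      fix x assume x: "x \<in> {x\<in>{c..d}. 0 \<le> y * (d - x) + y' * (x - c)}"
      then have "y * (d - x) \<le> 0" "y' * (x - c) \<le> 0" using 2 by (auto simp: mult_le_0_iff)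
      moreover have "0 \<le> y * (d - x) + y' * (x - c)" using x by simp
      ultimately have "y * (d - x) = 0" "y' * (x - c) = 0" by linarith+
      then show "x \<in> {c, d}" using y by auto
    qed
    then have "finite {x\<in>{c..d}. 0 \<le> y * (d - x) + y' * (x - c)}" by (rule finite_subset) simp
    then have "negligible {x\<in>{c..d}. 0 \<le> y * (d - x) + y' * (x - c)}" by (rule negligible_finite)
    then have "measure lebesgue {x\<in>{c..d}. 0 \<le> y * (d - x) + y' * (x - c)} = 0" by (rule negligible_imp_measure0)
    moreover have "max 0 y = 0" "max 0 y' = 0" using 2 by auto
    ultimately show ?thesis by simp
  next
    case 3
    define x0 where "x0 = c + (d - c) * (- y) / (y' - y)"
    have x0: "y * (d - x) + y' * (x - c) = (y' - y) * (x - x0)" for x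
      using 3 by (simp add: x0_def field_simps)
    have "(d - c) * y / (y' - y) \<le> 0" using 3 cd by (intro divide_nonpos_pos mult_nonneg_nonpos) auto
    then have "c \<le> x0" by (simp add: x0_def)
    then have "{x\<in>{c..d}. 0 \<le> y * (d - x) + y' * (x - c)} = {x0..d}"
      unfolding x0 using 3 by (auto simp: zero_le_mult_iff)
    moreover have "d - x0 = (d - c) * y' / (y' - y)" using 3 by (simp add: x0_def field_simps)
    moreover have "0 \<le> (d - c) * y' / (y' - y)" using 3 cd by simp
    ultimately show ?thesis using 3 by (simp add: measure_lebesgue_Icc)
  next
    case 4
    define x0 where "x0 = c + (d - c) * y / (y - y')"
    have x0: "y * (d - x) + y' * (x - c) = (y - y') * (x0 - x)" for x
      using 4 by (simp add: x0_def field_simps)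
    have "(d - c) * y / (y - y') \<le> d - c" using 4 cd by (simp add: field_simps)
    then have "x0 \<le> d" by (simp add: x0_def)
    then have "{x\<in>{c..d}. 0 \<le> y * (d - x) + y' * (x - c)} = {c..x0}"
      unfolding x0 using 4 by (auto simp: zero_le_mult_iff)
    moreover have "x0 - c = (d - c) * y / (y - y')" by (simp add: x0_def)
    moreover have "0 \<le> (d - c) * y / (y - y')" using 4 cd by simp
    ultimately show ?thesis using 4 by (simp add: measure_lebesgue_Icc)
  qed
qed

definition height where
  "height \<alpha> \<beta> x = Im \<alpha> + (x - Re \<alpha>) * ((Im \<beta> - Im \<alpha>) / (Re \<beta> - Re \<alpha>))"

lemma graph_segment:
  assumes "Re \<alpha> \<noteq> Re \<beta>"
  shows "Complex x y \<in> closed_segment \<alpha> \<beta> \<longleftrightarrow> min (Re \<alpha>) (Re \<beta>) \<le> x \<and> x \<le> max (Re \<alpha>) (Re \<beta>) \<and> y = height \<alpha> \<beta> x"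
proof
  assume h: "Complex x y \<in> closed_segment \<alpha> \<beta>"
  then obtain t where t: "Complex x y = (1 - t) *\<^sub>R \<alpha> + t *\<^sub>R \<beta>" by (auto simp: closed_segment_def)
  then have x: "x = (1 - t) * Re \<alpha> + t * Re \<beta>" and y: "y = (1 - t) * Im \<alpha> + t * Im \<beta>" by (auto simp: complex_eq_iff)
  have "x - Re \<alpha> = t * (Re \<beta> - Re \<alpha>)" using x by (simp add: algebra_simps)
  then have "height \<alpha> \<beta> x = Im \<alpha> + t * (Im \<beta> - Im \<alpha>)" using assms by (simp add: height_def)
  then have "y = height \<alpha> \<beta> x" using y by (simp add: algebra_simps)
  then show "min (Re \<alpha>) (Re \<beta>) \<le> x \<and> x \<le> max (Re \<alpha>) (Re \<beta>) \<and> y = height \<alpha> \<beta> x" using Re_segment[OF h] by simp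
next
  assume h: "min (Re \<alpha>) (Re \<beta>) \<le> x \<and> x \<le> max (Re \<alpha>) (Re \<beta>) \<and> y = height \<alpha> \<beta> x"
  define t where "t = (x - Re \<alpha>) / (Re \<beta> - Re \<alpha>)"
  have "0 \<le> t" "t \<le> 1" using h assms
    by (cases "Re \<alpha> < Re \<beta>"; auto simp: t_def divide_simps)+
  moreover have "t * (Re \<beta> - Re \<alpha>) = x - Re \<alpha>" using assms by (simp add: t_def)
  then have "x = (1 - t) * Re \<alpha> + t * Re \<beta>" by (simp add: algebra_simps)
  moreover have "height \<alpha> \<beta> x = Im \<alpha> + t * (Im \<beta> - Im \<alpha>)" by (simp add: height_def t_def)
  then have "y = (1 - t) * Im \<alpha> + t * Im \<beta>" using h by (simp add: algebra_simps)
  ultimately show "Complex x y \<in> closed_segment \<alpha> \<beta>"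
    unfolding closed_segment_def by (intro CollectI exI[of _ t]) (simp add: complex_eq_iff)
qed

lemma height_affine:
  assumes "c \<noteq> d"
  shows "height \<alpha> \<beta> x = (height \<alpha> \<beta> c * (d - x) + height \<alpha> \<beta> d * (x - c)) / (d - c)"
proof -
  define k where "k = (Im \<beta> - Im \<alpha>) / (Re \<beta> - Re \<alpha>)"
  show ?thesis using assms unfolding height_def k_def[symmetric] by (simp add: field_simps)
qed

lemma measure_above:
  assumes "Re \<alpha> \<noteq> Re \<beta>" "lo \<alpha> \<beta> < hi L \<alpha> \<beta>" "height \<alpha> \<beta> (lo \<alpha> \<beta>) \<noteq> 0 \<or> height \<alpha> \<beta> (hi L \<alpha> \<beta>) \<noteq> 0"
  shows "measure lebesgue (above L \<alpha> \<beta>) = (hi L \<alpha> \<beta> - lo \<alpha> \<beta>) *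
     (max 0 (height \<alpha> \<beta> (lo \<alpha> \<beta>)) + max 0 (height \<alpha> \<beta> (hi L \<alpha> \<beta>))) / (\<bar>height \<alpha> \<beta> (lo \<alpha> \<beta>)\<bar> + \<bar>height \<alpha> \<beta> (hi L \<alpha> \<beta>)\<bar>)"
proof -
  have "above L \<alpha> \<beta> = {x\<in>{lo \<alpha> \<beta>..hi L \<alpha> \<beta>}. 0 \<le> height \<alpha> \<beta> x}"
    unfolding above_def graph_segment[OF assms(1)] by (auto simp: lo_def hi_def)
  also have "\<dots> = {x\<in>{lo \<alpha> \<beta>..hi L \<alpha> \<beta>}. 0 \<le> height \<alpha> \<beta> (lo \<alpha> \<beta>) * (hi L \<alpha> \<beta> - x) + height \<alpha> \<beta> (hi L \<alpha> \<beta>) * (x - lo \<alpha> \<beta>)}"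
  proof (intro Collect_cong conj_cong refl)
    fix x
    have "0 \<le> N / (hi L \<alpha> \<beta> - lo \<alpha> \<beta>) \<longleftrightarrow> 0 \<le> N" for N
      using assms(2) by (simp add: zero_le_divide_iff)
    then show "0 \<le> height \<alpha> \<beta> x \<longleftrightarrow> 0 \<le> height \<alpha> \<beta> (lo \<alpha> \<beta>) * (hi L \<alpha> \<beta> - x) + height \<alpha> \<beta> (hi L \<alpha> \<beta>) * (x - lo \<alpha> \<beta>)"
      using height_affine[of "lo \<alpha> \<beta>" "hi L \<alpha> \<beta>" \<alpha> \<beta> x] assms(2) by (metis order_less_irrefl)
  qed
  finally show ?thesis using measure_affine_nonneg[OF assms(2,3)] by simp
qed

text \<open>The lower part is the upper part of the mirror image, and the difference of the positive
  parts of a height and of its negative is the height itself.\<close>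

lemma Ord_formula:
  fixes p q a b
  defines "\<alpha> \<equiv> frame p q a" and "\<beta> \<equiv> frame p q b" and "L \<equiv> cmod (q - p)"
  assumes "Re \<alpha> \<noteq> Re \<beta>" "lo \<alpha> \<beta> < hi L \<alpha> \<beta>" "height \<alpha> \<beta> (lo \<alpha> \<beta>) \<noteq> 0 \<or> height \<alpha> \<beta> (hi L \<alpha> \<beta>) \<noteq> 0"
  shows "Ord p q a b = (hi L \<alpha> \<beta> - lo \<alpha> \<beta>) * (height \<alpha> \<beta> (lo \<alpha> \<beta>) + height \<alpha> \<beta> (hi L \<alpha> \<beta>)) / (\<bar>height \<alpha> \<beta> (lo \<alpha> \<beta>)\<bar> + \<bar>height \<alpha> \<beta> (hi L \<alpha> \<beta>)\<bar>)"
proof -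
  have c: "lo (cnj \<alpha>) (cnj \<beta>) = lo \<alpha> \<beta>" "hi L (cnj \<alpha>) (cnj \<beta>) = hi L \<alpha> \<beta>" by (simp_all add: lo_def hi_def)
  have h: "height (cnj \<alpha>) (cnj \<beta>) x = - height \<alpha> \<beta> x" for x
  proof -
    have "height (cnj \<alpha>) (cnj \<beta>) x = - Im \<alpha> + (x - Re \<alpha>) * ((Im \<alpha> - Im \<beta>) / (Re \<beta> - Re \<alpha>))"
      by (simp add: height_def)
    moreover have "(Im \<alpha> - Im \<beta>) / (Re \<beta> - Re \<alpha>) = - ((Im \<beta> - Im \<alpha>) / (Re \<beta> - Re \<alpha>))"
      by (metis minus_diff_eq minus_divide_left)
    ultimately show ?thesis unfolding height_def by simp
  qed
  have "measure lebesgue (below L \<alpha> \<beta>) = (hi L \<alpha> \<beta> - lo \<alpha> \<beta>) *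
     (max 0 (- height \<alpha> \<beta> (lo \<alpha> \<beta>)) + max 0 (- height \<alpha> \<beta> (hi L \<alpha> \<beta>))) / (\<bar>height \<alpha> \<beta> (lo \<alpha> \<beta>)\<bar> + \<bar>height \<alpha> \<beta> (hi L \<alpha> \<beta>)\<bar>)"
    using measure_above[of "cnj \<alpha>" "cnj \<beta>" L] assms(4-6) unfolding below_eq c h by simp
  moreover have "max 0 x - max 0 (- x) = x" for x :: real by auto
  ultimately show ?thesis
    unfolding Ord_eq \<alpha>_def[symmetric] \<beta>_def[symmetric] L_def[symmetric] measure_above[OF assms(4-6)]
    by (simp add: diff_divide_distrib[symmetric] right_diff_distrib[symmetric]) (smt (verit))
qed

lemma Ord_self: "Ord p q p q = 0"
proof -
  have "Im (frame p q p) = 0" "Im (frame p q q) = 0"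
    by (simp_all add: frame_def sgn_div_norm scaleR_conv_of_real algebra_simps)
  then have "cnj (frame p q p) = frame p q p" "cnj (frame p q q) = frame p q q" by (auto simp: complex_eq_iff)
  then show ?thesis unfolding Ord_eq below_eq by simp
qed

text \<open>\<open>Ord\<close> can jump only where two segments overlap along an interval of a line.
  Degenerate cases have limit 0 and follow from the bounds; otherwise \<open>Ord_formula\<close>
  holds near the limit and is continuous there.\<close>

lemma tendsto_Ord:
  assumes lim: "(fp \<longlongrightarrow> p) F" "(fq \<longlongrightarrow> q) F" "(fa \<longlongrightarrow> a) F" "(fb \<longlongrightarrow> b) F"
    and good: "p = q \<or> a = b \<or> closed_segment p q \<inter> closed_segment a b \<subseteq> {p, q} \<inter> {a, b}"
  shows "((\<lambda>x. Ord (fp x) (fq x) (fa x) (fb x)) \<longlongrightarrow> Ord p q a b) F"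
proof -
  have null: "((\<lambda>x. Ord (fp x) (fq x) (fa x) (fb x)) \<longlongrightarrow> Ord p q a b) F"
    if "(g \<longlongrightarrow> 0) F" "\<And>x. \<bar>Ord (fp x) (fq x) (fa x) (fb x)\<bar> \<le> g x" "Ord p q a b = 0" for g
    unfolding that(3) by (rule Lim_null_comparison[OF _ that(1)]) (use that(2) in auto)
  consider "p = q" | "a = b" | "p \<noteq> q" "a \<noteq> b" by blast
  then show ?thesis
  proof cases
    case 1
    have "((\<lambda>x. cmod (fq x - fp x)) \<longlongrightarrow> cmod (q - p)) F" by (intro tendsto_intros lim)
    then show ?thesis using 1 Ord_bound1[of p q a b] by (intro null[OF _ Ord_bound1]) auto
  next
    case 2
    have "((\<lambda>x. cmod (fa x - fb x)) \<longlongrightarrow> cmod (a - b)) F" by (intro tendsto_intros lim)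
    then show ?thesis using 2 Ord_bound3[of p q a b] by (intro null[OF _ Ord_bound3]) auto
  next
    case 3
    define L where "L = cmod (q - p)"
    define \<alpha> where "\<alpha> = frame p q a"
    define \<beta> where "\<beta> = frame p q b"
    let ?\<alpha> = "\<lambda>x. frame (fp x) (fq x) (fa x)" and ?\<beta> = "\<lambda>x. frame (fp x) (fq x) (fb x)" and ?L = "\<lambda>x. cmod (fq x - fp x)"
    have lL: "(?L \<longlongrightarrow> L) F" unfolding L_def by (intro tendsto_intros lim)
    have la: "(?\<alpha> \<longlongrightarrow> \<alpha>) F" and lb: "(?\<beta> \<longlongrightarrow> \<beta>) F"
      unfolding \<alpha>_def \<beta>_def frame_def using 3 by (intro tendsto_intros lim; simp)+
    show ?thesis
    proof (cases "Re \<alpha> = Re \<beta>")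
      case True
      have "((\<lambda>x. \<bar>Re (?\<alpha> x) - Re (?\<beta> x)\<bar>) \<longlongrightarrow> \<bar>Re \<alpha> - Re \<beta>\<bar>) F" by (intro tendsto_intros la lb)
      then show ?thesis using True Ord_bound2[of p q a b] by (intro null[OF _ Ord_bound2]) (auto simp: \<alpha>_def \<beta>_def)
    next
      case ne: False
      have llo: "((\<lambda>x. lo (?\<alpha> x) (?\<beta> x)) \<longlongrightarrow> lo \<alpha> \<beta>) F" unfolding lo_def by (intro tendsto_intros la lb)
      have lhi: "((\<lambda>x. hi (?L x) (?\<alpha> x) (?\<beta> x)) \<longlongrightarrow> hi L \<alpha> \<beta>) F" unfolding hi_def by (intro tendsto_intros la lb lL)
      show ?thesis
      proof (cases "lo \<alpha> \<beta> < hi L \<alpha> \<beta>")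
        case False
        have "((\<lambda>x. max 0 (hi (?L x) (?\<alpha> x) (?\<beta> x) - lo (?\<alpha> x) (?\<beta> x))) \<longlongrightarrow> max 0 (hi L \<alpha> \<beta> - lo \<alpha> \<beta>)) F"
          by (intro tendsto_intros llo lhi)
        then show ?thesis using False Ord_bound[of p q a b]
          by (intro null[OF _ Ord_bound]) (auto simp: \<alpha>_def \<beta>_def L_def)
      next
        case lt: True
        \<comment> \<open>If both end heights vanished, the segments would share a whole interval,
          whereas \<open>good\<close> leaves finitely many common points.\<close>
        have nz: "height \<alpha> \<beta> (lo \<alpha> \<beta>) \<noteq> 0 \<or> height \<alpha> \<beta> (hi L \<alpha> \<beta>) \<noteq> 0"
        proof (rule ccontr)
          assume "\<not> ?thesis"
          then have z: "height \<alpha> \<beta> x = 0" for x using height_affine[of "lo \<alpha> \<beta>" "hi L \<alpha> \<beta>" \<alpha> \<beta> x] lt by simp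
          have inj: "inj (frame p q)" using 3 by (auto simp: inj_on_def frame_def sgn_zero_iff)
          have ends: "frame p q p = 0" "frame p q q = of_real L"
          proof -
            have "(q - p) * cnj (sgn (q - p)) = of_real (cmod (q - p))"
            proof -
              have "(q - p) * cnj (sgn (q - p)) = of_real (cmod (q - p)) * (sgn (q - p) * cnj (sgn (q - p)))"
                using 3 by (simp add: sgn_div_norm scaleR_conv_of_real)
              also have "sgn (q - p) * cnj (sgn (q - p)) = 1" using 3 by (simp add: complex_norm_square[symmetric] norm_sgn)
              finally show ?thesis by simp
            qed
            then show "frame p q q = of_real L" by (simp add: frame_def L_def)
          qed (simp add: frame_def)
          have "(\<lambda>x. Complex x 0) ` {lo \<alpha> \<beta>..hi L \<alpha> \<beta>} \<subseteq> frame p q ` (closed_segment p q \<inter> closed_segment a b)"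
          proof
            fix w assume "w \<in> (\<lambda>x. Complex x 0) ` {lo \<alpha> \<beta>..hi L \<alpha> \<beta>}"
            then obtain x where x: "lo \<alpha> \<beta> \<le> x" "x \<le> hi L \<alpha> \<beta>" "w = Complex x 0" by auto
            have "w \<in> closed_segment \<alpha> \<beta>" unfolding x(3) graph_segment[OF ne] z using x by (auto simp: lo_def hi_def)
            then have 1: "w \<in> frame p q ` closed_segment a b" unfolding frame_segment \<alpha>_def \<beta>_def .
            have "0 \<le> x" "x \<le> L" using x by (auto simp: lo_def hi_def)
            then have "w \<in> closed_segment 0 (of_real L)"
              unfolding closed_segment_def x(3) using 3 by (intro CollectI exI[of _ "x / L"]) (auto simp: complex_eq_iff L_def)
            then have 2: "w \<in> frame p q ` closed_segment p q" unfolding frame_segment ends .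
            show "w \<in> frame p q ` (closed_segment p q \<inter> closed_segment a b)" using 1 2 image_Int[OF inj] by blast
          qed
          moreover have "finite (frame p q ` (closed_segment p q \<inter> closed_segment a b))"
            using good 3 by (intro finite_imageI) (auto intro: finite_subset)
          ultimately have "finite ((\<lambda>x. Complex x 0) ` {lo \<alpha> \<beta>..hi L \<alpha> \<beta>})" by (rule finite_subset)
          then have "finite {lo \<alpha> \<beta>..hi L \<alpha> \<beta>}" by (rule finite_imageD) (auto simp: inj_on_def)
          then show False using lt infinite_Icc by blast
        qed
        let ?y = "\<lambda>x. height (?\<alpha> x) (?\<beta> x) (lo (?\<alpha> x) (?\<beta> x))" and ?y' = "\<lambda>x. height (?\<alpha> x) (?\<beta> x) (hi (?L x) (?\<alpha> x) (?\<beta> x))"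
        let ?yl = "height \<alpha> \<beta> (lo \<alpha> \<beta>)" and ?yr = "height \<alpha> \<beta> (hi L \<alpha> \<beta>)"
        have ly: "(?y \<longlongrightarrow> ?yl) F" "(?y' \<longlongrightarrow> ?yr) F"
          unfolding height_def using ne by (intro tendsto_intros la lb llo lhi; simp)+
        have pos: "0 < \<bar>?yl\<bar> + \<bar>?yr\<bar>" using nz by auto
        have "((\<lambda>x. (hi (?L x) (?\<alpha> x) (?\<beta> x) - lo (?\<alpha> x) (?\<beta> x)) * (?y x + ?y' x) / (\<bar>?y x\<bar> + \<bar>?y' x\<bar>)) \<longlongrightarrow>
           (hi L \<alpha> \<beta> - lo \<alpha> \<beta>) * (?yl + ?yr) / (\<bar>?yl\<bar> + \<bar>?yr\<bar>)) F"
          using pos by (intro tendsto_intros ly llo lhi) auto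
        moreover have "\<forall>\<^sub>F x in F. Ord (fp x) (fq x) (fa x) (fb x) =
            (hi (?L x) (?\<alpha> x) (?\<beta> x) - lo (?\<alpha> x) (?\<beta> x)) * (?y x + ?y' x) / (\<bar>?y x\<bar> + \<bar>?y' x\<bar>)"
        proof -
          have "\<forall>\<^sub>F x in F. 0 < hi (?L x) (?\<alpha> x) (?\<beta> x) - lo (?\<alpha> x) (?\<beta> x)"
            by (rule order_tendstoD(1)[OF tendsto_diff[OF lhi llo]]) (use lt in simp)
          moreover have "\<forall>\<^sub>F x in F. 0 < \<bar>?y x\<bar> + \<bar>?y' x\<bar>"
            by (rule order_tendstoD(1)[OF tendsto_add[OF tendsto_rabs[OF ly(1)] tendsto_rabs[OF ly(2)]] pos])
          moreover have "\<forall>\<^sub>F x in F. 0 < \<bar>Re (?\<alpha> x) - Re (?\<beta> x)\<bar>"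
            by (rule order_tendstoD(1)[OF tendsto_rabs[OF tendsto_diff[OF tendsto_Re[OF la] tendsto_Re[OF lb]]]]) (use ne in simp)
          ultimately show ?thesis
          proof eventually_elim
            case (elim x)
            show ?case by (rule Ord_formula) (use elim in auto)
          qed
        qed
        moreover have "Ord p q a b = (hi L \<alpha> \<beta> - lo \<alpha> \<beta>) * (?yl + ?yr) / (\<bar>?yl\<bar> + \<bar>?yr\<bar>)"
          unfolding \<alpha>_def \<beta>_def L_def by (rule Ord_formula) (use ne lt nz in \<open>auto simp: \<alpha>_def \<beta>_def L_def\<close>)
        ultimately show ?thesis by (simp add: tendsto_cong)
      qed
    qed
  qed
qed

section \<open>Bars of length zero\<close>

lemma path_start_closure:
  fixes f :: "real \<Rightarrow> 'a::topological_space"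
  assumes f: "continuous_on UNIV f" and S: "\<And>t. 0 < t \<Longrightarrow> t < 1 \<Longrightarrow> f t \<in> S"
  shows "f 0 \<in> closure S"
proof -
  have "f ` closure {0<..<1} \<subseteq> closure S"
  proof (rule image_closure_subset)
    show "f ` {0<..<1} \<subseteq> closure S" using S closure_subset[of S] by auto
  qed (auto intro: continuous_on_subset[OF f])
  then show ?thesis by auto
qed

context chain begin

definition shut :: "(nat \<Rightarrow> complex) \<Rightarrow> nat \<Rightarrow> nat \<Rightarrow> bool" where "shut C = (\<lambda>x y. \<exists>e<m. C (tg e) = C e \<and> (e = x \<and> tg e = y \<or> e = y \<and> tg e = x))"

text \<open>Zero bars are read off from \<open>C\<close> itself. Vertices joined by
  \<open>shut\<close> bars coincide by definition, so only the other implication is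
  recorded.\<close>

definition weak_nt :: "(nat \<Rightarrow> complex) \<Rightarrow> bool" where
  "weak_nt C \<longleftrightarrow> (\<forall>v\<ge>N. C v = 0) \<and>
     (\<forall>e<m. \<forall>f<m. e \<noteq> f \<longrightarrow>
        closed_segment (C e) (C (tg e)) \<inter> closed_segment (C f) (C (tg f)) \<subseteq> {C e, C (tg e)} \<inter> {C f, C (tg f)}) \<and>
     (\<forall>v<N. \<forall>w<N. C v = C w \<longrightarrow> (shut C)\<^sup>*\<^sup>* v w)"

definition shut_edges :: "(nat \<Rightarrow> complex) \<Rightarrow> nat set" where "shut_edges C = {e. e < m \<and> C (tg e) = C e}"

lemma weak_nt_open:
  assumes "weak_nt C" "shut_edges C = {}"
  shows "nt C"
proof -
  have no: "\<not> shut C x y" for x y using assms(2) unfolding shut_def shut_edges_def by blast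
  have "x = y" if "(shut C)\<^sup>*\<^sup>* x y" for x y using that by (induction) (auto simp: no)
  then have "inj_on C {..<N}" using assms(1) unfolding weak_nt_def inj_on_def by auto
  then show ?thesis using assms(1) unfolding weak_nt_def nt_def by blast
qed

lemma segment_interior:
  fixes a b :: complex
  assumes "a \<noteq> b" "0 < t" "t < 1"
  defines "x \<equiv> b + t *\<^sub>R (a - b)"
  shows "closed_segment a x \<subseteq> closed_segment a b" "closed_segment x b \<subseteq> closed_segment a b"
    "closed_segment a x \<inter> closed_segment x b = {x}" "b \<notin> closed_segment a x" "a \<notin> closed_segment x b" "x \<noteq> a" "x \<noteq> b"
proof -
  have x: "x = (1 - (1 - t)) *\<^sub>R a + (1 - t) *\<^sub>R b" by (simp add: x_def algebra_simps)
  have 1: "(1 - t) \<in> {0<..<1}" using assms by auto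
  have ix: "x \<in> closed_segment a b" unfolding closed_segment_def using x assms by (intro CollectI exI[of _ "1 - t"]) auto
  show "closed_segment a x \<subseteq> closed_segment a b" "closed_segment x b \<subseteq> closed_segment a b"
    using ix by (simp_all add: subset_closed_segment)
  have d: "x - b = t *\<^sub>R (a - b)" "x - a = (1 - t) *\<^sub>R (b - a)" by (auto simp: x_def algebra_simps)
  have "t *\<^sub>R (a - b) \<noteq> 0" "(1 - t) *\<^sub>R (b - a) \<noteq> 0" using assms by auto
  then show ne: "x \<noteq> a" "x \<noteq> b" using d by auto
  show "closed_segment a x \<inter> closed_segment x b = {x}"
    using ix by (rule Int_closed_segment[OF disjI1])
  have len: "dist a b = dist a x + dist x b" using ix unfolding between_mem_segment[symmetric] between by blast
  show "b \<notin> closed_segment a x"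
  proof
    assume "b \<in> closed_segment a x"
    then have "dist a x = dist a b + dist b x" unfolding between_mem_segment[symmetric] between by blast
    then show False using len ne by (simp add: dist_commute)
  qed
  show "a \<notin> closed_segment x b"
  proof
    assume "a \<in> closed_segment x b"
    then have "dist x b = dist x a + dist a b" unfolding between_mem_segment[symmetric] between by blast
    then show False using len ne by (simp add: dist_commute)
  qed
qed

text \<open>Moving the common vertex of a zero bar and a positive bar into the positive bar splits the
  latter in two, so nothing else is touched.\<close>
lemma weak_nt_split:
  assumes C: "weak_nt C" and e: "e0 < m" "e1 < m" "C (tg e0) = C e0" "C (tg e1) \<noteq> C e1"
    and ends: "{e0, tg e0} = {v, w}" "{e1, tg e1} = {u, v}"
    and only: "\<And>f. f < m \<Longrightarrow> v \<in> {f, tg f} \<Longrightarrow> f = e0 \<or> f = e1"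
    and t: "0 < t" "t < 1"
  defines "C' \<equiv> C(v := C v + t *\<^sub>R (C u - C v))"
  shows "weak_nt C'" "shut_edges C' = shut_edges C - {e0}"
proof -
  have lt: "u < N" "v < N" "w < N"
  proof -
    have "{v, w} \<subseteq> {..<N}" "{u, v} \<subseteq> {..<N}" unfolding ends[symmetric] using e N by auto
    then show "u < N" "v < N" "w < N" by auto
  qed
  have vw: "v \<noteq> w" "u \<noteq> v" using ends tg_neq[OF e(1)] tg_neq[OF e(2)] by (auto simp: doubleton_eq_iff)
  have Cvw: "C v = C w" using ends(1) e(3) by (auto simp: doubleton_eq_iff)
  have Cuv: "C u \<noteq> C v" using ends(2) e(4) by (auto simp: doubleton_eq_iff)
  have e01: "e0 \<noteq> e1" using e by auto
  let ?x = "C' v"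
  have x: "?x = C v + t *\<^sub>R (C u - C v)" by (simp add: C'_def)
  have other: "C' z = C z" if "z \<noteq> v" for z using that by (simp add: C'_def)
  note SI = segment_interior[OF Cuv t, folded x]
  define S where "S D f = closed_segment (D f :: complex) (D (tg f))" for D f
  define B where "B D f = {D f :: complex, D (tg f)}" for D f
  have seg_ends: "S D f = closed_segment (D a) (D b)" "B D f = {D a, D b}" if "{f, tg f} = {a, b}" for D f a b
    using that by (auto simp: S_def B_def doubleton_eq_iff closed_segment_commute)
  note C0 = seg_ends[OF ends(1)] and C1 = seg_ends[OF ends(2)]
  have S0: "S C' e0 = closed_segment ?x (C v)" "B C' e0 = {?x, C v}"
    using C0[of C'] vw Cvw by (simp_all add: other)
  have S1: "S C' e1 = closed_segment (C u) ?x" "B C' e1 = {C u, ?x}"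
    using C1[of C'] vw by (simp_all add: other)
  have Sf: "S C' f = S C f" "B C' f = B C f" if "f < m" "f \<noteq> e0" "f \<noteq> e1" for f
  proof -
    have "f \<noteq> v" "tg f \<noteq> v" using only[OF that(1)] that by blast+
    then show "S C' f = S C f" "B C' f = B C f" by (simp_all add: S_def B_def other)
  qed
  have nt: "S C f \<inter> S C g \<subseteq> B C f \<inter> B C g" if "f < m" "g < m" "f \<noteq> g" for f g
    using C that unfolding weak_nt_def S_def B_def by blast
  have x01: "S C' f \<inter> S C' g \<subseteq> B C' f \<inter> B C' g" if h: "f < m" "f \<noteq> e0" "f \<noteq> e1" "g = e0 \<or> g = e1" for f g
  proof -
    have n1: "S C f \<inter> closed_segment (C u) (C v) \<subseteq> B C f \<inter> {C u, C v}"
      using nt[OF h(1) e(2) h(3)] unfolding C1 .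
    show ?thesis
    proof (cases "g = e0")
      case True
      show ?thesis unfolding True S0 Sf[OF h(1-3)] using n1 SI(2,5) by blast
    next
      case False
      then have "g = e1" using h by simp
      show ?thesis unfolding \<open>g = e1\<close> S1 Sf[OF h(1-3)] using n1 SI(1,4) by blast
    qed
  qed
  have seg: "S C' f \<inter> S C' g \<subseteq> B C' f \<inter> B C' g" if h: "f < m" "g < m" "f \<noteq> g" for f g
  proof -
    consider "f \<noteq> e0" "f \<noteq> e1" "g \<noteq> e0" "g \<noteq> e1" | "f \<noteq> e0" "f \<noteq> e1" "g = e0 \<or> g = e1"
      | "g \<noteq> e0" "g \<noteq> e1" "f = e0 \<or> f = e1" | "f = e0" "g = e1" | "f = e1" "g = e0" using h(3) by blast
    then show ?thesis
    proof cases
      case 1 then show ?thesis using nt[OF h] Sf h by simp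
    next
      case 2 then show ?thesis using x01 h by blast
    next
      case 3 then show ?thesis using x01[of g f] h by blast
    next
      case 4 then show ?thesis using SI(3) S0 S1 by auto
    next
      case 5 then show ?thesis using SI(3) S0 S1 by auto
    qed
  qed
  have sh: "C' (tg f) = C' f \<longleftrightarrow> C (tg f) = C f \<and> f \<noteq> e0" if "f < m" for f
  proof -
    consider "f = e0" | "f = e1" | "f \<noteq> e0" "f \<noteq> e1" by blast
    then show ?thesis
    proof cases
      case 1
      have "B C' e0 \<noteq> {C' e0}" unfolding S0 using SI(7) by (metis insertI1 insertI2 singletonD)
      then show ?thesis using 1 by (auto simp: B_def)
    next
      case 2
      have "B C' e1 \<noteq> {C' e1}" unfolding S1 using SI(6) by (metis insertI1 insertI2 singletonD)
      then show ?thesis using 2 e(4) by (auto simp: B_def)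
    next
      case 3
      then have "f \<noteq> v" "tg f \<noteq> v" using only[OF that] by blast+
      then show ?thesis using 3 by (simp add: other)
    qed
  qed
  then show "shut_edges C' = shut_edges C - {e0}" unfolding shut_edges_def by auto
  \<comment> \<open>Once \<open>e0\<close> is open, \<open>v\<close> leaves its cluster of
    coinciding vertices; chains of zero bars through \<open>v\<close> are rerouted to
    \<open>w\<close>, the other end of \<open>e0\<close>.\<close>
  define g where "g z = (if z = v then w else z)" for z
  have step: "(shut C')\<^sup>*\<^sup>* (g y) (g z)" if h: "shut C y z" for y z
  proof -
    obtain f where f: "f < m" "C (tg f) = C f" "f = y \<and> tg f = z \<or> f = z \<and> tg f = y"
      using h unfolding shut_def by metis
    then have fyz: "{f, tg f} = {y, z}" by auto
    show ?thesis
    proof (cases "f = e0")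
      case True
      then have "{y, z} = {v, w}" using fyz ends by simp
      then have "g y = g z" using vw by (auto simp: g_def doubleton_eq_iff)
      then show ?thesis by simp
    next
      case False
      then have "v \<notin> {f, tg f}" using only[OF f(1)] f(2) e(4) by blast
      then have "g y = y" "g z = z" using fyz by (auto simp: g_def)
      moreover have "shut C' y z" using f sh[OF f(1)] False unfolding shut_def by blast
      ultimately show ?thesis by auto
    qed
  qed
  have path: "(shut C')\<^sup>*\<^sup>* (g y) (g z)" if "(shut C)\<^sup>*\<^sup>* y z" for y z
    using that by induction (auto intro: rtranclp_trans step)
  \<comment> \<open>The new position is an interior point of the old bar \<open>e1\<close>, where no
    other vertex was.\<close>
  have xv: "C' z \<noteq> ?x" if h: "z < N" "z \<noteq> v" for z
  proof
    assume eq: "C' z = ?x"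
    then have Cz: "C z = ?x" using h other by simp
    obtain f where f: "f < m" "z = f \<or> z = tg f" using incident[OF h(1)] by blast
    then have "C z \<in> S C f" by (auto simp: S_def)
    moreover have "C z \<in> closed_segment (C u) (C v)" unfolding Cz using SI(1) by auto
    ultimately have "f \<noteq> e1 \<Longrightarrow> C z \<in> {C u, C v}" using nt[OF f(1) e(2)] unfolding C1 by blast
    then have "f = e1" using Cz SI(6,7) by auto
    then have "z \<in> {u, v}" using f ends(2) by auto
    then show False using h Cz SI(6) by auto
  qed
  have "(shut C')\<^sup>*\<^sup>* y z" if h: "y < N" "z < N" "C' y = C' z" for y z
  proof (cases "y = v \<or> z = v")
    case True
    then have "y = z" using h xv by metis
    then show ?thesis by simp
  next
    case False
    then have "C y = C z" using h other by simp
    then have "(shut C)\<^sup>*\<^sup>* y z" using C h unfolding weak_nt_def by blast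
    from path[OF this] show ?thesis using False by (simp add: g_def)
  qed
  moreover have "\<forall>z\<ge>N. C' z = 0" using C lt unfolding weak_nt_def C'_def by auto
  ultimately show "weak_nt C'" using seg unfolding weak_nt_def S_def B_def by blast
qed

definition simple_confs :: "(nat \<Rightarrow> complex) set" where "simple_confs = {C. nt C \<and> (\<forall>v\<ge>N. C v = 0)}"

lemma nt_translate:
  fixes C :: "nat \<Rightarrow> complex"
  shows "nt (\<lambda>v. if v < N then C v + c else 0) \<longleftrightarrow> nt C"
proof -
  let ?D = "\<lambda>v. if v < N then C v + c else 0"
  have i: "inj (\<lambda>z. z + c)" by (simp add: inj_on_def)
  have tr: "closed_segment (x + c) (y + c) = (\<lambda>z. z + c) ` closed_segment x y" for x y
    using closed_segment_translation[of c x y] by (simp add: add.commute)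
  have shift: "closed_segment (x + c) (y + c) \<inter> closed_segment (z + c) (w + c) \<subseteq> {x + c, y + c} \<inter> {z + c, w + c} \<longleftrightarrow>
     closed_segment x y \<inter> closed_segment z w \<subseteq> {x, y} \<inter> {z, w}" for x y z w
  proof -
    have B: "{x + c, y + c} = (\<lambda>z. z + c) ` {x, y}" for x y by simp
    show ?thesis unfolding B tr image_Int[OF i, symmetric] by (rule inj_image_subset_iff[OF i])
  qed
  have D: "?D e = C e + c" "?D (tg e) = C (tg e) + c" if "e < m" for e using that N by auto
  have "inj_on ?D {..<N} \<longleftrightarrow> inj_on C {..<N}" by (auto simp: inj_on_def)
  then show ?thesis unfolding nt_def by (simp add: D shift[simplified])
qed

text \<open>A fully collapsed chain is the limit of shrinking copies of one nontouching
  shape.\<close>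

lemma const_approx: "(\<lambda>v. if v < N then c else 0) \<in> closure simple_confs"
proof -
  have "\<exists>Q :: nat \<Rightarrow> complex. \<forall>d>0. nt (\<lambda>v. d *\<^sub>R Q v)"
  proof (cases "m = N")
    case True
    \<comment> \<open>Points of a parabola in order of their abscissa form a strictly convex
      polygon, with orientations given by explicit products.\<close>
    let ?Q = "\<lambda>k::nat. Complex (real k) ((real k)\<^sup>2)"
    have "convex_at 1 (\<lambda>v. d *\<^sub>R ?Q v)" if "0 < d" for d
      unfolding convex_at_def
    proof (intro allI impI)
      fix v k assume h: "v < N" "k < N" "k \<noteq> v" "k \<noteq> tg v"
      have pos: "0 < cr (?Q (tg v) - ?Q v) (?Q k - ?Q v)"
      proof (cases "v = N - 1")
        case True
        then have tv: "tg v = 0" using tg_last by metis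
        have "cr (?Q (tg v) - ?Q v) (?Q k - ?Q v) = real v * real k * (real v - real k)"
          unfolding tv by (simp add: cr_def power2_eq_square algebra_simps)
        moreover have "0 < k" "k < v" using h tv True by auto
        ultimately show ?thesis by simp
      next
        case False
        then have tv: "tg v = Suc v" using h by (simp add: tg_Suc)
        have "cr (?Q (tg v) - ?Q v) (?Q k - ?Q v) = (real k - real v) * (real k - real (Suc v))"
          unfolding tv by (simp add: cr_def power2_eq_square algebra_simps)
        moreover have "k < v \<or> Suc v < k" using h tv by linarith
        ultimately show ?thesis by (auto simp: zero_less_mult_iff)
      qed
      have "cr (d *\<^sub>R ?Q (tg v) - d *\<^sub>R ?Q v) (d *\<^sub>R ?Q k - d *\<^sub>R ?Q v) = d\<^sup>2 * cr (?Q (tg v) - ?Q v) (?Q k - ?Q v)"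
        by (simp add: cr_def power2_eq_square algebra_simps)
      then show "0 < 1 * cr (d *\<^sub>R ?Q (tg v) - d *\<^sub>R ?Q v) (d *\<^sub>R ?Q k - d *\<^sub>R ?Q v)" using pos that by simp
    qed
    then have "\<forall>d>0. nt (\<lambda>v. d *\<^sub>R ?Q v)" using convex_nt[OF True one_neq_zero] by blast
    then show ?thesis by (intro exI[of _ ?Q])
  next
    case False
    then have m: "m = N - 1" using size by auto
    have "nt (\<lambda>v. d *\<^sub>R straight 1 (\<lambda>_. 1) v)" if "0 < d" for d
    proof -
      have "straight 1 (\<lambda>_. d) \<in> confs (\<lambda>_. 0) (\<lambda>_. 2 * d)" using that by (intro straight_confs[OF m]) auto
      moreover have "straight 1 (\<lambda>_. d) = (\<lambda>v. d *\<^sub>R straight 1 (\<lambda>_. 1) v)"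
        by (auto simp: straight_def scaleR_conv_of_real)
      ultimately show ?thesis by (simp add: confs_def)
    qed
    then show ?thesis by (intro exI[of _ "straight 1 (\<lambda>_. 1)"] allI impI)
  qed
  then obtain Q :: "nat \<Rightarrow> complex" where "\<forall>d>0. nt (\<lambda>v. d *\<^sub>R Q v)" ..
  then have Q: "nt (\<lambda>v. d *\<^sub>R Q v)" if "0 < d" for d using that by simp
  let ?F = "\<lambda>t v. if v < N then t *\<^sub>R Q v + c else 0"
  have "continuous_on UNIV ?F"
  proof (rule continuous_on_coordinatewise_then_product)
    fix v
    show "continuous_on UNIV (\<lambda>t. ?F t v)" by (cases "v < N") (auto intro!: continuous_intros)
  qed
  moreover have "?F t \<in> simple_confs" if "0 < t" for t
    using Q[OF that] nt_translate[of "\<lambda>v. t *\<^sub>R Q v" c] unfolding simple_confs_def by simp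
  ultimately have "?F 0 \<in> closure simple_confs" by (intro path_start_closure) auto
  moreover have "?F 0 = (\<lambda>v. if v < N then c else 0)" by auto
  ultimately show ?thesis by simp
qed

text \<open>Induction on the number of zero bars. Unless all bars are zero, some zero bar is next to
  a positive one and can be opened by an arbitrarily small motion; if all are zero the chain is a
  point.\<close>

lemma weak_nt_approx: "weak_nt C \<Longrightarrow> C \<in> closure simple_confs"
proof (induction "card (shut_edges C)" arbitrary: C rule: less_induct)
  case less
  have fin: "finite (shut_edges C)" unfolding shut_edges_def by simp
  consider "shut_edges C = {}" | "shut_edges C = {..<m}" | "shut_edges C \<noteq> {}" "shut_edges C \<noteq> {..<m}" by blast
  then show ?case
  proof cases
    case 1
    then have "C \<in> simple_confs" using weak_nt_open[OF less.prems] less.prems unfolding simple_confs_def weak_nt_def by blast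
    then show ?thesis using closure_subset by blast
  next
    case 2
    have const: "C 0 = C v" if "v < N" for v
      using that
    proof (induction v)
      case (Suc v)
      have "v < m" using Suc.prems N by linarith
      then have "v \<in> shut_edges C" using 2 by simp
      then have "C (tg v) = C v" by (simp add: shut_edges_def)
      then show ?case using Suc tg_Suc[OF Suc.prems] by simp
    qed simp
    have "(\<lambda>v. if v < N then C 0 else 0) = C"
    proof (rule ext)
      fix v
      show "(if v < N then C 0 else 0) = C v"
        using const[of v] less.prems unfolding weak_nt_def by (cases "v < N") simp_all
    qed
    then show ?thesis using const_approx[of "C 0"] by (simp only:)
  next
    case 3
    \<comment> \<open>A change between zero and positive already occurs at two consecutive indices,
      so the bars meet in vertex \<open>Suc f\<close> and the closing bar of a cycle needs no
      special case.\<close>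
    have "\<exists>f. Suc f < m \<and> (f \<in> shut_edges C \<longleftrightarrow> Suc f \<notin> shut_edges C)"
    proof (rule ccontr)
      assume no: "\<nexists>f. Suc f < m \<and> (f \<in> shut_edges C \<longleftrightarrow> Suc f \<notin> shut_edges C)"
      have "f \<in> shut_edges C \<longleftrightarrow> 0 \<in> shut_edges C" if "f < m" for f
        using that by (induction f) (use no in auto)
      moreover have "shut_edges C \<subseteq> {..<m}" unfolding shut_edges_def by auto
      ultimately show False using 3 by blast
    qed
    then obtain f where f: "Suc f < m" "f \<in> shut_edges C \<longleftrightarrow> Suc f \<notin> shut_edges C" by blast
    have tgf: "tg f = Suc f" using f N by (intro tg_Suc) linarith
    have only: "g = f \<or> g = Suc f" if "g < m" "Suc f \<in> {g, tg g}" for g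
      using that tg_inj[of f g] tgf f N by auto
    have key: "C \<in> closure simple_confs"
      if h: "e0 < m" "e1 < m" "C (tg e0) = C e0" "C (tg e1) \<noteq> C e1" "{e0, tg e0} = {Suc f, w}" "{e1, tg e1} = {u, Suc f}"
        "{e0, e1} = {f, Suc f}" for e0 e1 u w
    proof -
      have o: "g = e0 \<or> g = e1" if "g < m" "Suc f \<in> {g, tg g}" for g using only[OF that] h(7) by blast
      let ?M = "\<lambda>t. C(Suc f := C (Suc f) + t *\<^sub>R (C u - C (Suc f)))"
      have "?M t \<in> closure simple_confs" if "0 < t" "t < 1" for t
      proof (rule less.hyps)
        note sp = weak_nt_split[OF less.prems h(1-6) o that]
        show "weak_nt (?M t)" by (rule sp(1))
        have "shut_edges (?M t) = shut_edges C - {e0}" by (rule sp(2))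
        moreover have "e0 \<in> shut_edges C" using h unfolding shut_edges_def by simp
        ultimately show "card (shut_edges (?M t)) < card (shut_edges C)" using card_Diff1_less[OF fin] by (simp only:)
      qed
      then have "?M 0 \<in> closure (closure simple_confs)" by (rule path_start_closure[OF continuous_on_move])
      then show ?thesis by simp
    qed
    show ?thesis
    proof (cases "f \<in> shut_edges C")
      case True
      then show ?thesis using f tgf by (intro key[of f "Suc f" f "tg (Suc f)"]) (auto simp: shut_edges_def)
    next
      case False
      then show ?thesis using f tgf by (intro key[of "Suc f" f "tg (Suc f)" f]) (auto simp: shut_edges_def)
    qed
  qed
qed

end

section \<open>Noncrossing configurations as limits\<close>

lemma Ord_translate: "Ord (p + c) (q + c) (a + c) (b + c) = Ord p q a b"
  unfolding Ord_eq frame_def by simp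

context chain begin

definition well_meeting :: "(nat \<Rightarrow> complex) \<Rightarrow> bool" where
  "well_meeting C \<longleftrightarrow> (\<forall>e<m. \<forall>f<m. e \<noteq> f \<longrightarrow>
     closed_segment (C e) (C (tg e)) \<inter> closed_segment (C f) (C (tg f)) \<subseteq> {C e, C (tg e)} \<inter> {C f, C (tg f)})"

definition ann where "ann = Annot {..<m} (\<lambda>e. e) tg"

lemma fst_ann [simp]: "fst (ann C) = C"
  by (simp add: ann_def Annot_def)

lemma snd_ann: "snd (ann C) (e, f) = (if e < m \<and> f < m then Ord (C e) (C (tg e)) (C f) (C (tg f)) else 0)"
  by (simp add: ann_def Annot_def)

text \<open>The diagonal is separate because a segment overlaps itself, which
  \<open>tendsto_Ord\<close> excludes; there \<open>Ord\<close> is constantly 0 by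
  \<open>Ord_self\<close>.\<close>

lemma continuous_ann: "continuous_on {C. well_meeting C} ann"
proof -
  have "continuous_on {C. well_meeting C} (\<lambda>C. snd (ann C) p)" for p
  proof (cases p)
    case (Pair e f)
    have coord: "((\<lambda>C. C v) \<longlongrightarrow> C v) (at C within S)" for C :: "nat \<Rightarrow> complex" and S v
      using continuous_on_coord[of UNIV v] unfolding continuous_on_def by (metis UNIV_I tendsto_within_subset subset_UNIV)
    show ?thesis
    proof (cases "e < m \<and> f < m \<and> e \<noteq> f")
      case True
      have "((\<lambda>C. Ord (C e) (C (tg e)) (C f) (C (tg f))) \<longlongrightarrow> Ord (C e) (C (tg e)) (C f) (C (tg f))) (at C within {C. well_meeting C})"
        if "well_meeting C" for C
        using that True unfolding well_meeting_def by (intro tendsto_Ord coord disjI2) blast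
      then show ?thesis using True unfolding continuous_on_def Pair by (simp add: snd_ann)
    next
      case False
      then have "snd (ann C) p = 0" for C unfolding Pair snd_ann by (auto simp: Ord_self)
      then show ?thesis by simp
    qed
  qed
  then have "continuous_on {C. well_meeting C} (\<lambda>C. (C, snd (ann C)))"
    by (intro continuous_on_Pair continuous_on_id) (rule continuous_on_coordinatewise_then_product)
  moreover have "(\<lambda>C. (C, snd (ann C))) = ann" by (simp add: fun_eq_iff prod_eq_iff)
  ultimately show ?thesis by (simp only:)
qed

definition shift :: "complex \<Rightarrow> (nat \<Rightarrow> complex) \<Rightarrow> nat \<Rightarrow> complex" where
  "shift c C = (\<lambda>v. if v < N then C v + c else 0)"

definition place :: "complex \<Rightarrow> (nat \<Rightarrow> complex) \<times> (nat \<times> nat \<Rightarrow> real) \<Rightarrow> (nat \<Rightarrow> complex) \<times> (nat \<times> nat \<Rightarrow> real)" where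
  "place c X = (shift c (fst X), snd X)"

lemma edge_less: "e < m \<Longrightarrow> e < N" using N by simp

lemma shift_edge: "e < m \<Longrightarrow> shift c C (tg e) - shift c C e = C (tg e) - C e"
  by (simp add: shift_def edge_less)

lemma ann_shift: "ann (shift c C) = place c (ann C)"
  by (auto simp: place_def prod_eq_iff fun_eq_iff snd_ann shift_def edge_less Ord_translate)

lemma continuous_place: "continuous_on UNIV (\<lambda>(c, X). place c X)"
proof -
  have f: "continuous_on UNIV (\<lambda>z :: complex \<times> (nat \<Rightarrow> complex) \<times> (nat \<times> nat \<Rightarrow> real). fst (snd z) v)" for v
    by (rule continuous_on_compose2[OF continuous_on_coord[of UNIV v] continuous_on_fst[OF continuous_on_snd[OF continuous_on_id]]]) simp
  have "continuous_on UNIV (\<lambda>z :: complex \<times> (nat \<Rightarrow> complex) \<times> (nat \<times> nat \<Rightarrow> real). (\<lambda>v. if v < N then fst (snd z) v + fst z else 0, snd (snd z)))"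
  proof (rule continuous_on_Pair[OF continuous_on_coordinatewise_then_product])
    fix v
    show "continuous_on UNIV (\<lambda>z :: complex \<times> (nat \<Rightarrow> complex) \<times> (nat \<times> nat \<Rightarrow> real). if v < N then fst (snd z) v + fst z else 0)"
      by (cases "v < N") (simp_all add: continuous_on_add[OF f continuous_on_fst[OF continuous_on_id]])
  qed (intro continuous_on_snd continuous_on_id)
  then show ?thesis unfolding place_def shift_def by (simp add: case_prod_unfold)
qed

lemma weak_nt_iff: "weak_nt C \<longleftrightarrow> (\<forall>v\<ge>N. C v = 0) \<and> well_meeting C \<and> (\<forall>v<N. \<forall>w<N. C v = C w \<longrightarrow> (shut C)\<^sup>*\<^sup>* v w)"
  unfolding weak_nt_def well_meeting_def by simp

lemma simple_meeting: "C \<in> simple_confs \<Longrightarrow> well_meeting C"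
  unfolding simple_confs_def nt_def well_meeting_def by simp

lemma ann_approx:
  assumes "weak_nt C"
  shows "ann C \<in> closure (ann ` simple_confs)"
proof -
  obtain F where F: "\<And>n. F n \<in> simple_confs" "F \<longlonglongrightarrow> C"
    using weak_nt_approx[OF assms] unfolding closure_sequential by blast
  have "(\<lambda>n. ann (F n)) \<longlonglongrightarrow> ann C"
    using continuous_on_tendsto_compose[OF continuous_ann F(2)] assms F(1) simple_meeting weak_nt_iff by auto
  then show ?thesis unfolding closure_sequential using F(1) by (intro exI[of _ "\<lambda>n. ann (F n)"]) auto
qed

lemma NConf_weak_nt:
  assumes "C \<in> NConf \<epsilon> {..<N} {..<m} (\<lambda>e. e) tg l"
  shows "weak_nt C"
proof -
  obtain l' where nt: "nontouching {..<N} {..<m} (\<lambda>e. e) tg l' C" using assms unfolding NConf_def by blast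
  then have l': "cmod (C (tg e) - C e) = l' e" if "e < m" for e using that unfolding nontouching_def Conf0_def by auto
  have "zero_joined {..<m} (\<lambda>e. e) tg l' \<le> (shut C)\<^sup>*\<^sup>*"
    unfolding zero_joined_def by (rule rtranclp_mono) (use l' in \<open>force simp: shut_def\<close>)
  then show ?thesis using nt unfolding weak_nt_def nontouching_def Conf0_def by auto
qed

lemma simple_NConf:
  assumes C: "C \<in> simple_confs" and l: "\<And>e. e < m \<Longrightarrow> \<bar>cmod (C (tg e) - C e) - l e\<bar> \<le> \<epsilon>"
  shows "C \<in> NConf \<epsilon> {..<N} {..<m} (\<lambda>e. e) tg l"
proof -
  let ?l = "\<lambda>e. cmod (C (tg e) - C e)"
  have nt: "nt C" using C unfolding simple_confs_def by blast
  have no: "\<not> (\<exists>e\<in>{..<m}. ?l e = 0 \<and> (e = x \<and> tg e = y \<or> e = y \<and> tg e = x))" for x y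
    using nt_neq[OF nt, symmetric] by auto
  have "zero_joined {..<m} (\<lambda>e. e) tg ?l v w \<longleftrightarrow> v = w" for v w
  proof
    assume "zero_joined {..<m} (\<lambda>e. e) tg ?l v w"
    then show "v = w" unfolding zero_joined_def by (induction rule: rtranclp_induct) (use no in blast)+
  qed (simp add: zero_joined_def)
  moreover have "inj_on C {..<N}" using nt unfolding nt_def by blast
  ultimately have "nontouching {..<N} {..<m} (\<lambda>e. e) tg ?l C"
    using C simple_meeting[OF C] unfolding nontouching_def Conf0_def well_meeting_def simple_confs_def
    by (auto simp: inj_on_eq_iff)
  then show ?thesis using l unfolding NConf_def by (intro CollectI exI[of _ ?l]) auto
qed

lemma shift_simple: "C \<in> simple_confs \<Longrightarrow> shift c C \<in> simple_confs"
  using nt_translate[of C c] by (simp add: simple_confs_def shift_def)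

text \<open>The lower bound is cut off at 0 because the results on \<open>confs\<close> ask for
  nonnegative bounds. The tolerance for \<open>k = 0\<close> is 1, as in the definition of
  \<open>NCConf0\<close>.\<close>

definition near where
  "near l k = confs (\<lambda>e. max 0 (l e - 1 / real (Suc k))) (\<lambda>e. l e + 1 / real (Suc k))"

definition pinned where "pinned l = (\<Inter>k. closure (ann ` near l k))"

lemma near_iff: "C \<in> near l k \<longleftrightarrow> C \<in> simple_confs \<and> C 0 = 0 \<and> (\<forall>e<m. \<bar>cmod (C (tg e) - C e) - l e\<bar> < 1 / real (Suc k))"
proof -
  have "nt C \<Longrightarrow> e < m \<Longrightarrow> 0 < cmod (C (tg e) - C e)" for e using nt_neq[of C e] by simp
  then show ?thesis unfolding near_def confs_def simple_confs_def mem_Collect_eq max_less_iff_conj abs_less_iff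
    by (smt (verit))
qed

text \<open>Nontouching configurations are limits of simple ones, so a point of
  \<open>NCConf0\<close> is such a limit, too; the bar lengths converge to \<open>l\<close> along
  it, and after translation the sequence enters every \<open>near l k\<close>. Conversely, lying in
  all these closures forces the lengths to be exactly \<open>l\<close>.\<close>

theorem NCConf0_eq:
  "NCConf0 {..<N} {..<m} (\<lambda>e. e) tg l = (\<lambda>(c, X). place c X) ` (UNIV \<times> pinned l)"
proof (intro equalityI subsetI)
  fix X assume X: "X \<in> NCConf0 {..<N} {..<m} (\<lambda>e. e) tg l"
  define D where "D = fst X"
  have D: "\<And>v. N \<le> v \<Longrightarrow> D v = 0" "\<And>e. e < m \<Longrightarrow> cmod (D (tg e) - D e) = l e"
    using X unfolding NCConf0_def Conf0_def D_def by auto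
  have "X \<in> closure (ann ` NConf 1 {..<N} {..<m} (\<lambda>e. e) tg l)" using X unfolding NCConf0_def ann_def by simp
  moreover have "ann ` NConf 1 {..<N} {..<m} (\<lambda>e. e) tg l \<subseteq> closure (ann ` simple_confs)"
    using NConf_weak_nt ann_approx by blast
  ultimately have "X \<in> closure (ann ` simple_confs)" using closure_minimal[OF _ closed_closure] by blast
  then obtain G where G: "\<And>n. G n \<in> ann ` simple_confs" "G \<longlonglongrightarrow> X" unfolding closure_sequential by blast
  define F where "F n = fst (G n)" for n
  have F: "F n \<in> simple_confs" "G n = ann (F n)" for n using G(1)[of n] unfolding F_def by auto
  have FD: "F \<longlonglongrightarrow> D" unfolding F_def D_def by (intro tendsto_fst G(2))
  have Fv: "(\<lambda>n. F n v) \<longlonglongrightarrow> D v" for v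
    using continuous_on_tendsto_compose[OF continuous_on_coord[of UNIV v] FD] by simp
  have "place (- D 0) X \<in> closure (ann ` near l k)" for k
  proof (rule Lim_in_closed_set[OF closed_closure])
    have "(\<lambda>n. (- F n 0, G n)) \<longlonglongrightarrow> (- D 0, X)" by (intro tendsto_Pair tendsto_minus Fv G(2))
    from continuous_on_tendsto_compose[OF continuous_place this]
    show "(\<lambda>n. place (- F n 0) (G n)) \<longlonglongrightarrow> place (- D 0) X" by simp
    have "\<forall>\<^sub>F n in sequentially. \<forall>e\<in>{..<m}. \<bar>cmod (F n (tg e) - F n e) - l e\<bar> < 1 / real (Suc k)"
    proof (intro eventually_ball_finite ballI)
      fix e assume "e \<in> {..<m}"
      then have e: "cmod (D (tg e) - D e) = l e" using D by simp
      have "(\<lambda>n. \<bar>cmod (F n (tg e) - F n e) - l e\<bar>) \<longlonglongrightarrow> \<bar>cmod (D (tg e) - D e) - l e\<bar>"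
        by (intro tendsto_intros Fv)
      then show "\<forall>\<^sub>F n in sequentially. \<bar>cmod (F n (tg e) - F n e) - l e\<bar> < 1 / real (Suc k)"
        unfolding e by (rule order_tendstoD) simp
    qed simp
    then show "\<forall>\<^sub>F n in sequentially. place (- F n 0) (G n) \<in> closure (ann ` near l k)"
    proof eventually_elim
      case (elim n)
      have "shift (- F n 0) (F n) \<in> near l k"
        unfolding near_iff
      proof (intro conjI allI impI)
        show "shift (- F n 0) (F n) \<in> simple_confs" by (rule shift_simple[OF F(1)])
        show "shift (- F n 0) (F n) 0 = 0" using N by (simp add: shift_def)
        show "\<bar>cmod (shift (- F n 0) (F n) (tg e) - shift (- F n 0) (F n) e) - l e\<bar> < 1 / real (Suc k)" if "e < m" for e
          unfolding shift_edge[OF that] using elim that by simp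
      qed
      then have "ann (shift (- F n 0) (F n)) \<in> closure (ann ` near l k)"
        by (intro subsetD[OF closure_subset] imageI)
      then show ?case by (simp only: F(2) ann_shift)
    qed
  qed simp
  then have "place (- D 0) X \<in> pinned l" unfolding pinned_def by blast
  moreover have "shift (D 0) (shift (- D 0) D) = D" using D(1) by (auto simp: shift_def)
  then have "X = place (D 0) (place (- D 0) X)" by (simp add: place_def prod_eq_iff D_def)
  ultimately show "X \<in> (\<lambda>(c, X). place c X) ` (UNIV \<times> pinned l)"
    by (intro image_eqI[of _ _ "(D 0, place (- D 0) X)"]) simp_all
next
  fix Y assume "Y \<in> (\<lambda>(c, X). place c X) ` (UNIV \<times> pinned l)"
  then obtain c X where Y: "Y = place c X" and X: "\<And>k. X \<in> closure (ann ` near l k)" unfolding pinned_def by auto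
  \<comment> \<open>Closed conditions that hold for annotated members of \<open>near l k\<close> and
    so pass to their limits.\<close>
  define Z where "Z k = {Z :: (nat \<Rightarrow> complex) \<times> (nat \<times> nat \<Rightarrow> real). (\<forall>v\<in>{N..}. fst Z v = 0) \<and> (\<forall>e\<in>{..<m}. \<bar>cmod (fst Z (tg e) - fst Z e) - l e\<bar> \<le> 1 / real (Suc k))
    \<and> (\<forall>p\<in>- ({..<m} \<times> {..<m}). snd Z p = 0)}" for k
  have cf: "continuous_on UNIV (\<lambda>Z :: (nat \<Rightarrow> complex) \<times> (nat \<times> nat \<Rightarrow> real). fst Z v)" for v
    by (rule continuous_on_compose2[OF continuous_on_coord[of UNIV v] continuous_on_fst[OF continuous_on_id]]) simp
  have cs: "continuous_on UNIV (\<lambda>Z :: (nat \<Rightarrow> complex) \<times> (nat \<times> nat \<Rightarrow> real). snd Z p)" for p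
    by (rule continuous_on_compose2[OF continuous_on_coord[of UNIV p] continuous_on_snd[OF continuous_on_id]]) simp
  have "closed (Z k)" for k
    unfolding Z_def Ball_def by (intro closed_Collect_conj closed_Collect_all closed_Collect_imp closed_Collect_le closed_Collect_eq
       continuous_intros cf cs open_Collect_const)
  moreover have "ann ` near l k \<subseteq> Z k" for k
  proof
    fix W assume "W \<in> ann ` near l k"
    then obtain C where "W = ann C" "C \<in> near l k" by blast
    moreover have "snd (ann C) p = 0" if "p \<notin> {..<m} \<times> {..<m}" for C p using that by (cases p) (auto simp: snd_ann)
    ultimately show "W \<in> Z k" unfolding near_iff Z_def simple_confs_def by (auto simp: less_imp_le)
  qed
  ultimately have XZ: "X \<in> Z k" for k using X[of k] closure_minimal by blast
  have len: "cmod (fst X (tg e) - fst X e) = l e" if "e < m" for e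
  proof -
    have "\<bar>cmod (fst X (tg e) - fst X e) - l e\<bar> \<le> 1 / real (Suc k)" for k using XZ[of k] that unfolding Z_def by simp
    then have "\<bar>cmod (fst X (tg e) - fst X e) - l e\<bar> \<le> 0"
      by (intro LIMSEQ_le_const[OF LIMSEQ_Suc[OF lim_1_over_n]]) auto
    then show ?thesis by simp
  qed
  have "fst Y \<in> Conf0 {..<N} {..<m} (\<lambda>e. e) tg l"
    unfolding Conf0_def Y place_def using len by (auto simp: shift_edge) (auto simp: shift_def)
  moreover have "snd Y \<in> Matrices {..<m}" using XZ[of 0] unfolding Y place_def Matrices_def Z_def by auto
  moreover have "Y \<in> closure (ann ` NConf 1 {..<N} {..<m} (\<lambda>e. e) tg l)"
  proof -
    have "continuous_on UNIV (place c)"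
      using continuous_on_compose2[OF continuous_place, of UNIV "\<lambda>X. (c, X)"] by (simp add: continuous_on_Pair)
    then have "place c ` closure (ann ` near l 0) \<subseteq> closure (place c ` ann ` near l 0)"
      by (intro image_closure_subset closure_subset) (auto intro: continuous_on_subset)
    moreover have "place c ` ann ` near l 0 \<subseteq> ann ` NConf 1 {..<N} {..<m} (\<lambda>e. e) tg l"
    proof -
      have "shift c C \<in> NConf 1 {..<N} {..<m} (\<lambda>e. e) tg l" if "C \<in> near l 0" for C
      proof (rule simple_NConf)
        show "shift c C \<in> simple_confs" using shift_simple that unfolding near_iff by blast
        show "\<bar>cmod (shift c C (tg e) - shift c C e) - l e\<bar> \<le> 1" if "e < m" for e
          using that \<open>C \<in> near l 0\<close> unfolding near_iff by (auto simp: shift_edge less_imp_le)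
      qed
      then show ?thesis by (auto simp: ann_shift[symmetric])
    qed
    ultimately show ?thesis using X[of 0] closure_mono unfolding Y by blast
  qed
  ultimately show "Y \<in> NCConf0 {..<N} {..<m} (\<lambda>e. e) tg l" unfolding NCConf0_def ann_def by (simp add: mem_Times_iff)
qed

end

section \<open>Connectedness of nested intersections\<close>

text \<open>Each connected \<open>K n\<close> contains both parts of a separation, hence a point
  equally far from both. Compactness gives a common such point, but in the intersection exactly one
  of the two distances is zero.\<close>

lemma connected_decreasing_Inter:
  fixes K :: "nat \<Rightarrow> 'a::metric_space set"
  assumes K: "\<And>n. compact (K n)" "\<And>n. connected (K n)" and dec: "\<And>i j. i \<le> j \<Longrightarrow> K j \<subseteq> K i"
  shows "connected (\<Inter>n. K n)"
proof (rule ccontr)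
  define I where "I = (\<Inter>n. K n)"
  assume "\<not> connected (\<Inter>n. K n)"
  then obtain A B where AB: "closed A" "closed B" "I \<subseteq> A \<union> B" "A \<inter> B \<inter> I = {}" "A \<inter> I \<noteq> {}" "B \<inter> I \<noteq> {}"
    unfolding connected_closed I_def[symmetric] by (simp only: not_not) (elim exE conjE)
  have cl: "closed I" unfolding I_def by (intro closed_INT) (simp add: K compact_imp_closed)
  have IK: "x \<in> K n" if "x \<in> I" for x n using that unfolding I_def by blast
  define g where "g x = infdist x (A \<inter> I) - infdist x (B \<inter> I)" for x
  have g: "continuous_on UNIV g" unfolding g_def[abs_def] by (intro continuous_intros)
  have zA: "infdist x (A \<inter> I) = 0 \<longleftrightarrow> x \<in> A \<inter> I" for x
    by (rule in_closed_iff_infdist_zero[OF closed_Int[OF AB(1) cl] AB(5), symmetric])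
  have zB: "infdist x (B \<inter> I) = 0 \<longleftrightarrow> x \<in> B \<inter> I" for x
    by (rule in_closed_iff_infdist_zero[OF closed_Int[OF AB(2) cl] AB(6), symmetric])
  have zero: "K n \<inter> {x. g x = 0} \<noteq> {}" for n
  proof -
    obtain a b where ab: "a \<in> A \<inter> I" "b \<in> B \<inter> I" using AB(5,6) by blast
    have le: "g a \<le> 0" "0 \<le> g b" unfolding g_def using zA[of a] zB[of b] ab infdist_nonneg by simp_all
    have conn: "connected (g ` K n)" by (rule connected_continuous_image[OF continuous_on_subset[OF g]]) (auto simp: K)
    have "g a \<in> g ` K n" "g b \<in> g ` K n" using ab IK by auto
    from connectedD_interval[OF conn this le] show ?thesis by force
  qed
  have cz: "closed {x. g x = 0}" by (intro closed_Collect_eq g continuous_on_const)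
  have "K 0 \<inter> (\<Inter>n\<in>UNIV. K n \<inter> {x. g x = 0}) \<noteq> {}"
  proof (rule compact_imp_fip_image[OF K(1)])
    fix J :: "nat set" assume J: "finite J"
    have "K (Max (insert 0 J)) \<subseteq> K i" if "i \<in> insert 0 J" for i using that J by (intro dec Max_ge) auto
    then have "K (Max (insert 0 J)) \<inter> {x. g x = 0} \<subseteq> K 0 \<inter> (\<Inter>n\<in>J. K n \<inter> {x. g x = 0})" by blast
    then show "K 0 \<inter> (\<Inter>n\<in>J. K n \<inter> {x. g x = 0}) \<noteq> {}" using zero[of "Max (insert 0 J)"] by blast
  qed (intro closed_Int cz compact_imp_closed K)
  then obtain x where x: "x \<in> I" "g x = 0" unfolding I_def by blast
  then have "infdist x (A \<inter> I) = 0 \<longleftrightarrow> infdist x (B \<inter> I) = 0" unfolding g_def by simp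
  then show False unfolding zA zB using x(1) AB(3,4) by blast
qed

text \<open>A chosen point names the component around each set. For an empty set the choice is
  arbitrary, which does no harm to an upper bound.\<close>

lemma components_two_connected:
  fixes A B :: "'a::topological_space set"
  assumes "connected A" "connected B"
  shows "finite (components (A \<union> B)) \<and> card (components (A \<union> B)) \<le> 2"
proof -
  let ?S = "A \<union> B" and ?c = "\<lambda>T. connected_component_set (A \<union> B) (SOME x. x \<in> T)"
  have comp: "connected_component_set ?S x = ?c T" if T: "connected T" "T \<subseteq> ?S" "x \<in> T" for T x
  proof -
    have "(SOME y. y \<in> T) \<in> T" using T(3) by (rule someI)
    then have "connected_component ?S x (SOME y. y \<in> T)" unfolding connected_component_def using T by blast
    then show ?thesis by (simp add: connected_component_eq_eq connected_component_eq)
  qed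
  have "components ?S \<subseteq> {?c A, ?c B}"
  proof
    fix W assume "W \<in> components ?S"
    then obtain x where "x \<in> ?S" "W = connected_component_set ?S x" unfolding components_def by blast
    then show "W \<in> {?c A, ?c B}" using comp[OF assms(1)] comp[OF assms(2)] by blast
  qed
  moreover have "card {?c A, ?c B} \<le> 2" by (simp add: card_insert_if)
  ultimately show ?thesis using finite_subset[of "components ?S" "{?c A, ?c B}"] card_mono[of "{?c A, ?c B}" "components ?S"]
    by (meson finite.emptyI finite_insert order_trans)
qed

context chain begin

lemma near_simple: "C \<in> near l k \<Longrightarrow> C \<in> simple_confs"
  by (simp only: near_iff)

lemma near_mono: "i \<le> j \<Longrightarrow> near l j \<subseteq> near l i"
proof
  fix C assume ij: "i \<le> j" and C: "C \<in> near l j"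
  have le: "1 / real (Suc j) \<le> 1 / real (Suc i)" using ij by (intro divide_left_mono) auto
  have less: "\<bar>cmod (C (tg e) - C e) - l e\<bar> < 1 / real (Suc i)" if "e < m" for e
  proof -
    have "\<bar>cmod (C (tg e) - C e) - l e\<bar> < 1 / real (Suc j)"
      by (rule conjunct2[OF conjunct2[OF C[unfolded near_iff]], rule_format, OF that])
    then show ?thesis using le by (rule less_le_trans)
  qed
  have "C \<in> simple_confs" by (rule near_simple[OF C])
  moreover have "C 0 = 0" by (rule conjunct1[OF conjunct2[OF C[unfolded near_iff]]])
  ultimately show "C \<in> near l i" unfolding near_iff by (intro conjI allI impI less)
qed

lemma continuous_ann_near: "S \<subseteq> near l k \<Longrightarrow> continuous_on S ann"
  by (rule continuous_on_subset[OF continuous_ann]) (blast intro: simple_meeting near_simple)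

text \<open>Pinning bounds the positions, and an entry of the annotation is at most a bar length by
  \<open>Ord_bound1\<close>.\<close>

lemma compact_closure_ann:
  assumes S: "S \<subseteq> near l k"
  shows "compact (closure (ann ` S))"
proof -
  define R where "R = (\<Sum>e<N. \<bar>l e + 1 / real (Suc k)\<bar>)"
  let ?B = "{C. \<forall>v. C v \<in> cball (0::complex) R} \<times> {A. \<forall>p :: nat \<times> nat. A p \<in> cball (0::real) (2 * R)}"
  have B: "compact ?B" by (intro compact_Times compact_box_fun) auto
  have in_box: "ann C \<in> ?B" if C: "C \<in> near l k" for C
  proof -
    have R0: "0 \<le> R" by (simp add: R_def sum_nonneg)
    have b: "cmod (C v) \<le> R" for v
    proof (cases "v < N")
      case True
      then show ?thesis unfolding R_def using confs_bounded C unfolding near_def by blast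
    next
      case False
      then show ?thesis using C R0 unfolding near_iff simple_confs_def by simp
    qed
    have "\<bar>snd (ann C) p\<bar> \<le> 2 * R" for p
    proof (cases p)
      case (Pair e f)
      show ?thesis
        using Ord_bound1[of "C e" "C (tg e)" "C f" "C (tg f)"] norm_triangle_ineq4[of "C (tg e)" "C e"] b[of e] b[of "tg e"] R0
        by (simp add: Pair snd_ann)
    qed
    then show ?thesis unfolding mem_Times_iff mem_Collect_eq fst_ann mem_cball_0 real_norm_def using b by simp
  qed
  have "ann ` S \<subseteq> ?B" by (intro image_subsetI in_box subsetD[OF S])
  then have "closure (ann ` S) \<subseteq> ?B" by (rule closure_minimal[OF _ compact_imp_closed[OF B]])
  then have "?B \<inter> closure (ann ` S) = closure (ann ` S)" by (rule Int_absorb1)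
  then show ?thesis using compact_Int_closed[OF B closed_closure[of "ann ` S"]] by (simp only:)
qed

lemma connected_Inter_closures:
  assumes "\<And>k. W k \<subseteq> near l k" "\<And>i j. i \<le> j \<Longrightarrow> W j \<subseteq> W i" "\<And>k. connected (W k)"
  shows "connected (\<Inter>k. closure (ann ` W k))"
proof (rule connected_decreasing_Inter)
  show "compact (closure (ann ` W k))" for k by (rule compact_closure_ann[OF assms(1)])
  show "connected (closure (ann ` W k))" for k
    by (intro connected_imp_connected_closure connected_continuous_image continuous_ann_near[OF assms(1)] assms(3))
  show "closure (ann ` W j) \<subseteq> closure (ann ` W i)" if "i \<le> j" for i j
    using assms(2)[OF that] by (intro closure_mono image_mono)
qed

lemma connected_placed:
  assumes "connected P"
  shows "connected ((\<lambda>(c, X). place c X) ` (UNIV \<times> P))"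
  by (intro connected_continuous_image continuous_on_subset[OF continuous_place] connected_Times assms connected_UNIV) auto

theorem open_chain_connected:
  assumes "m = N - 1"
  shows "connected (NCConf0 {..<N} {..<m} (\<lambda>e. e) tg l)"
proof -
  have "connected (pinned l)"
    unfolding pinned_def
  proof (rule connected_Inter_closures)
    show "connected (near l k)" for k unfolding near_def by (intro connected_open_confs assms) auto
  qed (use near_mono in auto)
  then show ?thesis unfolding NCConf0_eq by (rule connected_placed)
qed

text \<open>All components that contain a convex polygon of orientation \<open>\<sigma>\<close>.
  Unlike the polygons alone, the two sides exhaust \<open>near l k\<close>; they are still connected
  and decrease with \<open>k\<close>, as \<open>connected_Inter_closures\<close> demands.\<close>

definition side :: "real \<Rightarrow> (nat \<Rightarrow> real) \<Rightarrow> nat \<Rightarrow> (nat \<Rightarrow> complex) set" where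
  "side \<sigma> l k = {C. \<exists>D. convex_at \<sigma> D \<and> connected_component (near l k) D C}"

lemma connected_side:
  assumes conn: "connected {C \<in> near l k. convex_at \<sigma> C}"
  shows "connected (side \<sigma> l k)"
proof (cases "side \<sigma> l k = {}")
  case False
  then obtain C D where D: "convex_at \<sigma> D" "connected_component (near l k) D C" unfolding side_def by blast
  have "side \<sigma> l k = connected_component_set (near l k) D"
  proof (intro equalityI subsetI)
    fix C' assume "C' \<in> side \<sigma> l k"
    then obtain D' where D': "convex_at \<sigma> D'" "connected_component (near l k) D' C'" unfolding side_def by blast
    have "D \<in> near l k" "D' \<in> near l k" using D D' by (auto dest: connected_component_in)
    then have "connected_component (near l k) D D'"
      unfolding connected_component_def using D D' conn by (intro exI[of _ "{C \<in> near l k. convex_at \<sigma> C}"]) auto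
    then show "C' \<in> connected_component_set (near l k) D" using D'(2) connected_component_trans by (metis mem_Collect_eq)
  qed (use D in \<open>auto simp: side_def\<close>)
  then show ?thesis by simp
qed simp

lemma side_near: "side \<sigma> l k \<subseteq> near l k"
  unfolding side_def by (auto dest: connected_component_in)

lemma side_mono: "i \<le> j \<Longrightarrow> side \<sigma> l j \<subseteq> side \<sigma> l i"
  unfolding side_def using connected_component_of_subset[OF _ near_mono] by blast

theorem closed_chain_components:
  fixes l :: "nat \<Rightarrow> real"
  assumes m: "m = N"
  defines "S \<equiv> NCConf0 {..<N} {..<m} (\<lambda>e. e) tg l"
  shows "finite (components S) \<and> card (components S) \<le> 2"
proof -
  define A where "A \<sigma> = (\<Inter>k. closure (ann ` side \<sigma> l k))" for \<sigma>
  have "connected {C \<in> near l k. convex_at 1 C}" "connected {C \<in> near l k. convex_at (-1) C}" for k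
    unfolding near_def by (intro connected_ccw connected_cw m; simp)+
  then have "connected (side 1 l k)" "connected (side (-1) l k)" for k by (intro connected_side; simp)+
  then have conn: "connected (A 1)" "connected (A (-1))"
    unfolding A_def by (intro connected_Inter_closures[OF side_near side_mono]; simp)+
  have split: "near l k = side 1 l k \<union> side (-1) l k" for k
  proof (intro equalityI subsetI)
    fix C assume C: "C \<in> near l k"
    then have "connected_component_set (near l k) C \<in> components (near l k)" by (rule componentsI)
    then have "\<exists>D\<in>connected_component_set (near l k) C. convex_at 1 D \<or> convex_at (-1) D"
      unfolding near_def by (intro closed_component_convex m) auto
    then obtain D where D: "connected_component (near l k) C D" "convex_at 1 D \<or> convex_at (-1) D" by blast
    then show "C \<in> side 1 l k \<union> side (-1) l k" unfolding side_def using connected_component_sym[OF D(1)] by blast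
  qed (use side_near in blast)
  \<comment> \<open>The intersection commutes with the union because both families decrease: a point
    missing from one closure on each side is missing from both at the larger index.\<close>
  have "pinned l = A 1 \<union> A (-1)"
  proof -
    have "x \<in> A 1 \<or> x \<in> A (-1)" if x: "x \<in> pinned l" for x
    proof (rule ccontr)
      assume "\<not> ?thesis"
      then obtain i j where ij: "x \<notin> closure (ann ` side 1 l i)" "x \<notin> closure (ann ` side (-1) l j)" unfolding A_def by blast
      have "x \<in> closure (ann ` near l (max i j))" using x unfolding pinned_def by blast
      then have "x \<in> closure (ann ` side 1 l (max i j)) \<or> x \<in> closure (ann ` side (-1) l (max i j))"
        unfolding split image_Un closure_Un by blast
      moreover have "closure (ann ` side \<sigma> l (max i j)) \<subseteq> closure (ann ` side \<sigma> l i)"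
        "closure (ann ` side \<sigma> l (max i j)) \<subseteq> closure (ann ` side \<sigma> l j)" for \<sigma>
        by (intro closure_mono image_mono side_mono; simp)+
      ultimately show False using ij by blast
    qed
    moreover have "A \<sigma> \<subseteq> pinned l" for \<sigma>
      unfolding A_def pinned_def by (intro INF_mono' closure_mono image_mono side_near)
    ultimately show ?thesis by blast
  qed
  then have "S = (\<lambda>(c, X). place c X) ` (UNIV \<times> A 1) \<union> (\<lambda>(c, X). place c X) ` (UNIV \<times> A (-1))"
    unfolding S_def NCConf0_eq by (simp only: Sigma_Un_distrib2 image_Un)
  then show ?thesis using components_two_connected[OF connected_placed[OF conn(1)] connected_placed[OF conn(2)]] by simp
qed

end

lemma NCConf0_cong:
  assumes "\<And>e. e \<in> E \<Longrightarrow> tgt e = tgt' e"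
  shows "NCConf0 V E src tgt l = NCConf0 V E src tgt' l"
proof -
  have c: "Conf0 V E src tgt k = Conf0 V E src tgt' k" for k
    using assms by (simp add: Conf0_def)
  have "Annot E src tgt = Annot E src tgt'"
    using assms by (simp add: Annot_def fun_eq_iff)
  moreover have "zero_joined E src tgt = zero_joined E src tgt'"
    using assms by (simp add: zero_joined_def fun_eq_iff cong: bex_cong conj_cong)
  then have "nontouching V E src tgt k C = nontouching V E src tgt' k C" for k C
    using assms by (simp add: nontouching_def c)
  then have "NConf 1 V E src tgt l = NConf 1 V E src tgt' l"
    by (simp add: NConf_def)
  ultimately show ?thesis by (simp add: NCConf0_def c)
qed

text \<open>Separate because the locale \<open>chain\<close> starts with two vertices; without bars
  the space is a copy of the plane.\<close>

lemma connected_one_vertex: "connected (open_chain_NCConf 0 l)"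
proof -
  let ?S = "{C :: nat \<Rightarrow> complex. \<forall>v. v \<noteq> 0 \<longrightarrow> C v = 0}"
  have A: "Annot {} (\<lambda>i. i) Suc C = (C, \<lambda>p. 0)" for C by (auto simp: Annot_def)
  have "NConf 1 {..0} {} (\<lambda>i. i) Suc l = ?S"
    by (auto simp: NConf_def nontouching_def Conf0_def zero_joined_def)
  moreover have "Matrices {} = {\<lambda>p. 0}" by (auto simp: Matrices_def fun_eq_iff)
  then have "Conf0 {..0} {} (\<lambda>i. i) Suc l \<times> Matrices {} = (\<lambda>C. (C, \<lambda>p. 0)) ` ?S"
    by (auto simp: Conf0_def)
  ultimately have "open_chain_NCConf 0 l = (\<lambda>C. (C, \<lambda>p. 0)) ` ?S"
    unfolding open_chain_NCConf_def NCConf0_def lessThan_0 A[abs_def]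
    by (simp only: Int_absorb2[OF closure_subset])
  also have "\<dots> = (\<lambda>c. (\<lambda>v. if v = 0 then c else 0, \<lambda>p. 0)) ` UNIV"
  proof -
    have "?S = (\<lambda>c v. if v = 0 then c else 0) ` UNIV"
      by (force simp: image_iff fun_eq_iff)
    then show ?thesis by (simp add: image_image)
  qed
  also have "connected \<dots>"
  proof (intro connected_continuous_image connected_UNIV continuous_on_Pair continuous_on_const continuous_on_coordinatewise_then_product)
    fix v :: nat
    show "continuous_on UNIV (\<lambda>c :: complex. if v = 0 then c else 0)"
      by (cases "v = 0") (simp_all add: continuous_on_id)
  qed
  finally show ?thesis .
qed

theorem mainTheorem8:
  shows "(\<forall>(n::nat) (l::nat \<Rightarrow> real). (\<forall>i<n. 0 \<le> l i) \<longrightarrow>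
            connected (open_chain_NCConf n l)) \<and>
         (\<forall>(n::nat) (l::nat \<Rightarrow> real). 3 \<le> n \<and> (\<forall>i<n. 0 \<le> l i) \<longrightarrow>
            finite (components (closed_chain_NCConf n l)) \<and>
            card (components (closed_chain_NCConf n l)) \<le> 2)"
proof (intro conjI[of "\<forall>n l. _ n l"] allI impI)
  fix n and l :: "nat \<Rightarrow> real"
  show "connected (open_chain_NCConf n l)"
  proof (cases "n = 0")
    case True
    then show ?thesis using connected_one_vertex by simp
  next
    case False
    then interpret chain "Suc n" n by unfold_locales auto
    have "open_chain_NCConf n l = NCConf0 {..<Suc n} {..<n} (\<lambda>e. e) tg l"
      unfolding open_chain_NCConf_def lessThan_Suc_atMost by (rule NCConf0_cong) (simp add: tg_Suc)
    then show ?thesis using open_chain_connected by simp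
  qed
next
  fix n and l :: "nat \<Rightarrow> real"
  assume "3 \<le> n \<and> (\<forall>i<n. 0 \<le> l i)"
  then interpret chain n n by unfold_locales auto
  have "closed_chain_NCConf n l = NCConf0 {..<n} {..<n} (\<lambda>e. e) tg l"
    unfolding closed_chain_NCConf_def tg_def[abs_def] ..
  then show "finite (components (closed_chain_NCConf n l)) \<and> card (components (closed_chain_NCConf n l)) \<le> 2"
    using closed_chain_components by simp
qed

end
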